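(* For every $c\in\mathbb{C}$, the Zhu algebra $A(\mathcal{V}_c)$ is commutative, so all irreducible, admissible $\mathcal{V}_c$-modules are highest-weight modules.
   Context: Definition of $\mathcal{V}_c$. Let $\mathcal{D}$ be the Lie algebra of regular differential operators on the circle with coordinate $t$, with basis $t^{l+k}(\partial_t)^l$, $k\in\mathbb{Z}$, $l\in\mathbb{Z}_{\ge0}$. It has the 2-cocycle $\Psi\big(f(t)(\partial_t)^m,g(t)(\partial_t)^n\big)=\frac{m!\,n!}{(m+n+1)!}\,\mathrm{Res}_{t=0}f^{(n+1)}(t)g^{(m)}(t)\,dt$ and corresponding central extension $\hat{\mathcal{D}}=\mathcal{D}\oplus\mathbb{C}\kappa$. For $k\in\mathbb{Z}$ and odd $m\ge1$ set $W^m_k=-\frac12\big(t^{k+m}(\partial_t)^m+(-1)^{m+1}(\partial_t)^m t^{k+m}\big)$. These span a Lie subalgebra $\mathcal{D}^+\subset\mathcal{D}$; let $\hat{\mathcal{D}}^+=\mathcal{D}^+\oplus\mathbb{C}\kappa$. Let $\mathcal{P}^+$ be the span of the $W^m_k$ with $m+k\ge0$ (a subalgebra of $\hat{\mathcal{D}}^+$ since $\Psi$ vanishes on it). For $c\in\mathbb{C}$ let $\mathcal{M}^+_c=U(\hat{\mathcal{D}}^+)\otimes_{U(\mathcal{P}^+\oplus\mathbb{C}\kappa)}\mathbb{C}_0$, where $\mathcal{P}^+$ acts on $\mathbb{C}_0=\mathbb{C}$ by zero and $\kappa$ by $c$. It is a vertex algebra freely generated by the fields $W^m(z)=\sum_{k}W^m_kz^{-k-m-1}$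 of weight $m+1$ ($m\ge 1$ odd). The simple vertex algebra $\mathcal{V}_c$ is the quotient of $\mathcal{M}^+_c$ by its maximal proper graded $\hat{\mathcal{D}}^+$-submodule. Zhu algebra. For a vertex algebra $\mathcal{W}=\bigoplus_{n\in\mathbb{Z}}\mathcal{W}_n$ graded by weight, and $a\in\mathcal{W}_m$, $b\in\mathcal{W}$, put $a*b=\mathrm{Res}_z\big(a(z)\frac{(z+1)^m}{z}b\big)$ and $a\circ b=\mathrm{Res}_z\big(a(z)\frac{(z+1)^m}{z^2}b\big)$, extended linearly. Let $O(\mathcal{W})$ be the span of all $a\circ b$. Then $A(\mathcal{W})=\mathcal{W}/O(\mathcal{W})$ is a unital associative algebra under $*$. A $\mathbb{Z}_{\ge0}$-graded $\mathcal{W}$-module $M=\bigoplus_{n\ge0}M_n$ is admissible if for every $a\in\mathcal{W}_m$, with $a(z)=\sum_n a(n)z^{-n-1}$, one has $a(n)M_k\subset M_{m+k-n-1}$ for all $n\in\mathbb{Z}$. When $A(\mathcal{W})$ is commutative, an irreducible admissible module $M$ is called a highest-weight module if $M_0$ is one-dimensional and $M$ is generated by any nonzero $v\in M_0$ (a highest-weight vector).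
   Formalization: Irreducible admissible modules are additionally assumed to have nonzero lowest component M_0; without this, V_c with its grading shifted up by one is irreducible and admissible but has M_0 = 0, so it is not a highest-weight module. *)

theory Defs
  imports
    Complex_Main
    "HOL-Library.Poly_Mapping"
    "HOL-Library.Product_Plus"
    "HOL-Algebra.Module"
    "HOL-Algebra.QuotRing"
begin

section \<open>Complex vector spaces as HOL-Algebra modules\<close>

definition complex_ring :: "complex ring" where
  "complex_ring = \<lparr>carrier = UNIV, mult = (*), one = 1, zero = 0, add = (+)\<rparr>"

abbreviation subspace_of :: "'v set \<Rightarrow> (complex, 'v, 'x) module_scheme \<Rightarrow> bool" where
  "subspace_of H M \<equiv> submodule H complex_ring M"

definition lspan :: "(complex, 'v, 'x) module_scheme \<Rightarrow> 'v set \<Rightarrow> 'v set" where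
  "lspan M S = \<Inter>{H. subspace_of H M \<and> S \<subseteq> H}"

text \<open>The fields \<^const>\<open>mult\<close> and \<^const>\<open>one\<close> of a module record carry no
  information for a vector space.\<close>

definition vec_space :: "'v::ab_group_add set \<Rightarrow> (complex \<Rightarrow> 'v \<Rightarrow> 'v) \<Rightarrow> (complex, 'v) module" where
  "vec_space S scale =
    \<lparr>carrier = S, mult = (\<lambda>_ _. 0), one = 0, zero = 0, add = (+), smult = scale\<rparr>"

text \<open>Quotient by a subspace, with elements the cosets, and the map on cosets induced by a map
  preserving the subspace (in the style of \<^const>\<open>rcoset_mult\<close>).\<close>

definition quot_space ::
  "(complex, 'v, 'x) module_scheme \<Rightarrow> 'v set \<Rightarrow> (complex, 'v set) module" where
  "quot_space M N =
    \<lparr>carrier = a_rcosets\<^bsub>M\<^esub> N, mult = (\<lambda>_ _. N), one = N, zero = N, add = set_add M,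
     smult = (\<lambda>z X. \<Union>x\<in>X. N +>\<^bsub>M\<^esub> (z \<odot>\<^bsub>M\<^esub> x))\<rparr>"

definition quot_map ::
  "(complex, 'v, 'x) module_scheme \<Rightarrow> 'v set \<Rightarrow> ('v \<Rightarrow> 'v) \<Rightarrow> 'v set \<Rightarrow> 'v set" where
  "quot_map M N g X = (\<Union>x\<in>X. N +>\<^bsub>M\<^esub> g x)"

text \<open>Sum of a family of which only finitely many members are nonzero.\<close>

definition fin_sum :: "(complex, 'v, 'x) module_scheme \<Rightarrow> ('i \<Rightarrow> 'v) \<Rightarrow> 'v" where
  "fin_sum M f = finsum M f {i. f i \<noteq> \<zero>\<^bsub>M\<^esub>}"

definition decomposes ::
  "(complex, 'v, 'x) module_scheme \<Rightarrow> (int \<Rightarrow> 'v set) \<Rightarrow> 'v \<Rightarrow> (int \<Rightarrow> 'v) \<Rightarrow> bool" where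
  "decomposes M gr x f \<longleftrightarrow>
    (\<forall>n. f n \<in> gr n) \<and> finite {n. f n \<noteq> \<zero>\<^bsub>M\<^esub>} \<and> x = fin_sum M f"

definition direct_sum ::
  "(complex, 'v, 'x) module_scheme \<Rightarrow> (int \<Rightarrow> 'v set) \<Rightarrow> bool" where
  "direct_sum M gr \<longleftrightarrow>
    (\<forall>n. subspace_of (gr n) M) \<and> (\<forall>x\<in>carrier M. \<exists>!f. decomposes M gr x f)"

definition component ::
  "(complex, 'v, 'x) module_scheme \<Rightarrow> (int \<Rightarrow> 'v set) \<Rightarrow> 'v \<Rightarrow> int \<Rightarrow> 'v" where
  "component M gr x = (THE f. decomposes M gr x f)"

section \<open>Vertex algebras and their modules\<close>

text \<open>\<open>nprod W a n b\<close> is $a(n)b$, where $a(z) = \sum_n a(n) z^{-n-1}$.\<close>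

record 'v vertex_alg = "(complex, 'v) module" +
  vac :: 'v
  nprod :: "'v \<Rightarrow> int \<Rightarrow> 'v \<Rightarrow> 'v"
  wt :: "int \<Rightarrow> 'v set"

text \<open>The Borcherds identity. For both sums all but finitely many terms vanish because
  \<open>a(n)u = 0\<close> for \<open>n\<close> large.\<close>

definition borcherds_identity ::
  "('v, 'x) vertex_alg_scheme \<Rightarrow> (complex, 'm, 'y) module_scheme
    \<Rightarrow> ('v \<Rightarrow> int \<Rightarrow> 'm \<Rightarrow> 'm) \<Rightarrow> bool" where
  "borcherds_identity W M act \<longleftrightarrow>
    (\<forall>a\<in>carrier W. \<forall>b\<in>carrier W. \<forall>u\<in>carrier M. \<forall>m n k.
      fin_sum M (\<lambda>j::nat.
        ((of_int m gchoose j) \<odot>\<^bsub>M\<^esub> act (nprod W a (n + int j) b) (m + k - int j) u))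
      = fin_sum M (\<lambda>j::nat.
        (((-1) ^ j * (of_int n gchoose j)) \<odot>\<^bsub>M\<^esub>
          (act a (m + n - int j) (act b (k + int j) u)
           \<ominus>\<^bsub>M\<^esub> ((-1) powi n) \<odot>\<^bsub>M\<^esub> act b (n + k - int j) (act a (m + int j) u)))))"

definition va_module ::
  "('v, 'x) vertex_alg_scheme \<Rightarrow> (complex, 'm, 'y) module_scheme
    \<Rightarrow> ('v \<Rightarrow> int \<Rightarrow> 'm \<Rightarrow> 'm) \<Rightarrow> bool" where
  "va_module W M act \<longleftrightarrow>
    module complex_ring M \<and>
    (\<forall>a\<in>carrier W. \<forall>n. \<forall>u\<in>carrier M. act a n u \<in> carrier M) \<and>
    (\<forall>a\<in>carrier W. \<forall>b\<in>carrier W. \<forall>n. \<forall>u\<in>carrier M.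
      act (a \<oplus>\<^bsub>W\<^esub> b) n u = act a n u \<oplus>\<^bsub>M\<^esub> act b n u) \<and>
    (\<forall>z. \<forall>a\<in>carrier W. \<forall>n. \<forall>u\<in>carrier M. act (z \<odot>\<^bsub>W\<^esub> a) n u = z \<odot>\<^bsub>M\<^esub> act a n u) \<and>
    (\<forall>a\<in>carrier W. \<forall>n. \<forall>u\<in>carrier M. \<forall>v\<in>carrier M.
      act a n (u \<oplus>\<^bsub>M\<^esub> v) = act a n u \<oplus>\<^bsub>M\<^esub> act a n v) \<and>
    (\<forall>z. \<forall>a\<in>carrier W. \<forall>n. \<forall>u\<in>carrier M. act a n (z \<odot>\<^bsub>M\<^esub> u) = z \<odot>\<^bsub>M\<^esub> act a n u) \<and>
    (\<forall>a\<in>carrier W. \<forall>u\<in>carrier M. \<exists>N. \<forall>n\<ge>N. act a n u = \<zero>\<^bsub>M\<^esub>) \<and>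
    (\<forall>n. \<forall>u\<in>carrier M. act (vac W) n u = (if n = -1 then u else \<zero>\<^bsub>M\<^esub>)) \<and>
    borcherds_identity W M act"

text \<open>Borcherds' form of the axioms; the translation operator is \<open>a \<mapsto> a(-2)1\<close>.\<close>

definition vertex_algebra :: "('v, 'x) vertex_alg_scheme \<Rightarrow> bool" where
  "vertex_algebra W \<longleftrightarrow>
    va_module W W (nprod W) \<and>
    vac W \<in> carrier W \<and>
    (\<forall>a\<in>carrier W. nprod W a (-1) (vac W) = a \<and>
      (\<forall>n\<ge>0. nprod W a n (vac W) = \<zero>\<^bsub>W\<^esub>))"

definition va_submodule ::
  "('v, 'x) vertex_alg_scheme \<Rightarrow> (complex, 'm, 'y) module_scheme
    \<Rightarrow> ('v \<Rightarrow> int \<Rightarrow> 'm \<Rightarrow> 'm) \<Rightarrow> 'm set \<Rightarrow> bool" where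
  "va_submodule W M act H \<longleftrightarrow>
    subspace_of H M \<and> (\<forall>a\<in>carrier W. \<forall>n. \<forall>u\<in>H. act a n u \<in> H)"

definition va_irreducible ::
  "('v, 'x) vertex_alg_scheme \<Rightarrow> (complex, 'm, 'y) module_scheme
    \<Rightarrow> ('v \<Rightarrow> int \<Rightarrow> 'm \<Rightarrow> 'm) \<Rightarrow> bool" where
  "va_irreducible W M act \<longleftrightarrow>
    carrier M \<noteq> {\<zero>\<^bsub>M\<^esub>} \<and>
    (\<forall>H. va_submodule W M act H \<longrightarrow> H = {\<zero>\<^bsub>M\<^esub>} \<or> H = carrier M)"

definition va_generated ::
  "('v, 'x) vertex_alg_scheme \<Rightarrow> (complex, 'm, 'y) module_scheme
    \<Rightarrow> ('v \<Rightarrow> int \<Rightarrow> 'm \<Rightarrow> 'm) \<Rightarrow> 'm \<Rightarrow> 'm set" where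
  "va_generated W M act v = \<Inter>{H. va_submodule W M act H \<and> v \<in> H}"

text \<open>Gradings by nonnegative integers are indexed by \<open>int\<close>, the negative components being zero.\<close>

definition admissible ::
  "('v, 'x) vertex_alg_scheme \<Rightarrow> (complex, 'm, 'y) module_scheme
    \<Rightarrow> ('v \<Rightarrow> int \<Rightarrow> 'm \<Rightarrow> 'm) \<Rightarrow> (int \<Rightarrow> 'm set) \<Rightarrow> bool" where
  "admissible W M act gr \<longleftrightarrow>
    va_module W M act \<and> direct_sum M gr \<and> (\<forall>n<0. gr n = {\<zero>\<^bsub>M\<^esub>}) \<and>
    (\<forall>m. \<forall>a\<in>wt W m. \<forall>n k. \<forall>u\<in>gr k. act a n u \<in> gr (m + k - n - 1))"

definition highest_weight_module ::
  "('v, 'x) vertex_alg_scheme \<Rightarrow> (complex, 'm, 'y) module_scheme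
    \<Rightarrow> ('v \<Rightarrow> int \<Rightarrow> 'm \<Rightarrow> 'm) \<Rightarrow> (int \<Rightarrow> 'm set) \<Rightarrow> bool" where
  "highest_weight_module W M act gr \<longleftrightarrow>
    (\<exists>v\<in>gr 0. v \<noteq> \<zero>\<^bsub>M\<^esub> \<and> gr 0 = {z \<odot>\<^bsub>M\<^esub> v | z. True}) \<and>
    (\<forall>v\<in>gr 0. v \<noteq> \<zero>\<^bsub>M\<^esub> \<longrightarrow> va_generated W M act v = carrier M)"

text \<open>Quotient by an ideal.\<close>

definition quot_va :: "('v, 'x) vertex_alg_scheme \<Rightarrow> 'v set \<Rightarrow> 'v set vertex_alg" where
  "quot_va W I = module.extend (quot_space W I)
    (vertex_alg.fields
      (I +>\<^bsub>W\<^esub> vac W)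
      (\<lambda>X n Y. \<Union>x\<in>X. \<Union>y\<in>Y. I +>\<^bsub>W\<^esub> nprod W x n y)
      (\<lambda>n. (\<lambda>x. I +>\<^bsub>W\<^esub> x) ` wt W n))"

section \<open>The Zhu algebra\<close>

text \<open>\<open>zhu_res W m p a b\<close> is $\mathrm{Res}_z\, a(z) (1+z)^m z^{-p} b$, with $(1+z)^m$ expanded in
  nonnegative powers of $z$.\<close>

definition zhu_res ::
  "('v, 'x) vertex_alg_scheme \<Rightarrow> int \<Rightarrow> int \<Rightarrow> 'v \<Rightarrow> 'v \<Rightarrow> 'v" where
  "zhu_res W m p a b =
    fin_sum W (\<lambda>j::nat. (of_int m gchoose j) \<odot>\<^bsub>W\<^esub> nprod W a (int j - p) b)"

definition zhu_star :: "('v, 'x) vertex_alg_scheme \<Rightarrow> 'v \<Rightarrow> 'v \<Rightarrow> 'v" where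
  "zhu_star W a b = fin_sum W (\<lambda>m. zhu_res W m 1 (component W (wt W) a m) b)"

definition zhu_O :: "('v, 'x) vertex_alg_scheme \<Rightarrow> 'v set" where
  "zhu_O W = lspan W {zhu_res W m 2 a b | m a b. a \<in> wt W m \<and> b \<in> carrier W}"

definition zhu_algebra :: "('v, 'x) vertex_alg_scheme \<Rightarrow> (complex, 'v set) module" where
  "zhu_algebra W = (quot_space W (zhu_O W))
    \<lparr>mult := (\<lambda>X Y. \<Union>a\<in>X. \<Union>b\<in>Y. zhu_O W +>\<^bsub>W\<^esub> zhu_star W a b),
     one := zhu_O W +>\<^bsub>W\<^esub> vac W\<rparr>"

section \<open>Regular differential operators on the circle\<close>

type_synonym laurent = "int \<Rightarrow>\<^sub>0 complex"
type_synonym diffop = "nat \<Rightarrow>\<^sub>0 laurent"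

text \<open>Laurent polynomials in $t$ (the product of \<^typ>\<open>int \<Rightarrow>\<^sub>0 complex\<close> is convolution), and
  differential operators $\sum_m f_m(t) \partial_t^m$ given by $m \mapsto f_m$. The composition of
  operators is \<open>dcomp\<close>, not the product that \<^typ>\<open>nat \<Rightarrow>\<^sub>0 laurent\<close> has as a type of polynomials.\<close>

abbreviation coef :: "('a \<Rightarrow>\<^sub>0 'b::zero) \<Rightarrow> 'a \<Rightarrow> 'b" where
  "coef \<equiv> Poly_Mapping.lookup"

definition ldiff :: "laurent \<Rightarrow> laurent" where
  "ldiff f = (\<Sum>k\<in>Poly_Mapping.keys f. Poly_Mapping.single (k - 1) (of_int k * coef f k))"

definition lresidue :: "laurent \<Rightarrow> complex" where
  "lresidue f = coef f (-1)"

text \<open>\<open>dmono a l\<close> is $t^a \partial_t^l$.\<close>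

definition dmono :: "int \<Rightarrow> nat \<Rightarrow> diffop" where
  "dmono a l = Poly_Mapping.single l (Poly_Mapping.single a 1)"

definition dscale :: "complex \<Rightarrow> diffop \<Rightarrow> diffop" where
  "dscale z = Poly_Mapping.map (Poly_Mapping.map ((*) z))"

text \<open>$f \partial^m \circ g \partial^n = \sum_i \binom{m}{i} f g^{(i)} \partial^{m+n-i}$ (Leibniz).\<close>

definition dcomp :: "diffop \<Rightarrow> diffop \<Rightarrow> diffop" where
  "dcomp A B = (\<Sum>m\<in>Poly_Mapping.keys A. \<Sum>n\<in>Poly_Mapping.keys B. \<Sum>i\<le>m.
    Poly_Mapping.single (m + n - i) (of_nat (m choose i) * coef A m * (ldiff ^^ i) (coef B n)))"

definition dcocycle :: "diffop \<Rightarrow> diffop \<Rightarrow> complex" where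
  "dcocycle A B = (\<Sum>m\<in>Poly_Mapping.keys A. \<Sum>n\<in>Poly_Mapping.keys B.
    (fact m * fact n / fact (m + n + 1)) *
    lresidue ((ldiff ^^ (n + 1)) (coef A m) * (ldiff ^^ m) (coef B n)))"

text \<open>The pair \<open>(A, z)\<close> is $A + z\kappa$.\<close>

type_synonym dhat = "diffop \<times> complex"

definition dhat_scale :: "complex \<Rightarrow> dhat \<Rightarrow> dhat" where
  "dhat_scale z x = (dscale z (fst x), z * snd x)"

definition dhat_bracket :: "dhat \<Rightarrow> dhat \<Rightarrow> dhat" where
  "dhat_bracket x y =
    (dcomp (fst x) (fst y) - dcomp (fst y) (fst x), dcocycle (fst x) (fst y))"

definition kappa :: dhat where
  "kappa = (0, 1)"

text \<open>\<open>W_op m k\<close> is $W^m_k$.\<close>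

definition W_op :: "nat \<Rightarrow> int \<Rightarrow> diffop" where
  "W_op m k = dscale (- 1 / 2)
    (dmono (k + int m) m
     + dscale ((-1) ^ (m + 1)) (dcomp (dmono 0 m) (dmono (k + int m) 0)))"

definition D_plus :: "diffop set" where
  "D_plus = lspan (vec_space UNIV dscale) {W_op m k | m k. odd m}"

definition P_plus :: "diffop set" where
  "P_plus = lspan (vec_space UNIV dscale) {W_op m k | m k. odd m \<and> int m + k \<ge> 0}"

definition D_plus_hat :: "dhat set" where
  "D_plus_hat = D_plus \<times> UNIV"

section \<open>The generalized Verma module and its simple quotient\<close>

text \<open>Elements of the free associative algebra on the set \<open>D_plus_hat\<close> are finite linear
  combinations of words.\<close>

type_synonym free_alg = "dhat list \<Rightarrow>\<^sub>0 complex"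

definition word :: "dhat list \<Rightarrow> free_alg" where
  "word w = Poly_Mapping.single w 1"

definition free_scale :: "complex \<Rightarrow> free_alg \<Rightarrow> free_alg" where
  "free_scale z = Poly_Mapping.map ((*) z)"

definition free_space :: "(complex, free_alg) module" where
  "free_space = vec_space {f. Poly_Mapping.keys f \<subseteq> lists D_plus_hat} free_scale"

text \<open>The two-sided ideal of relations of $U(\hat{\mathcal D}^+)$ together with the left ideal
  generated by $\mathcal P^+$ and $\kappa - c$. Dividing the free algebra by their sum gives
  $U(\hat{\mathcal D}^+) \otimes_{U(\mathcal P^+ \oplus \mathbb C\kappa)} \mathbb C_0$, a word
  $w$ representing $w \otimes 1$.\<close>

definition enveloping_relations :: "free_alg set" where
  "enveloping_relations =
    {word (u @ [dhat_scale a x + dhat_scale b y] @ v)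
        - free_scale a (word (u @ [x] @ v)) - free_scale b (word (u @ [y] @ v))
      | a b x y u v. x \<in> D_plus_hat \<and> y \<in> D_plus_hat
          \<and> u \<in> lists D_plus_hat \<and> v \<in> lists D_plus_hat}
    \<union> {word (u @ [x, y] @ v) - word (u @ [y, x] @ v) - word (u @ [dhat_bracket x y] @ v)
      | x y u v. x \<in> D_plus_hat \<and> y \<in> D_plus_hat
          \<and> u \<in> lists D_plus_hat \<and> v \<in> lists D_plus_hat}"

definition induction_relations :: "complex \<Rightarrow> free_alg set" where
  "induction_relations c =
    {word (u @ [(p, 0)]) | p u. p \<in> P_plus \<and> u \<in> lists D_plus_hat}
    \<union> {word (u @ [kappa]) - free_scale c (word u) | u. u \<in> lists D_plus_hat}"

definition M_relations :: "complex \<Rightarrow> free_alg set" where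
  "M_relations c = lspan free_space (enveloping_relations \<union> induction_relations c)"

type_synonym M_elem = "free_alg set"

definition M_space :: "complex \<Rightarrow> (complex, M_elem) module" where
  "M_space c = quot_space free_space (M_relations c)"

definition M_word :: "complex \<Rightarrow> dhat list \<Rightarrow> M_elem" where
  "M_word c w = M_relations c +>\<^bsub>free_space\<^esub> word w"

definition free_left_mult :: "dhat \<Rightarrow> free_alg \<Rightarrow> free_alg" where
  "free_left_mult x f = (\<Sum>w\<in>Poly_Mapping.keys f. Poly_Mapping.single (x # w) (coef f w))"

definition M_action :: "complex \<Rightarrow> dhat \<Rightarrow> M_elem \<Rightarrow> M_elem" where
  "M_action c x = quot_map free_space (M_relations c) (free_left_mult x)"

text \<open>Weight grading, for which $W^m_k$ has degree $-k$ and the vacuum degree $0$.\<close>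

definition M_weight :: "complex \<Rightarrow> int \<Rightarrow> M_elem set" where
  "M_weight c n = lspan (M_space c)
    {M_word c (map (\<lambda>(m, k). (W_op m k, 0)) ws) | ws.
       (\<forall>(m, k)\<in>set ws. odd m) \<and> (\<Sum>(m, k)\<leftarrow>ws. - k) = n}"

definition graded_submodule :: "complex \<Rightarrow> M_elem set \<Rightarrow> bool" where
  "graded_submodule c H \<longleftrightarrow>
    subspace_of H (M_space c) \<and>
    (\<forall>x\<in>D_plus_hat. \<forall>v\<in>H. M_action c x v \<in> H) \<and>
    H = lspan (M_space c) (\<Union>n. H \<inter> M_weight c n)"

text \<open>The sum of all proper graded submodules; none of them meets the line of weight \<open>0\<close> spanned by
  the vacuum, so the sum is proper, and it is the maximal one.\<close>

definition maximal_submodule :: "complex \<Rightarrow> M_elem set" where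
  "maximal_submodule c =
    lspan (M_space c) (\<Union>{H. graded_submodule c H \<and> H \<noteq> carrier (M_space c)})"

definition M_with :: "complex \<Rightarrow> (M_elem \<Rightarrow> int \<Rightarrow> M_elem \<Rightarrow> M_elem) \<Rightarrow> M_elem vertex_alg" where
  "M_with c Y = module.extend (M_space c) (vertex_alg.fields (M_word c []) Y (M_weight c))"

text \<open>\<open>Y\<close> is the vertex algebra structure on the module with vacuum $1 \otimes 1$ for which the
  state $W^m_{-m-1} (1 \otimes 1)$ has the field $W^m(z) = \sum_k W^m_k z^{-k-m-1}$, so that
  $W^m(n) = W^m_{n-m}$. By the reconstruction theorem there is exactly one such structure (up to
  the irrelevant values of \<open>Y\<close> off the carrier).\<close>

definition state_field_map ::
  "complex \<Rightarrow> (M_elem \<Rightarrow> int \<Rightarrow> M_elem \<Rightarrow> M_elem) \<Rightarrow> bool" where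
  "state_field_map c Y \<longleftrightarrow>
    vertex_algebra (M_with c Y) \<and>
    (\<forall>m n. odd m \<longrightarrow> (\<forall>v\<in>carrier (M_space c).
      Y (M_word c [(W_op m (- int m - 1), 0)]) n v = M_action c (W_op m (n - int m), 0) v))"

definition V_simple ::
  "complex \<Rightarrow> (M_elem \<Rightarrow> int \<Rightarrow> M_elem \<Rightarrow> M_elem) \<Rightarrow> M_elem set vertex_alg" where
  "V_simple c Y = quot_va (M_with c Y) (maximal_submodule c)"

end

theory Submission
  imports Defs "HOL-Analysis.Continuum_Not_Denumerable" "HOL-Computational_Algebra.Fundamental_Theorem_Algebra"
begin

text \<open>
  Smear the modes of a state with Laurent polynomials, $a[f] = \sum_n f_n a(n)$. For \<open>a\<close> of weight
  \<open>m\<close> the Zhu product is $a * b = a[(1+t)^m t^{-1}] b$, and $O$ is spanned by the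
  $a[(1+t)^m t^{-2}] b$. Because the translation operator satisfies $(Ta)[g] = -a[g']$, the subspace
  $O$ contains $a[(1+t)^m h] b$ whenever $h$ has degree at most $-2$ at infinity (\<open>md_O\<close>). The
  Borcherds identity, written for the function $(1+t)^m$ (\<open>borcherds_tshift\<close>), then shows that $O$
  is a two-sided ideal for $*$ and that $*$ is associative modulo $O$ (\<open>star_O_right\<close>,
  \<open>star_O_left\<close>, \<open>star_assoc\<close>).

  In $\mathcal M_c^+$ the generator $w_r$ of weight $r + 1$ has as its smeared modes the differential
  operators $W^r[f] = -(f \partial^r + \partial^r f)/2$. Left multiplication by $w_r$ is therefore
  $L_r = W^r[(1+t)^{r+1} t^{-1}]$. The coefficient of $\partial^l$ in $L_r$ has degree at most $l$ and
  is divisible by $(1+t)^{l+1}$. Operators with this degree bound act on $t^d$, to leading order at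
  infinity, by scalars depending on $d$; so in $[L_q, L_r]$ the degree drops by one, while the
  divisibility persists. The commutator is skew-adjoint and hence a combination of operators
  $W^p[(1+t)^{p+1} h]$ with $h$ of degree at most $-2$ (\<open>Lop_commutator\<close>), which have values in $O$.
  The cocycle vanishes on operators with the first degree bound (\<open>dcocycle_degree_0\<close>), which
  is why the result does not depend on $c$. So the left multiplications $L_r$ commute modulo $O$. Moreover
  $\mathcal M_c^+$ is spanned by $O$ and the $L_{r_1} \cdots L_{r_k} 1$, by induction on the length of
  words (\<open>Fil_span\<close>). With associativity this gives $a * b - b * a \in O$ (\<open>star_comm\<close>).

  The maximal graded submodule is a two-sided ideal for all the products (\<open>maximal_ideal_left\<close>,
  \<open>maximal_ideal_right\<close>), since the translation operator is itself a mode of $w_1$. Weights are the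
  eigenvalues of another mode of $w_1$, so homogeneous components in the quotient $\mathcal V_c$ are
  the images of homogeneous components (\<open>component_V\<close>), and commutativity passes to the Zhu algebra
  of $\mathcal V_c$.

  For an irreducible admissible module with lowest component $M_0$, the zero modes $o(a)$ satisfy
  $o(a * b) = o(a) o(b)$ and $o(O) = 0$ on $M_0$ (\<open>om_star\<close>, \<open>om_O\<close>). Irreducibility makes $M_0$ the
  span of the $o(a) v$ for each nonzero $v$ in $M_0$, hence of the words in the commuting operators
  $o(w_r)$ applied to $v$. Thus $M_0$ has countable dimension. An operator $X$ among the $o(w_r)$ without
  eigenvector would give the uncountable independent family $(X - \lambda)^{-1} v$; so there are
  eigenvectors, all the $o(w_r)$ are scalars, and $M_0$ is a line (\<open>one_dimensional\<close>).

  The modules in the statement live on carriers. Each of them is realized as a direct summand of a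
  vector space that is a whole type (\<open>realization_exists\<close>), and the computations take place there.
\<close>

section \<open>Finitely supported functions\<close>

text \<open>The induction principle for everything that is additive in a Laurent polynomial: it leaves
  the monomials to be checked.\<close>

lemma pm_induct [case_names zero single add]:
  fixes f :: "'a \<Rightarrow>\<^sub>0 'b::comm_monoid_add"
  assumes "P 0" "\<And>k x. P (Poly_Mapping.single k x)" "\<And>f g. P f \<Longrightarrow> P g \<Longrightarrow> P (f + g)"
  shows "P f"
proof -
  have "f = (\<Sum>k\<in>Poly_Mapping.keys f. Poly_Mapping.single k (coef f k))"
    by (rule poly_mapping_eqI)
      (simp add: lookup_sum lookup_single when_def in_keys_iff sum.delta)
  moreover have "P (\<Sum>k\<in>S. Poly_Mapping.single k (coef f k))" if "finite S" for S
    using that by (induction S rule: finite_induct) (auto intro: assms)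
  ultimately show ?thesis using finite_keys by metis
qed

lemma keys_sum_superset:
  assumes "finite S" "Poly_Mapping.keys f \<subseteq> S" "\<And>k. g k 0 = 0"
  shows "(\<Sum>k\<in>Poly_Mapping.keys f. g k (coef f k)) = (\<Sum>k\<in>S. g k (coef f k))"
  using assms by (intro sum.mono_neutral_left) (auto simp: in_keys_iff)

section \<open>Laurent polynomials\<close>

abbreviation tpow :: "int \<Rightarrow> laurent" where
  "tpow k \<equiv> Poly_Mapping.single k 1"

definition tshift :: laurent where
  "tshift = 1 + tpow 1"

lemma coef_ldiff: "coef (ldiff f) k = of_int (k + 1) * coef f (k + 1)"
proof -
  have *: "(a - 1 = k) = (a = k + 1)" for a :: int by auto
  show ?thesis
    unfolding ldiff_def
    by (simp add: lookup_sum lookup_single when_def * sum.delta in_keys_iff)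
qed

lemma ldiff_zero [simp]: "ldiff 0 = 0"
  by (rule poly_mapping_eqI) (simp add: coef_ldiff)

lemma ldiff_one [simp]: "ldiff 1 = 0"
proof (rule poly_mapping_eqI)
  fix k show "coef (ldiff 1) k = coef 0 k"
    by (cases "k + 1 = 0") (simp_all only: coef_ldiff lookup_one when_def of_int_0 mult_zero_left lookup_zero if_False mult_zero_right)
qed

lemma ldiff_add [simp]: "ldiff (f + g) = ldiff f + ldiff g"
  by (rule poly_mapping_eqI) (simp only: coef_ldiff lookup_add distrib_left)

lemma ldiff_uminus [simp]: "ldiff (- f) = - ldiff f"
  by (rule poly_mapping_eqI) (simp only: coef_ldiff lookup_uminus mult_minus_right)

lemma ldiff_diff [simp]: "ldiff (f - g) = ldiff f - ldiff g"
  using ldiff_add[of f "- g"] by simp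

lemma ldiff_single [simp]: "ldiff (Poly_Mapping.single k x) = Poly_Mapping.single (k - 1) (of_int k * x)"
  by (rule poly_mapping_eqI) (auto simp add: coef_ldiff lookup_single when_def)

lemma ldiff_mult [simp]: "ldiff (f * g) = ldiff f * g + f * ldiff g"
proof (induction f rule: pm_induct)
  case (single a x)
  show ?case
  proof (induction g rule: pm_induct)
    case (single b y)
    have e: "a - 1 + b = a + b - 1" "a + (b - 1) = a + b - 1" by auto
    show ?case
      by (simp add: mult_single e flip: single_add) (simp add: algebra_simps)
  qed (simp_all add: distrib_left add_ac)
qed (simp_all add: distrib_right add_ac)

lemma ldiff_sum: "ldiff (sum f S) = (\<Sum>i\<in>S. ldiff (f i))"
  by (induction S rule: infinite_finite_induct) auto

lemma ldiff_of_nat [simp]: "ldiff (of_nat n) = 0"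
  by (induction n) auto

lemma ldiff_iter_add: "(ldiff ^^ n) (f + g) = (ldiff ^^ n) f + (ldiff ^^ n) g"
  by (induction n) auto

lemma ldiff_iter_sum: "(ldiff ^^ n) (sum f S) = (\<Sum>i\<in>S. (ldiff ^^ n) (f i))"
  by (induction n) (auto simp: ldiff_sum)

lemma ldiff_iter_zero [simp]: "(ldiff ^^ n) 0 = 0"
  by (induction n) auto

lemma ldiff_leibniz:
  "(ldiff ^^ m) (f * g) = (\<Sum>i\<le>m. of_nat (m choose i) * (ldiff ^^ i) f * (ldiff ^^ (m - i)) g)"
proof (induction m)
  case (Suc m)
  let ?F = "\<lambda>i j. (ldiff ^^ i) f * (ldiff ^^ j) g"
  have "(ldiff ^^ Suc m) (f * g) =
      (\<Sum>i\<le>m. of_nat (m choose i) * ?F (Suc i) (m - i)) + (\<Sum>i\<le>m. of_nat (m choose i) * ?F i (Suc m - i))"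
  proof -
    have e: "ldiff (of_nat c * a * b) = of_nat c * (ldiff a * b) + of_nat c * (a * ldiff b)" for c a b
      by (simp add: algebra_simps)
    show ?thesis
      by (simp add: Suc ldiff_sum e sum.distrib Suc_diff_le del: ldiff_mult)
  qed
  also have "(\<Sum>i\<le>m. of_nat (m choose i) * ?F i (Suc m - i)) = (\<Sum>i\<le>Suc m. of_nat (m choose i) * ?F i (Suc m - i))"
    by simp
  also have "\<dots> = ?F 0 (Suc m) + (\<Sum>i\<le>m. of_nat (m choose Suc i) * ?F (Suc i) (m - i))"
    by (subst sum.atMost_Suc_shift) simp
  also have "(\<Sum>i\<le>m. of_nat (m choose i) * ?F (Suc i) (m - i)) + \<dots> =
     (\<Sum>i\<le>Suc m. of_nat (Suc m choose i) * ?F i (Suc m - i))"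
    by (subst sum.atMost_Suc_shift) (simp add: sum.distrib distrib_right add_ac del: sum.atMost_Suc funpow.simps)
  finally show ?case by (simp add: mult.assoc)
qed simp

lemma lresidue_add: "lresidue (f + g) = lresidue f + lresidue g"
  by (simp add: lresidue_def lookup_add)
lemma lresidue_uminus: "lresidue (- g) = - lresidue g"
  by (simp add: lresidue_def)
lemma lresidue_diff: "lresidue (f - g) = lresidue f - lresidue g"
  by (simp add: lresidue_def lookup_minus)
lemma lresidue_sum: "lresidue (sum f S) = (\<Sum>i\<in>S. lresidue (f i))"
  by (simp add: lresidue_def lookup_sum)
lemma lresidue_zero: "lresidue 0 = 0"
  by (simp add: lresidue_def)

lemma lresidue_ldiff [simp]: "lresidue (ldiff f) = 0"
  by (simp add: lresidue_def coef_ldiff)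

lemma lresidue_by_parts: "lresidue (ldiff f * g) = - lresidue (f * ldiff g)"
  using lresidue_ldiff[of "f * g"] by (simp add: lresidue_add add_eq_0_iff del: lresidue_ldiff)

text \<open>Up to a sign, $\partial^n$ is its own adjoint for the pairing
  $(f, g) \mapsto \mathrm{Res}\, f g$; this is what makes the operators $W^r_k$ with odd $r$
  skew-adjoint.\<close>

lemma lresidue_by_parts_iter: "lresidue ((ldiff ^^ n) f * g) = (-1) ^ n * lresidue (f * (ldiff ^^ n) g)"
proof (induction n arbitrary: g)
  case (Suc n)
  have "(ldiff ^^ n) (ldiff g) = ldiff ((ldiff ^^ n) g)" by (simp add: funpow_swap1)
  then show ?case by (simp add: lresidue_by_parts Suc)
qed simp

lemma coef_single_mult: "coef (Poly_Mapping.single a x * f) k = x * coef f (k - a)" for f :: laurent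
proof (induction f rule: pm_induct)
  case (single b y)
  show ?case by (auto simp: mult_single lookup_single when_def)
qed (simp_all add: lookup_add algebra_simps)

lemma lresidue_nondegenerate:
  assumes "\<And>f. lresidue (f * h) = 0" shows "h = 0"
proof (rule poly_mapping_eqI)
  fix k show "coef h k = coef 0 k"
    using assms[of "tpow (-1 - k)"] by (simp add: lresidue_def coef_single_mult)
qed

lemma tshift_mult: "tshift * f = f + tpow 1 * f"
  by (simp add: tshift_def algebra_simps)

lemma ldiff_tshift [simp]: "ldiff tshift = 1"
  by (simp add: tshift_def)

lemma ldiff_power: "ldiff u = 1 \<Longrightarrow> ldiff (u ^ n) = of_nat n * u ^ (n - 1)"
proof (induction n)
  case (Suc n)
  then show ?case by (cases n) (simp_all add: algebra_simps)
qed simp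

text \<open>The order of growth at $t = \infty$. Negative exponents are unrestricted, so that
  derivatives obey the expected bounds without exception.\<close>

definition deg_le :: "int \<Rightarrow> laurent \<Rightarrow> bool" where
  "deg_le d f \<longleftrightarrow> (\<forall>k>d. coef f k = 0)"

lemma deg_le_0 [simp]: "deg_le d 0" by (simp add: deg_le_def)
lemma deg_le_add: "deg_le d f \<Longrightarrow> deg_le d g \<Longrightarrow> deg_le d (f + g)" by (simp add: deg_le_def lookup_add)
lemma deg_le_diff: "deg_le d f \<Longrightarrow> deg_le d g \<Longrightarrow> deg_le d (f - g)" by (simp add: deg_le_def lookup_minus)
lemma deg_le_mono: "deg_le d f \<Longrightarrow> d \<le> e \<Longrightarrow> deg_le e f" by (auto simp: deg_le_def)
lemma deg_le_sum: "(\<And>i. i \<in> S \<Longrightarrow> deg_le d (f i)) \<Longrightarrow> deg_le d (sum f S)"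
  by (simp add: deg_le_def lookup_sum)
lemma deg_le_single: "k \<le> d \<Longrightarrow> deg_le d (Poly_Mapping.single k x)"
  by (auto simp: deg_le_def lookup_single when_def)
lemma deg_le_ldiff: "deg_le d f \<Longrightarrow> deg_le (d - 1) (ldiff f)"
  by (auto simp: deg_le_def coef_ldiff)
lemma deg_le_ldiff_iter: "deg_le d f \<Longrightarrow> deg_le (d - int n) ((ldiff ^^ n) f)"
proof (induction n)
  case (Suc n)
  then show ?case using deg_le_ldiff[of "d - int n" "(ldiff ^^ n) f"] by (simp add: algebra_simps)
qed simp

lemma coef_mult_top:
  assumes "deg_le m f" "deg_le n g"
  shows "deg_le (m + n) (f * g)" "coef (f * g) (m + n) = coef f m * coef g n"
proof -
  have f: "f = (\<Sum>k\<in>Poly_Mapping.keys f. Poly_Mapping.single k (coef f k))"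
    by (rule poly_mapping_eqI)
      (simp add: lookup_sum lookup_single when_def in_keys_iff sum.delta)
  have *: "coef (f * g) k = (\<Sum>i\<in>Poly_Mapping.keys f. coef f i * coef g (k - i))" for k
    by (subst f) (simp add: sum_distrib_right lookup_sum coef_single_mult)
  have km: "i \<le> m" if "i \<in> Poly_Mapping.keys f" for i
    using that assms(1) by (meson deg_le_def in_keys_iff not_le)
  show "deg_le (m + n) (f * g)"
    unfolding deg_le_def * using km assms(2) by (force simp: deg_le_def intro!: sum.neutral)
  have "coef (f * g) (m + n) = (\<Sum>i\<in>Poly_Mapping.keys f. if i = m then coef f m * coef g n else 0)"
    unfolding * using km assms(2) by (intro sum.cong) (force simp: deg_le_def)+
  also have "\<dots> = coef f m * coef g n"
    by (simp add: sum.delta in_keys_iff)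
  finally show "coef (f * g) (m + n) = coef f m * coef g n" .
qed

fun ffact :: "int \<Rightarrow> nat \<Rightarrow> complex" where
  "ffact d 0 = 1"
| "ffact d (Suc n) = of_int (d - int n) * ffact d n"

lemma coef_ldiff_iter: "coef ((ldiff ^^ n) f) (d - int n) = ffact d n * coef f d"
proof (induction n)
  case (Suc n)
  have e: "d - int (Suc n) + 1 = d - int n" by simp
  show ?case unfolding funpow.simps o_def coef_ldiff e Suc by simp
qed simp

lemma ffact_eq_0: "m < n \<Longrightarrow> ffact (int m) n = 0"
proof (induction n)
  case (Suc n)
  then show ?case by (cases "m = n") auto
qed simp

lemma deg_le_sharpen: "deg_le d f \<Longrightarrow> coef f d = 0 \<Longrightarrow> deg_le (d - 1) f"
  unfolding deg_le_def by (metis order_le_less zless_imp_add1_zle diff_add_cancel)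

text \<open>The iterated derivative loses one more degree than expected, because the falling factorial
  $m (m-1) \cdots (m-n+1)$ contains the factor $0$.\<close>

lemma deg_le_ldiff_iter_strict:
  "deg_le (int m) f \<Longrightarrow> m < n \<Longrightarrow> deg_le (int m - int n - 1) ((ldiff ^^ n) f)"
  by (rule deg_le_sharpen) (simp_all add: deg_le_ldiff_iter coef_ldiff_iter ffact_eq_0)

lemma lresidue_deg: "deg_le (-2) f \<Longrightarrow> lresidue f = 0"
  by (simp add: deg_le_def lresidue_def)

section \<open>Differential operators acting on Laurent polynomials\<close>

text \<open>An operator is determined by its action on Laurent polynomials, so identities between
  compositions can be checked on functions, where \<^const>\<open>dcomp\<close> is the composition of maps.\<close>

definition diffop_apply :: "diffop \<Rightarrow> laurent \<Rightarrow> laurent" where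
  "diffop_apply A f = (\<Sum>l\<in>Poly_Mapping.keys A. coef A l * (ldiff ^^ l) f)"

lemma diffop_apply_superset:
  "finite S \<Longrightarrow> Poly_Mapping.keys A \<subseteq> S \<Longrightarrow> diffop_apply A f = (\<Sum>l\<in>S. coef A l * (ldiff ^^ l) f)"
  unfolding diffop_apply_def by (rule keys_sum_superset) auto

lemma diffop_apply_0 [simp]: "diffop_apply 0 f = 0" "diffop_apply A 0 = 0"
  by (simp_all add: diffop_apply_def)

lemma diffop_apply_add: "diffop_apply (A + B) f = diffop_apply A f + diffop_apply B f"
proof -
  let ?S = "Poly_Mapping.keys A \<union> Poly_Mapping.keys B"
  have "Poly_Mapping.keys (A + B) \<subseteq> ?S" by (rule keys_add)
  then show ?thesis
    by (simp add: diffop_apply_superset[of ?S] lookup_add sum.distrib algebra_simps)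
qed

lemma diffop_apply_uminus: "diffop_apply (- A) f = - diffop_apply A f"
  using diffop_apply_add[of A "- A" f] by (simp add: eq_neg_iff_add_eq_0 add.commute)

lemma diffop_apply_diff: "diffop_apply (A - B) f = diffop_apply A f - diffop_apply B f"
  using diffop_apply_add[of A "- B" f] by (simp add: diffop_apply_uminus)

lemma diffop_apply_sum: "diffop_apply (sum A S) f = (\<Sum>i\<in>S. diffop_apply (A i) f)"
  by (induction S rule: infinite_finite_induct) (auto simp: diffop_apply_add)

lemma diffop_apply_single [simp]: "diffop_apply (Poly_Mapping.single l a) f = a * (ldiff ^^ l) f"
  by (cases "a = 0") (simp_all add: diffop_apply_def)

lemma diffop_apply_arg_add: "diffop_apply A (f + g) = diffop_apply A f + diffop_apply A g"
  by (simp add: diffop_apply_def ldiff_iter_add sum.distrib algebra_simps)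

lemma diffop_apply_arg_diff: "diffop_apply A (f - g) = diffop_apply A f - diffop_apply A g"
  using diffop_apply_arg_add[of A "f - g" g] by simp

lemma diffop_apply_arg_uminus: "diffop_apply A (- f) = - diffop_apply A f"
  using diffop_apply_arg_diff[of A 0 f] by simp

lemma dscale_eq_single_mult: "dscale z A = Poly_Mapping.single 0 (Poly_Mapping.single 0 z) * A"
proof -
  have "(Poly_Mapping.map ((*) z) :: laurent \<Rightarrow> _) = (*) (Poly_Mapping.single 0 z)"
    by (rule ext) (rule mult_map_scale_conv_mult)
  then show ?thesis by (simp add: dscale_def mult_map_scale_conv_mult)
qed

lemma coef_dscale: "coef (dscale z A) l = Poly_Mapping.single 0 z * coef A l"
proof (induction A rule: pm_induct)
  case (single k x)
  show ?case by (simp add: dscale_eq_single_mult mult_single lookup_single when_def)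
qed (simp_all add: dscale_eq_single_mult lookup_add algebra_simps)

lemma diffop_apply_dscale: "diffop_apply (dscale z A) f = Poly_Mapping.single 0 z * diffop_apply A f"
proof -
  have "Poly_Mapping.keys (dscale z A) \<subseteq> Poly_Mapping.keys A"
    by (auto simp: in_keys_iff coef_dscale)
  then show ?thesis
    by (simp add: diffop_apply_superset[of "Poly_Mapping.keys A"] coef_dscale sum_distrib_left mult.assoc)
qed

lemma diffop_apply_dcomp: "diffop_apply (dcomp A B) f = diffop_apply A (diffop_apply B f)"
proof -
  have "diffop_apply (dcomp A B) f = (\<Sum>m\<in>Poly_Mapping.keys A. \<Sum>n\<in>Poly_Mapping.keys B. \<Sum>i\<le>m.
     of_nat (m choose i) * coef A m * (ldiff ^^ i) (coef B n) * (ldiff ^^ (m + n - i)) f)"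
    by (simp add: dcomp_def diffop_apply_sum)
  also have "\<dots> = (\<Sum>m\<in>Poly_Mapping.keys A. \<Sum>n\<in>Poly_Mapping.keys B. \<Sum>i\<le>m.
     coef A m * (of_nat (m choose i) * (ldiff ^^ i) (coef B n) * (ldiff ^^ (m - i)) ((ldiff ^^ n) f)))"
  proof (intro sum.cong refl)
    fix m n i :: nat assume "i \<in> {..m}"
    then have e: "m + n - i = (m - i) + n" by auto
    show "of_nat (m choose i) * coef A m * (ldiff ^^ i) (coef B n) * (ldiff ^^ (m + n - i)) f
       = coef A m * (of_nat (m choose i) * (ldiff ^^ i) (coef B n) * (ldiff ^^ (m - i)) ((ldiff ^^ n) f))"
      unfolding e funpow_add o_def by (simp only: mult_ac)
  qed
  also have "\<dots> = diffop_apply A (diffop_apply B f)"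
    by (simp add: diffop_apply_def ldiff_iter_sum ldiff_leibniz sum_distrib_left)
  finally show ?thesis .
qed

lemma ldiff_of_nat_mult: "ldiff (of_nat c * f) = of_nat c * ldiff f"
  by simp

lemma ldiff_iter_power:
  assumes "ldiff u = 1"
  shows "(ldiff ^^ n) (u ^ l) = of_nat (\<Prod>i<n. l - i) * u ^ (l - n)"
proof (induction n)
  case (Suc n)
  have e: "l - n - 1 = l - Suc n" by simp
  have "(ldiff ^^ Suc n) (u ^ l) = of_nat (\<Prod>i<n. l - i) * (of_nat (l - n) * u ^ (l - n - 1))"
    by (simp only: funpow.simps o_def Suc ldiff_of_nat_mult ldiff_power[OF assms])
  also have "\<dots> = of_nat (\<Prod>i<Suc n. l - i) * u ^ (l - Suc n)"
    using e by (simp only: prod.lessThan_Suc of_nat_mult mult.assoc)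
  finally show ?case .
qed simp

definition laurent_subspace :: "laurent set \<Rightarrow> bool" where
  "laurent_subspace J \<longleftrightarrow> 0 \<in> J \<and> (\<forall>f\<in>J. \<forall>g\<in>J. f + g \<in> J) \<and> (\<forall>z. \<forall>f\<in>J. Poly_Mapping.single 0 z * f \<in> J)"

lemma laurent_subspaceD:
  assumes "laurent_subspace J"
  shows "0 \<in> J" "f \<in> J \<Longrightarrow> g \<in> J \<Longrightarrow> f + g \<in> J" "f \<in> J \<Longrightarrow> Poly_Mapping.single 0 z * f \<in> J"
    "f \<in> J \<Longrightarrow> - f \<in> J" "f \<in> J \<Longrightarrow> g \<in> J \<Longrightarrow> f - g \<in> J" "f \<in> J \<Longrightarrow> of_nat n * f \<in> J"
    "(\<And>i. i \<in> S \<Longrightarrow> h i \<in> J) \<Longrightarrow> sum h S \<in> J"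
proof -
  show 0: "0 \<in> J" and a: "f \<in> J \<Longrightarrow> g \<in> J \<Longrightarrow> f + g \<in> J" 
    and s: "f \<in> J \<Longrightarrow> Poly_Mapping.single 0 z * f \<in> J" for f g z
    using assms by (auto simp: laurent_subspace_def)
  show m: "f \<in> J \<Longrightarrow> - f \<in> J" for f
    using s[of f "-1"] by (simp add: single_uminus)
  show "f \<in> J \<Longrightarrow> g \<in> J \<Longrightarrow> f - g \<in> J"
    using a[of f "- g"] m by simp
  show "f \<in> J \<Longrightarrow> of_nat n * f \<in> J"
    using s[of f "of_nat n"] by simp
  show "(\<And>i. i \<in> S \<Longrightarrow> h i \<in> J) \<Longrightarrow> sum h S \<in> J"
    by (induction S rule: infinite_finite_induct) (auto simp: 0 a)
qed

text \<open>Applied to $u^l$, the operator $A = \sum_i a_i \partial^i$ gives $l!\, a_l$ plus multiples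
  of the $a_i u^{l-i}$ with $i < l$, since $u' = 1$ and the terms with $i > l$ vanish. So the
  coefficients can be recovered one after the other from the values on the powers of $u$, and
  they inherit every linear condition on these values that is compatible with multiplication by
  $u$. With $u = 1 + t$ both divisibility by powers of $1 + t$ and bounds on the degree are of
  this kind.\<close>

lemma diffop_coef_in:
  assumes u: "ldiff u = 1"
    and J: "\<And>l. laurent_subspace (J l)" "\<And>i l f. i < l \<Longrightarrow> f \<in> J i \<Longrightarrow> f * u ^ (l - i) \<in> J l"
    and A: "\<And>l. diffop_apply A (u ^ l) \<in> J l"
  shows "coef A l \<in> J l"
proof (induction l rule: less_induct)
  case (less l)
  let ?c = "\<lambda>i. \<Prod>j<i. l - j"
  let ?S = "Poly_Mapping.keys A \<union> {..l}"
  have "diffop_apply A (u ^ l) = (\<Sum>i\<in>?S. coef A i * (of_nat (?c i) * u ^ (l - i)))"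
    by (simp add: diffop_apply_superset[of ?S] ldiff_iter_power[OF u] del: of_nat_prod)
  also have "\<dots> = (\<Sum>i\<in>{..l}. coef A i * (of_nat (?c i) * u ^ (l - i)))"
  proof (rule sum.mono_neutral_right)
    show "\<forall>i\<in>?S - {..l}. coef A i * (of_nat (?c i) * u ^ (l - i)) = 0"
    proof
      fix i assume "i \<in> ?S - {..l}"
      then have "?c i = 0" by auto
      then show "coef A i * (of_nat (?c i) * u ^ (l - i)) = 0" by (simp only: of_nat_0 mult_zero_left mult_zero_right)
    qed
  qed auto
  also have "\<dots> = (\<Sum>i<l. coef A i * (of_nat (?c i) * u ^ (l - i))) + of_nat (?c l) * coef A l"
    by (simp add: lessThan_Suc_atMost[symmetric] mult.commute del: of_nat_prod)
  finally have e: "of_nat (?c l) * coef A l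
      = diffop_apply A (u ^ l) - (\<Sum>i<l. of_nat (?c i) * (coef A i * u ^ (l - i)))"
    by (simp add: algebra_simps del: of_nat_prod)
  have mem: "of_nat (?c l) * coef A l \<in> J l"
    unfolding e
    by (intro laurent_subspaceD[OF J(1)] A J(2)) (auto intro: less)
  have "?c l \<noteq> 0" by auto
  then have "Poly_Mapping.single 0 (1 / of_nat (?c l)) * of_nat (?c l) = (1 :: laurent)"
    by (simp only: single_of_nat[symmetric] mult_single add_0_left) (simp del: of_nat_prod)
  then have "coef A l = Poly_Mapping.single 0 (1 / of_nat (?c l)) * (of_nat (?c l) * coef A l)"
    by (simp only: mult.assoc[symmetric] mult_1_left)
  then show ?case
    using laurent_subspaceD(3)[OF J(1) mem] by metis
qed

lemma diffop_eqI:
  assumes "\<And>f. diffop_apply A f = diffop_apply B f"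
  shows "A = B"
proof -
  have "coef (A - B) l \<in> {0}" for l
    by (rule diffop_coef_in[of "tshift" "\<lambda>_. {0}"])
      (auto simp: laurent_subspace_def diffop_apply_diff assms)
  then show ?thesis by (intro poly_mapping_eqI) (simp add: lookup_minus)
qed

section \<open>Skew-adjoint operators\<close>

lemma dscale_1 [simp]: "dscale 1 A = A"
  by (simp add: dscale_eq_single_mult)

text \<open>The generator $W^r_k$ is the case $f = t^{k+r}$. Smearing it with a general Laurent
  polynomial allows to use the function $(1+t)^{r+1} t^{-1}$ of the Zhu product directly.\<close>

definition Wf :: "nat \<Rightarrow> laurent \<Rightarrow> diffop" where
  "Wf r f = dscale (- 1 / 2) (Poly_Mapping.single r f + dcomp (dmono 0 r) (Poly_Mapping.single 0 f))"

lemma W_op_eq_Wf: "odd m \<Longrightarrow> W_op m k = Wf m (tpow (k + int m))"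
  by (simp add: W_op_def Wf_def dmono_def)

lemma dcomp_deriv: "dcomp (dmono 0 r) (Poly_Mapping.single 0 f) =
    (\<Sum>i\<le>r. Poly_Mapping.single (r - i) (of_nat (r choose i) * (ldiff ^^ i) f))"
  by (cases "f = 0") (simp_all add: dcomp_def dmono_def)

lemma diffop_apply_dmono_0: "diffop_apply (dmono 0 r) g = (ldiff ^^ r) g"
  by (simp add: dmono_def)

lemma diffop_apply_Wf:
  "diffop_apply (Wf r f) g = Poly_Mapping.single 0 (- 1 / 2) * (f * (ldiff ^^ r) g + (ldiff ^^ r) (f * g))"
  by (simp add: Wf_def diffop_apply_dscale diffop_apply_add diffop_apply_dcomp diffop_apply_dmono_0)

lemma coef_Wf_in:
  assumes J: "\<And>l. laurent_subspace (J l)" "\<And>l f. f \<in> J (Suc l) \<Longrightarrow> ldiff f \<in> J l" and f: "f \<in> J r"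
  shows "coef (Wf r f) l \<in> J l"
proof -
  have d: "i \<le> r \<Longrightarrow> (ldiff ^^ i) f \<in> J (r - i)" for i
  proof (induction i)
    case (Suc i)
    then show ?case using J(2)[of "(ldiff ^^ i) f" "r - Suc i"] by (simp add: Suc_diff_Suc)
  qed (simp add: f)
  have "coef (\<Sum>i\<le>r. Poly_Mapping.single (r - i) (of_nat (r choose i) * (ldiff ^^ i) f)) l \<in> J l"
    unfolding lookup_sum
    by (rule laurent_subspaceD[OF J(1)])
      (auto simp: lookup_single when_def intro!: laurent_subspaceD[OF J(1)] d)
  then show ?thesis
    unfolding Wf_def coef_dscale lookup_add dcomp_deriv
    using f by (auto simp: lookup_single when_def intro!: laurent_subspaceD[OF J(1)])
qed

lemma Wf_add: "Wf r (f + g) = Wf r f + Wf r g"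
  by (rule diffop_eqI) (simp add: diffop_apply_Wf diffop_apply_add ldiff_iter_add algebra_simps)

lemma Wf_zero [simp]: "Wf r 0 = 0"
  using Wf_add[of r 0 0] by simp

lemma ldiff_const_mult: "ldiff (Poly_Mapping.single 0 z * f) = Poly_Mapping.single 0 z * ldiff f"
  by simp

lemma ldiff_iter_const_mult: "(ldiff ^^ n) (Poly_Mapping.single 0 z * f) = Poly_Mapping.single 0 z * (ldiff ^^ n) f"
  by (induction n) (simp_all add: ldiff_const_mult del: ldiff_mult)

lemma Wf_scale: "Wf r (Poly_Mapping.single 0 z * f) = dscale z (Wf r f)"
proof (rule diffop_eqI)
  fix g
  have "(ldiff ^^ r) (Poly_Mapping.single 0 z * f * g) = Poly_Mapping.single 0 z * (ldiff ^^ r) (f * g)"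
    by (simp add: ldiff_iter_const_mult mult.assoc)
  then show "diffop_apply (Wf r (Poly_Mapping.single 0 z * f)) g = diffop_apply (dscale z (Wf r f)) g"
    by (simp add: diffop_apply_Wf diffop_apply_dscale algebra_simps)
qed

text \<open>The operators $W^r_k$ with odd $r$ span the operators that are skew-adjoint for the
  residue pairing. Closure under commutators, which is not visible from the spanning set, is
  obvious from this description.\<close>

definition skew :: "diffop \<Rightarrow> bool" where
  "skew A \<longleftrightarrow> (\<forall>f g. lresidue (diffop_apply A f * g) = - lresidue (f * diffop_apply A g))"

lemma skewI: "(\<And>f g. lresidue (diffop_apply A f * g) = - lresidue (f * diffop_apply A g)) \<Longrightarrow> skew A"
  by (simp add: skew_def)

lemma skewD: "skew A \<Longrightarrow> lresidue (diffop_apply A f * g) = - lresidue (f * diffop_apply A g)"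
  by (simp add: skew_def)

lemma lresidue_const_mult: "lresidue (Poly_Mapping.single 0 z * f) = z * lresidue f"
  by (simp add: lresidue_def coef_single_mult)

lemma skew_0: "skew 0" by (simp add: skew_def lresidue_zero)

lemma skew_add:
  assumes "skew A" "skew B" shows "skew (A + B)"
  by (rule skewI)
    (simp only: diffop_apply_add distrib_left distrib_right lresidue_add skewD[OF assms(1)] skewD[OF assms(2)]
      minus_add_distrib)

lemma skew_dscale:
  assumes "skew A" shows "skew (dscale z A)"
proof (rule skewI)
  fix f g
  show "lresidue (diffop_apply (dscale z A) f * g) = - lresidue (f * diffop_apply (dscale z A) g)"
    by (simp only: diffop_apply_dscale mult.left_commute[of f "Poly_Mapping.single 0 z"] mult.assoc
        lresidue_const_mult skewD[OF assms] mult_minus_right)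
qed

lemma skew_commutator:
  assumes "skew A" "skew B" shows "skew (dcomp A B - dcomp B A)"
  by (rule skewI)
    (simp only: diffop_apply_diff diffop_apply_dcomp left_diff_distrib right_diff_distrib lresidue_diff
      skewD[OF assms(1)] skewD[OF assms(2)] minus_diff_eq minus_minus)

lemma skew_plus_adjoint:
  assumes "odd r" shows "skew (Poly_Mapping.single r f + dcomp (dmono 0 r) (Poly_Mapping.single 0 f))"
  unfolding skew_def
proof (intro allI)
  fix g h
  let ?A = "Poly_Mapping.single r f + dcomp (dmono 0 r) (Poly_Mapping.single 0 f)"
  have "lresidue (g * (f * (ldiff ^^ r) h)) = - lresidue ((ldiff ^^ r) (f * g) * h)"
    using assms lresidue_by_parts_iter[of r "f * g" h] by (simp add: mult_ac)
  moreover have "lresidue (g * (ldiff ^^ r) (f * h)) = - lresidue ((ldiff ^^ r) g * (f * h))"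
    using assms by (simp add: lresidue_by_parts_iter)
  ultimately show "lresidue (diffop_apply ?A g * h) = - lresidue (g * diffop_apply ?A h)"
    by (simp add: diffop_apply_add diffop_apply_dcomp diffop_apply_dmono_0 distrib_left distrib_right
        lresidue_add mult_ac)
qed

lemma skew_minus_adjoint:
  assumes "even r" shows "skew (Poly_Mapping.single r f - dcomp (dmono 0 r) (Poly_Mapping.single 0 f))"
  unfolding skew_def
proof (intro allI)
  fix g h
  let ?A = "Poly_Mapping.single r f - dcomp (dmono 0 r) (Poly_Mapping.single 0 f)"
  have "lresidue (g * (f * (ldiff ^^ r) h)) = lresidue ((ldiff ^^ r) (f * g) * h)"
    using assms lresidue_by_parts_iter[of r "f * g" h] by (simp add: mult_ac)
  moreover have "lresidue (g * (ldiff ^^ r) (f * h)) = lresidue ((ldiff ^^ r) g * (f * h))"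
    using assms by (simp add: lresidue_by_parts_iter)
  ultimately show "lresidue (diffop_apply ?A g * h) = - lresidue (g * diffop_apply ?A h)"
    by (simp add: diffop_apply_diff diffop_apply_dcomp diffop_apply_dmono_0 right_diff_distrib left_diff_distrib
        lresidue_diff mult_ac)
qed

lemma skew_Wf: "odd r \<Longrightarrow> skew (Wf r f)"
  unfolding Wf_def by (intro skew_dscale skew_plus_adjoint)

interpretation dop: vector_space dscale
proof
  fix a b :: complex and x y :: diffop
  show "dscale a (x + y) = dscale a x + dscale a y"
    by (simp only: dscale_eq_single_mult distrib_left)
  show "dscale (a + b) x = dscale a x + dscale b x"
    by (simp only: dscale_eq_single_mult distrib_right single_add)
  show "dscale a (dscale b x) = dscale (a * b) x"
    by (simp only: dscale_eq_single_mult mult_single mult.assoc[symmetric] add_0_left)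
qed simp

section \<open>Vector spaces as modules\<close>

lemma complex_ring_simps [simp]:
  "carrier complex_ring = UNIV" "a \<otimes>\<^bsub>complex_ring\<^esub> b = a * b" "\<one>\<^bsub>complex_ring\<^esub> = 1"
  "\<zero>\<^bsub>complex_ring\<^esub> = 0" "a \<oplus>\<^bsub>complex_ring\<^esub> b = a + b"
  by (simp_all add: complex_ring_def)

lemma cring_complex_ring: "cring complex_ring"
proof (rule cringI)
  show "abelian_group complex_ring"
  proof (rule abelian_groupI)
    fix x :: complex
    show "\<exists>y\<in>carrier complex_ring. y \<oplus>\<^bsub>complex_ring\<^esub> x = \<zero>\<^bsub>complex_ring\<^esub>"
      by (rule bexI[of _ "- x"]) auto
  qed auto
  show "comm_monoid complex_ring"
    by (rule comm_monoidI) auto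
qed (auto simp: distrib_right)

text \<open>The statement speaks of modules with a carrier, the computations below of vector spaces
  that are a whole type. The lemmas of this section translate subspaces and spans.\<close>

lemma vec_space_simps [simp]:
  "carrier (vec_space S sc) = S" "\<zero>\<^bsub>vec_space S sc\<^esub> = 0"
  "x \<oplus>\<^bsub>vec_space S sc\<^esub> y = x + y" "z \<odot>\<^bsub>vec_space S sc\<^esub> x = sc z x"
  by (simp_all add: vec_space_def)

locale complex_vector_space = vector_space scale
  for scale :: "complex \<Rightarrow> 'v::ab_group_add \<Rightarrow> 'v"
begin

lemma module_vec_space:
  assumes "subspace C" shows "Module.module complex_ring (vec_space C scale)"
proof (rule moduleI[OF cring_complex_ring])
  show "abelian_group (vec_space C scale)"
  proof (rule abelian_groupI)
    fix x assume "x \<in> carrier (vec_space C scale)"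
    then show "\<exists>y\<in>carrier (vec_space C scale). y \<oplus>\<^bsub>vec_space C scale\<^esub> x = \<zero>\<^bsub>vec_space C scale\<^esub>"
      using assms by (intro bexI[of _ "- x"]) (auto intro: subspace_neg)
  qed (use assms in \<open>auto intro: subspace_add subspace_0\<close>)
qed (use assms in \<open>auto intro: subspace_scale simp: scale_left_distrib scale_right_distrib\<close>)

lemma a_inv_vec_space:
  assumes "subspace C" "x \<in> C" shows "\<ominus>\<^bsub>vec_space C scale\<^esub> x = - x"
proof -
  interpret m: Module.module complex_ring "vec_space C scale" using assms(1) by (rule module_vec_space)
  show ?thesis using assms by (intro m.minus_equality) (auto intro: subspace_neg)
qed

lemma subspace_of_vec_space:
  assumes "subspace C" shows "subspace_of H (vec_space C scale) \<longleftrightarrow> subspace H \<and> H \<subseteq> C"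
proof -
  interpret m: Module.module complex_ring "vec_space C scale" using assms(1) by (rule module_vec_space)
  show ?thesis
  proof
    assume H: "subspace_of H (vec_space C scale)"
    note E = m.submoduleE[OF H]
    from E(2) obtain x where "x \<in> H" by auto
    then have "0 \<in> H" using E(4)[of 0 x] by simp
    then show "subspace H \<and> H \<subseteq> C" 
      using E(1,4,5) unfolding subspace_def by auto
  next
    assume "subspace H \<and> H \<subseteq> C"
    then show "subspace_of H (vec_space C scale)"
      using assms by (intro m.submoduleI) (auto simp: a_inv_vec_space subset_iff intro: subspace_0 subspace_neg subspace_add subspace_scale)
  qed
qed

lemma lspan_vec_space:
  assumes "subspace C" "S \<subseteq> C" shows "lspan (vec_space C scale) S = span S"
proof -
  have "lspan (vec_space C scale) S = \<Inter>{H. (subspace H \<and> H \<subseteq> C) \<and> S \<subseteq> H}"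
    by (simp add: lspan_def subspace_of_vec_space[OF assms(1)])
  also have "\<dots> = span S"
  proof
    show "\<Inter>{H. (subspace H \<and> H \<subseteq> C) \<and> S \<subseteq> H} \<subseteq> span S"
      using span_minimal[OF assms(2,1)] span_superset by (intro Inter_lower) auto
    show "span S \<subseteq> \<Inter>{H. (subspace H \<and> H \<subseteq> C) \<and> S \<subseteq> H}"
      by (intro Inter_greatest span_minimal) auto
  qed
  finally show ?thesis .
qed

end

interpretation dop: complex_vector_space dscale ..

section \<open>The Lie algebra of skew-adjoint operators\<close>

lemma single_decomposition: "A = (\<Sum>l\<in>Poly_Mapping.keys A. Poly_Mapping.single l (coef A l))"
  by (rule poly_mapping_eqI)
    (simp add: lookup_sum lookup_single when_def in_keys_iff sum.delta)

text \<open>A skew-adjoint operator equals half of itself minus its adjoint. Taking the adjoint of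
  $a_l \partial^l$ term by term, odd $l$ contributes a multiple of $W^l[a_l]$, while for even
  $l$ the leading terms cancel and leave a skew-adjoint operator of smaller order, to which
  induction applies. The coefficients of that operator are derivatives $a_l^{(i)}$, so
  conditions $J_l$ on the coefficients that are compatible with differentiation survive the
  process. This control of the coefficients is what is needed for the commutators of the
  operators \<open>Lop r\<close>.\<close>

lemma skew_in_span_Wf:
  assumes J: "\<And>l. laurent_subspace (J l)" "\<And>l f. f \<in> J (Suc l) \<Longrightarrow> ldiff f \<in> J l"
    and A: "skew A" "\<And>l. coef A l \<in> J l"
  shows "A \<in> dop.span {Wf r f | r f. odd r \<and> f \<in> J r}" (is "_ \<in> ?S")
proof -
  obtain n where "Poly_Mapping.keys A \<subseteq> {..<n}"
    using finite_nat_iff_bounded[of "Poly_Mapping.keys A"] by auto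
  then show ?thesis using A
  proof (induction n arbitrary: A rule: less_induct)
    case (less n)
    let ?a = "coef A"
    define adj where "adj l = dcomp (dmono 0 l) (Poly_Mapping.single 0 (?a l))" for l
    define B where "B l = Poly_Mapping.single l (?a l) - (if even l then adj l else - adj l)" for l
    let ?K = "Poly_Mapping.keys A"
    \<comment> \<open>The formal adjoint of \<open>A\<close> is the sum of the $(-1)^l \partial^l \circ a_l$; as
      the pairing is nondegenerate, it is \<open>- A\<close>.\<close>
    have adj: "(\<Sum>l\<in>?K. if even l then adj l else - adj l) = - A"
    proof (rule diffop_eqI)
      fix g
      let ?h = "diffop_apply (\<Sum>l\<in>?K. if even l then adj l else - adj l) g"
      have "lresidue (f * (?h + diffop_apply A g)) = 0" for f
      proof -
        have "lresidue (f * ?h) = (\<Sum>l\<in>?K. lresidue (f * diffop_apply (if even l then adj l else - adj l) g))"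
          by (simp add: diffop_apply_sum sum_distrib_left lresidue_sum)
        also have "\<dots> = (\<Sum>l\<in>?K. lresidue (?a l * (ldiff ^^ l) f * g))"
        proof (rule sum.cong[OF refl])
          fix l
          have "lresidue (?a l * (ldiff ^^ l) f * g) = (-1) ^ l * lresidue (f * (ldiff ^^ l) (?a l * g))"
            using lresidue_by_parts_iter[of l f "?a l * g"] by (simp add: mult_ac)
          then show "lresidue (f * diffop_apply (if even l then adj l else - adj l) g) = lresidue (?a l * (ldiff ^^ l) f * g)"
            by (simp add: adj_def diffop_apply_dcomp diffop_apply_dmono_0 diffop_apply_uminus lresidue_uminus)
        qed
        also have "\<dots> = lresidue (diffop_apply A f * g)"
          by (simp add: diffop_apply_def sum_distrib_right lresidue_sum)
        also have "\<dots> = - lresidue (f * diffop_apply A g)"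
          by (rule skewD[OF less.prems(2)])
        finally show ?thesis by (simp add: distrib_left lresidue_add)
      qed
      then have "?h + diffop_apply A g = 0" by (rule lresidue_nondegenerate)
      then show "?h = diffop_apply (- A) g" by (simp add: diffop_apply_uminus eq_neg_iff_add_eq_0)
    qed
    have "(\<Sum>l\<in>?K. B l) = A + A"
      unfolding B_def sum_subtractf adj by (subst (4) single_decomposition) simp
    moreover have "dscale (1/2) (A + A) = A"
      by (simp only: dop.scale_right_distrib dop.scale_left_distrib[symmetric]) simp
    ultimately have AB: "A = dscale (1/2) (\<Sum>l\<in>?K. B l)" by simp
    have "B l \<in> ?S" if l: "l \<in> ?K" for l
    proof (cases "even l")
      case False
      have "Wf l (?a l) \<in> ?S" using False less.prems(3) by (auto intro: dop.span_base)
      moreover have "B l = dscale (-2) (Wf l (?a l))"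
        using False by (simp add: B_def Wf_def adj_def)
      ultimately show ?thesis by (simp only: dop.span_scale)
    next
      case True
      have "skew (B l)"
        using skew_minus_adjoint[OF True] True by (simp add: B_def adj_def)
      have d: "i \<le> l \<Longrightarrow> (ldiff ^^ i) (?a l) \<in> J (l - i)" for i
      proof (induction i)
        case (Suc i)
        then show ?case using J(2)[of "(ldiff ^^ i) (?a l)" "l - Suc i"] by (simp add: Suc_diff_Suc)
      qed (simp add: less.prems)
      \<comment> \<open>By the Leibniz rule the term of order \<open>l\<close> of the adjoint is that of
        $a_l \partial^l$ itself.\<close>
      have Bl: "B l = - (\<Sum>i<l. Poly_Mapping.single (l - Suc i) (of_nat (l choose Suc i) * (ldiff ^^ Suc i) (?a l)))"
        using True by (simp add: B_def adj_def dcomp_deriv sum.atMost_shift)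
      have "coef (B l) k \<in> J k" for k
        unfolding Bl lookup_uminus lookup_sum
        by (auto simp: lookup_single when_def simp del: funpow.simps intro!: laurent_subspaceD[OF J(1)] d)
      moreover have "Poly_Mapping.keys (B l) \<subseteq> {..<l}"
        unfolding Bl by (auto simp: in_keys_iff lookup_sum lookup_single when_def split: if_splits elim!: sum.not_neutral_contains_not_neutral)
      moreover have "l < n" using less.prems(1) l by auto
      ultimately show ?thesis using less.IH \<open>skew (B l)\<close> by blast
    qed
    then have "dscale (1/2) (\<Sum>l\<in>?K. B l) \<in> ?S"
      by (intro dop.span_scale dop.span_sum)
    then show "A \<in> ?S" using AB by simp
  qed
qed

lemma Wf_sum: "Wf r (sum f S) = (\<Sum>i\<in>S. Wf r (f i))"
  by (induction S rule: infinite_finite_induct) (auto simp: Wf_add)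

lemma Wf_single: "Wf r (Poly_Mapping.single k z) = dscale z (Wf r (tpow k))"
  using Wf_scale[of r z "tpow k"] by (simp add: mult_single)

lemma Wf_expand: "Wf r f = (\<Sum>k\<in>Poly_Mapping.keys f. dscale (coef f k) (Wf r (tpow k)))"
  by (subst single_decomposition[of f]) (simp only: Wf_sum Wf_single[symmetric])

lemma D_plus_span: "D_plus = dop.span {W_op m k | m k. odd m}"
  unfolding D_plus_def by (rule dop.lspan_vec_space) auto

lemma P_plus_span: "P_plus = dop.span {W_op m k | m k. odd m \<and> int m + k \<ge> 0}"
  unfolding P_plus_def by (rule dop.lspan_vec_space) auto

lemma Wf_in_D_plus: assumes "odd r" shows "Wf r f \<in> D_plus"
proof -
  have "Wf r (tpow k) \<in> D_plus" for k
    unfolding D_plus_span using assms W_op_eq_Wf[OF assms, of "k - int r"]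
    by (intro dop.span_base CollectI exI[of _ r] exI[of _ "k - int r"]) simp
  then show ?thesis
    unfolding D_plus_span
    unfolding Wf_expand[of r f] by (auto intro: dop.span_sum dop.span_scale)
qed

lemma Wf_in_P_plus:
  assumes "odd r" "\<And>k. k < 0 \<Longrightarrow> coef f k = 0" shows "Wf r f \<in> P_plus"
proof -
  have "Wf r (tpow k) \<in> P_plus" if "k \<ge> 0" for k
    unfolding P_plus_span using that W_op_eq_Wf[OF assms(1), of "k - int r"]
    by (intro dop.span_base CollectI exI[of _ r] exI[of _ "k - int r"]) (simp add: assms)
  moreover have "k \<ge> 0" if "k \<in> Poly_Mapping.keys f" for k using that assms(2)[of k] by (force simp: in_keys_iff)
  ultimately show ?thesis
    unfolding P_plus_span
    unfolding Wf_expand[of r f] by (auto intro: dop.span_sum dop.span_scale)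
qed

lemma P_plus_subset_D_plus: "P_plus \<subseteq> D_plus"
  unfolding P_plus_span D_plus_span by (rule dop.span_mono) auto

lemma D_plus_eq_skew: "D_plus = {A. skew A}"
proof
  show "D_plus \<subseteq> {A. skew A}"
    unfolding D_plus_span
    by (rule dop.span_minimal)
      (auto simp: W_op_eq_Wf skew_Wf dop.subspace_def skew_0 skew_add skew_dscale)
  show "{A. skew A} \<subseteq> D_plus"
  proof safe
    fix A assume "skew A"
    then have "A \<in> dop.span {Wf r f | r f. odd r \<and> f \<in> (\<lambda>_. UNIV) r}"
      by (intro skew_in_span_Wf) (auto simp: laurent_subspace_def)
    also have "\<dots> \<subseteq> D_plus"
      unfolding D_plus_span
      by (rule dop.span_minimal) (use Wf_in_D_plus in \<open>auto simp: D_plus_span\<close>)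
    finally show "A \<in> D_plus" .
  qed
qed

lemma D_plus_subspace: "dop.subspace D_plus"
  unfolding D_plus_span by (rule dop.subspace_span)

lemma D_plus_commutator: "A \<in> D_plus \<Longrightarrow> B \<in> D_plus \<Longrightarrow> dcomp A B - dcomp B A \<in> D_plus"
  by (simp add: D_plus_eq_skew skew_commutator)

lemma dcocycle_eq_0:
  assumes "\<And>m n. lresidue ((ldiff ^^ (n + 1)) (coef A m) * (ldiff ^^ m) (coef B n)) = 0"
  shows "dcocycle A B = 0"
  unfolding dcocycle_def using assms by (intro sum.neutral ballI) auto

text \<open>The degrees of $f^{(n+1)}$ and $g^{(m)}$ add up to at most $m - (n+1) + n - m = -1$, and
  one of the two derivatives falls short of its bound, as one of $n + 1 > m$ and $m > n$ holds.
  Hence the product has degree at most $-2$ and no residue. So the central charge does not enter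
  the commutators of the operators \<open>Lop r\<close>.\<close>

lemma dcocycle_degree_0:
  assumes A: "\<And>m. deg_le (int m) (coef A m)" and B: "\<And>n. deg_le (int n) (coef B n)"
  shows "dcocycle A B = 0"
proof (rule dcocycle_eq_0)
  fix m n
  let ?f = "(ldiff ^^ (n + 1)) (coef A m)" and ?g = "(ldiff ^^ m) (coef B n)"
  have "\<exists>d e. deg_le d ?f \<and> deg_le e ?g \<and> d + e = -2"
  proof (cases "n \<ge> m")
    case True
    then show ?thesis
      using deg_le_ldiff_iter_strict[OF A, of m "n + 1"] deg_le_ldiff_iter[OF B, of n m]
      by (intro exI[of _ "int m - int n - 2"] exI[of _ "int n - int m"]) simp
  next
    case False
    have e: "int m - int (n + 1) = int m - int n - 1" by simp
    have "deg_le (int m - int n - 1) ?f"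
      using deg_le_ldiff_iter[OF A, of m "n + 1"] unfolding e .
    moreover have "deg_le (int n - int m - 1) ?g"
      using False by (intro deg_le_ldiff_iter_strict B) simp
    moreover have "int m - int n - 1 + (int n - int m - 1) = -2" by simp
    ultimately show ?thesis by blast
  qed
  then show "lresidue (?f * ?g) = 0" using coef_mult_top(1) lresidue_deg by metis
qed

section \<open>Degree-zero operators commute to leading order\<close>

text \<open>To leading order at $t = \infty$ such an operator acts on $t^d$ as a function of the Euler
  operator $t \partial_t$, that is, by a scalar depending on $d$. Two such operators therefore
  commute to leading order.\<close>

lemma diffop_apply_degree:
  assumes A: "\<And>l. deg_le (int l) (coef A l)"
  obtains lam where "\<And>d g. deg_le d g \<Longrightarrow> deg_le d (diffop_apply A g) \<and> coef (diffop_apply A g) d = lam d * coef g d"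
proof
  fix d g assume g: "deg_le d g"
  have *: "deg_le d (coef A l * (ldiff ^^ l) g) \<and>
      coef (coef A l * (ldiff ^^ l) g) d = coef (coef A l) (int l) * (ffact d l * coef g d)" for l
    using coef_mult_top[OF A deg_le_ldiff_iter[OF g], of l l] coef_ldiff_iter[of l g d] by simp
  then show "deg_le d (diffop_apply A g) \<and> coef (diffop_apply A g) d =
     (\<Sum>l\<in>Poly_Mapping.keys A. coef (coef A l) (int l) * ffact d l) * coef g d"
    unfolding diffop_apply_def lookup_sum by (auto intro!: deg_le_sum simp: sum_distrib_right mult.assoc)
qed

lemma tshift_dvd_ldiff: assumes "tshift ^ Suc n dvd f" shows "tshift ^ n dvd ldiff f"
proof -
  obtain h where "f = tshift ^ Suc n * h" using assms by auto
  then have "ldiff f = tshift ^ n * (of_nat (Suc n) * h + tshift * ldiff h)"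
    using ldiff_power[OF ldiff_tshift, of "Suc n"] by (simp add: distrib_left mult_ac)
  then show ?thesis by simp
qed

lemma tshift_dvd_ldiff_iter: "tshift ^ n dvd f \<Longrightarrow> tshift ^ (n - l) dvd (ldiff ^^ l) f"
proof (induction l)
  case (Suc l)
  then show ?case
    using tshift_dvd_ldiff[of "n - Suc l" "(ldiff ^^ l) f"]
    by (cases "n > l") (auto simp: Suc_diff_Suc)
qed simp

lemma diffop_apply_tshift_dvd:
  assumes A: "\<And>l. tshift ^ Suc l dvd coef A l" and g: "tshift ^ x dvd g"
  shows "tshift ^ Suc x dvd diffop_apply A g"
  unfolding diffop_apply_def
proof (rule dvd_sum)
  fix l
  have "tshift ^ (Suc l + (x - l)) dvd coef A l * (ldiff ^^ l) g"
    unfolding power_add by (intro mult_dvd_mono A tshift_dvd_ldiff_iter g)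
  moreover have "Suc x \<le> Suc l + (x - l)" by simp
  ultimately show "tshift ^ Suc x dvd coef A l * (ldiff ^^ l) g"
    using le_imp_power_dvd dvd_trans by metis
qed

text \<open>These are the functions $(1+t)^{l+1} h$ with $h$ of degree at most $-2$. A state of weight
  $l + 1$ smeared with such a function has values in the subspace $O$ of Zhu.\<close>

definition small_coeffs :: "nat \<Rightarrow> laurent set" where
  "small_coeffs l = {f. tshift ^ Suc l dvd f \<and> deg_le (int l - 1) f}"

lemma deg_le_const_mult: "deg_le d f \<Longrightarrow> deg_le d (Poly_Mapping.single 0 z * f)"
  by (simp add: deg_le_def coef_single_mult)

lemma deg_le_tshift: "deg_le 1 tshift" "coef tshift 1 = 1"
  by (auto simp: tshift_def deg_le_def lookup_add lookup_one lookup_single when_def)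

lemma deg_le_tshift_power: "deg_le (int n) (tshift ^ n)" "coef (tshift ^ n) (int n) = 1"
proof -
  have "deg_le (int n) (tshift ^ n) \<and> coef (tshift ^ n) (int n) = 1"
  proof (induction n)
    case (Suc n)
    then show ?case
      using coef_mult_top[OF deg_le_tshift(1), of "int n" "tshift ^ n"] deg_le_tshift by simp
  qed (simp add: deg_le_def lookup_one)
  then show "deg_le (int n) (tshift ^ n)" "coef (tshift ^ n) (int n) = 1" by auto
qed

lemma small_coeffs_subspace: "laurent_subspace (small_coeffs l)"
  by (auto simp: laurent_subspace_def small_coeffs_def deg_le_add deg_le_const_mult)

lemma small_coeffs_ldiff: "f \<in> small_coeffs (Suc l) \<Longrightarrow> ldiff f \<in> small_coeffs l"
  using deg_le_ldiff[of "int l" f] tshift_dvd_ldiff[of "Suc l" f] by (auto simp: small_coeffs_def)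

lemma small_coeffsE:
  assumes "f \<in> small_coeffs l"
  obtains h where "f = tshift ^ Suc l * h" "deg_le (-2) h"
proof -
  obtain h where h: "f = tshift ^ Suc l * h" using assms by (auto simp: small_coeffs_def)
  have "deg_le (-2) h"
  proof (cases "h = 0")
    case False
    \<comment> \<open>the leading coefficients of $(1+t)^{l+1}$ and of \<open>h\<close> are nonzero, so the degrees
      add\<close>
    define d where "d = Max (Poly_Mapping.keys h)"
    have ne: "Poly_Mapping.keys h \<noteq> {}" using False by simp
    have d: "deg_le d h" 
      unfolding deg_le_def d_def using Max_ge[OF finite_keys, of _ h] by (meson in_keys_iff not_le)
    have "coef h d \<noteq> 0" using Max_in[OF finite_keys ne] by (simp add: d_def in_keys_iff)
    then have "coef f (int (Suc l) + d) \<noteq> 0"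
      unfolding h using coef_mult_top(2)[OF deg_le_tshift_power(1) d, of "Suc l"] deg_le_tshift_power(2)[of "Suc l"]
      by simp
    then have "int (Suc l) + d \<le> int l - 1"
      using assms by (auto simp: small_coeffs_def deg_le_def not_le[symmetric])
    then show ?thesis using deg_le_mono[OF d] by simp
  qed simp
  then show thesis using that h by blast
qed

text \<open>Left multiplication by the generator of weight $r + 1$ in the Zhu product.\<close>

definition Lop :: "nat \<Rightarrow> diffop" where
  "Lop r = Wf r (tshift ^ Suc r * tpow (-1))"

lemma Lop_coef: "deg_le (int l) (coef (Lop r) l)" "tshift ^ Suc l dvd coef (Lop r) l"
proof -
  have "coef (Lop r) l \<in> {f. deg_le (int l) f \<and> tshift ^ Suc l dvd f}"
    unfolding Lop_def
  proof (rule coef_Wf_in[where J = "\<lambda>l. {f. deg_le (int l) f \<and> tshift ^ Suc l dvd f}"])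
    fix l f assume "f \<in> {f. deg_le (int (Suc l)) f \<and> tshift ^ Suc (Suc l) dvd f}"
    then show "ldiff f \<in> {f. deg_le (int l) f \<and> tshift ^ Suc l dvd f}"
      using deg_le_ldiff[of "int (Suc l)" f] tshift_dvd_ldiff[of "Suc l" f] by simp
  next
    have "deg_le (int (Suc r) + (-1)) (tshift ^ Suc r * tpow (-1))"
      by (intro coef_mult_top(1) deg_le_tshift_power deg_le_single) simp
    then show "tshift ^ Suc r * tpow (-1) \<in> {f. deg_le (int r) f \<and> tshift ^ Suc r dvd f}" by simp
  qed (auto simp: laurent_subspace_def deg_le_add deg_le_const_mult)
  then show "deg_le (int l) (coef (Lop r) l)" "tshift ^ Suc l dvd coef (Lop r) l" by auto
qed

text \<open>Divisibility: \<open>Lop q\<close> and \<open>Lop r\<close> both raise the order of vanishing of a function at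
  $t = -1$ by one, so the coefficient of $\partial^l$ in the commutator is divisible by
  $(1+t)^{l+1}$. Degree: both operators act by scalars to leading order, so the commutator
  lowers the degree of every function by one. The commutator is skew-adjoint, hence a
  combination of operators \<open>Wf p f\<close> with \<open>f\<close> subject to the same two conditions.\<close>

lemma Lop_commutator:
  assumes "odd q" "odd r"
  shows "dcomp (Lop q) (Lop r) - dcomp (Lop r) (Lop q) \<in>
    dop.span {Wf p f | p f. odd p \<and> f \<in> small_coeffs p}" (is "?C \<in> _")
proof (rule skew_in_span_Wf)
  show "skew ?C" using assms by (intro skew_commutator) (auto simp: Lop_def skew_Wf)
  fix l
  have "coef ?C l \<in> {f. tshift ^ Suc l dvd f}"
  proof (rule diffop_coef_in[where u = tshift and J = "\<lambda>l. {f. tshift ^ Suc l dvd f}"])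
    fix l
    have s: "tshift ^ l dvd diffop_apply (Lop r) (tshift ^ l)" for r l
      using diffop_apply_tshift_dvd[OF Lop_coef(2), of l "tshift ^ l" r] by (metis dvd_refl power_Suc2 dvd_mult_left)
    show "diffop_apply ?C (tshift ^ l) \<in> {f. tshift ^ Suc l dvd f}"
      by (auto simp: diffop_apply_diff diffop_apply_dcomp intro!: dvd_diff diffop_apply_tshift_dvd[OF Lop_coef(2)] s
           simp del: power_Suc)
  next
    fix i l f assume "i < l" "f \<in> {f. tshift ^ Suc i dvd f}"
    then have "tshift ^ (Suc i + (l - i)) dvd f * tshift ^ (l - i)"
      unfolding power_add by (intro mult_dvd_mono) auto
    then show "f * tshift ^ (l - i) \<in> {f. tshift ^ Suc l dvd f}" using \<open>i < l\<close> by simp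
  qed (auto simp: laurent_subspace_def)
  moreover have "coef ?C l \<in> {f. deg_le (int l - 1) f}"
  proof (rule diffop_coef_in[where u = tshift and J = "\<lambda>l. {f. deg_le (int l - 1) f}"])
    fix l
    obtain a where a: "\<And>d g. deg_le d g \<Longrightarrow> deg_le d (diffop_apply (Lop q) g) \<and> coef (diffop_apply (Lop q) g) d = a d * coef g d"
      using diffop_apply_degree[OF Lop_coef(1)] by metis
    obtain b where b: "\<And>d g. deg_le d g \<Longrightarrow> deg_le d (diffop_apply (Lop r) g) \<and> coef (diffop_apply (Lop r) g) d = b d * coef g d"
      using diffop_apply_degree[OF Lop_coef(1)] by metis
    \<comment> \<open>the two leading coefficients are the products of the same scalars in opposite
      order\<close>
    have "deg_le (int l - 1) (diffop_apply ?C (tshift ^ l))"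
      by (rule deg_le_sharpen)
        (auto simp: diffop_apply_diff diffop_apply_dcomp lookup_minus a b deg_le_tshift_power intro!: deg_le_diff)
    then show "diffop_apply ?C (tshift ^ l) \<in> {f. deg_le (int l - 1) f}" by simp
  next
    fix i l f assume "i < l" "f \<in> {f. deg_le (int i - 1) f}"
    moreover from this have e: "int i - 1 + int (l - i) = int l - 1" by simp
    moreover have "deg_le (int i - 1 + int (l - i)) (f * tshift ^ (l - i))"
      using \<open>f \<in> _\<close> by (intro coef_mult_top(1) deg_le_tshift_power) simp
    ultimately show "f * tshift ^ (l - i) \<in> {f. deg_le (int l - 1) f}"
      unfolding e by simp
  qed (auto simp: laurent_subspace_def deg_le_add deg_le_const_mult)
  ultimately show "coef ?C l \<in> small_coeffs l" by (auto simp: small_coeffs_def)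
qed (auto simp: small_coeffs_subspace small_coeffs_ldiff)

section \<open>Translation and Euler operators\<close>

lemma Wf_1_1: "Wf (Suc 0) 1 = Poly_Mapping.single (Suc 0) (Poly_Mapping.single 0 (-1))"
proof (rule diffop_eqI)
  fix g
  have "Poly_Mapping.single 0 (- 1 / 2) * (h + h) = Poly_Mapping.single 0 (-1) * h" for h :: laurent
    by (simp only: distrib_left flip: distrib_right single_add) simp
  then show "diffop_apply (Wf (Suc 0) 1) g = diffop_apply (Poly_Mapping.single (Suc 0) (Poly_Mapping.single 0 (-1))) g"
    by (simp add: diffop_apply_Wf)
qed

lemma Wf_1_t: "Wf (Suc 0) (tpow 1) = Poly_Mapping.single (Suc 0) (Poly_Mapping.single 1 (-1)) + Poly_Mapping.single 0 (Poly_Mapping.single 0 (-1/2))"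
proof (rule diffop_eqI)
  fix g
  let ?c = "\<lambda>z. Poly_Mapping.single 0 z :: laurent"
  have "?c (- 1 / 2) * (h + (h + g)) = ?c (-1) * h + ?c (-1/2) * g" for h g :: laurent
    by (simp only: distrib_left add.assoc[symmetric]) (simp only: flip: distrib_right single_add, simp)
  moreover have "?c (-1) * (tpow 1 * h) = Poly_Mapping.single 1 (-1) * h" for h
    by (simp add: mult_single flip: mult.assoc)
  ultimately show "diffop_apply (Wf (Suc 0) (tpow 1)) g = diffop_apply (Poly_Mapping.single (Suc 0) (Poly_Mapping.single 1 (-1)) + Poly_Mapping.single 0 (Poly_Mapping.single 0 (-1/2))) g"
    by (simp add: diffop_apply_Wf diffop_apply_add add.commute)
qed

lemma ldiff_iter_const: "(ldiff ^^ n) (Poly_Mapping.single 0 z) = (if n = 0 then Poly_Mapping.single 0 z else 0)"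
  by (induction n) auto

lemma dcocycle_Wf_1_1: "dcocycle (Wf (Suc 0) 1) B = 0"
  by (rule dcocycle_eq_0)
    (simp add: Wf_1_1 lookup_single when_def lresidue_zero ldiff_iter_const del: funpow.simps)

text \<open>$W^1[1] = -\partial_t$, so its bracket with $W^r[f]$ differentiates \<open>f\<close> up to sign; it
  will be the translation operator.\<close>

lemma translation_bracket: "dhat_bracket (Wf (Suc 0) 1, 0) (Wf r f, 0) = (- Wf r (ldiff f), 0)"
proof -
  have "dcomp (Wf (Suc 0) 1) (Wf r f) - dcomp (Wf r f) (Wf (Suc 0) 1) = - Wf r (ldiff f)"
  proof (rule diffop_eqI)
    fix g
    have 1: "diffop_apply (Wf (Suc 0) 1) g = - ldiff g" for g
      by (simp add: Wf_1_1 single_uminus diffop_apply_uminus)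
    have sw: "ldiff ((ldiff ^^ r) h) = (ldiff ^^ r) (ldiff h)" for h
      by (simp add: funpow_swap1)
    have e: "ldiff (diffop_apply (Wf r f) g) = diffop_apply (Wf r f) (ldiff g) + diffop_apply (Wf r (ldiff f)) g"
      unfolding diffop_apply_Wf ldiff_const_mult ldiff_add sw ldiff_mult[of f] ldiff_iter_add
      by (simp only: distrib_left add_ac)
    show "diffop_apply (dcomp (Wf (Suc 0) 1) (Wf r f) - dcomp (Wf r f) (Wf (Suc 0) 1)) g = diffop_apply (- Wf r (ldiff f)) g"
      unfolding diffop_apply_diff diffop_apply_dcomp 1 diffop_apply_arg_uminus diffop_apply_uminus e
      by simp
  qed
  then show ?thesis by (simp add: dhat_bracket_def dcocycle_Wf_1_1)
qed

lemma euler_deriv: "tpow 1 * ldiff ((ldiff ^^ r) h) = (ldiff ^^ r) (tpow 1 * ldiff h) - of_nat r * (ldiff ^^ r) h"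
proof (induction r arbitrary: h)
  case (Suc r)
  have sw: "(ldiff ^^ Suc n) u = (ldiff ^^ n) (ldiff u)" for n u
    by (simp only: funpow_Suc_right o_def)
  have t: "ldiff (tpow 1 * u) = u + tpow 1 * ldiff u" for u by simp
  show ?case
    unfolding sw t ldiff_iter_add Suc[of "ldiff h"] by (simp add: distrib_right)
qed simp

lemma dcocycle_Wf_1_t: "dcocycle (Wf (Suc 0) (tpow 1)) B = 0"
proof (rule dcocycle_eq_0)
  fix m n
  have c: "coef (Wf (Suc 0) (tpow 1)) m =
      (if m = Suc 0 then Poly_Mapping.single 1 (-1) else if m = 0 then Poly_Mapping.single 0 (-1/2) else 0)"
    by (auto simp: Wf_1_t lookup_add lookup_single when_def)
  have sw: "(ldiff ^^ (n + 1)) u = (ldiff ^^ n) (ldiff u)" for n u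
    by (simp only: Suc_eq_plus1[symmetric] funpow_Suc_right o_def)
  have "ldiff (Poly_Mapping.single 1 (-1)) = Poly_Mapping.single 0 (-1)"
    "ldiff (Poly_Mapping.single 0 (-1/2)) = 0" by simp_all
  then show "lresidue ((ldiff ^^ (n + 1)) (coef (Wf (Suc 0) (tpow 1)) m) * (ldiff ^^ m) (coef B n)) = 0"
    unfolding c sw by (auto simp: ldiff_iter_const lresidue_zero lresidue_const_mult simp del: ldiff_single)
qed

text \<open>$W^1[t] = -(t \partial_t + 1/2)$ is the Euler operator up to sign and shift; it will be
  the operator whose eigenvalues are the weights.\<close>

lemma euler_bracket:
  "dhat_bracket (Wf (Suc 0) (tpow 1), 0) (Wf r (tpow n), 0) = (dscale (of_nat r - of_int n) (Wf r (tpow n)), 0)"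
proof -
  let ?c = "\<lambda>z. Poly_Mapping.single 0 z :: laurent"
  let ?E = "\<lambda>g. tpow 1 * ldiff g"
  have "dcomp (Wf (Suc 0) (tpow 1)) (Wf r (tpow n)) - dcomp (Wf r (tpow n)) (Wf (Suc 0) (tpow 1))
     = dscale (of_nat r - of_int n) (Wf r (tpow n))" (is "?L = ?R")
  proof (rule diffop_eqI)
    fix g
    have W: "diffop_apply (Wf (Suc 0) (tpow 1)) g = - ?E g - ?c (1/2) * g" for g
      by (simp add: Wf_1_t diffop_apply_add diffop_apply_diff diffop_apply_uminus single_uminus)
    have En: "?E (tpow n * g) = ?c (of_int n) * (tpow n * g) + tpow n * ?E g" for g
    proof -
      have t: "tpow 1 * Poly_Mapping.single (n - 1) (of_int n * 1) = ?c (of_int n) * tpow n"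
        by (simp add: mult_single del: single_of_int)
      show ?thesis
        by (simp only: ldiff_mult ldiff_single distrib_left mult.assoc[symmetric] t)
          (simp only: mult.commute[of "tpow 1" "tpow n"])
    qed
    have c: "?E (?c z * h) = ?c z * ?E h" for z h
      by (simp only: ldiff_const_mult mult.left_commute)
    have cA: "diffop_apply A (?c z * h) = ?c z * diffop_apply A h" for A z h
      by (simp only: diffop_apply_def ldiff_iter_const_mult sum_distrib_left mult.left_commute)
    have "?E (diffop_apply (Wf r (tpow n)) g) - diffop_apply (Wf r (tpow n)) (?E g) =
        ?c (of_int n - of_nat r) * diffop_apply (Wf r (tpow n)) g"
    proof -
      have 1: "?E (tpow n * (ldiff ^^ r) g) = tpow n * (ldiff ^^ r) (?E g) + ?c (of_int n - of_nat r) * (tpow n * (ldiff ^^ r) g)"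
        unfolding En euler_deriv by (simp add: single_diff algebra_simps)
      have 2: "?E ((ldiff ^^ r) (tpow n * g)) = (ldiff ^^ r) (tpow n * ?E g) + ?c (of_int n - of_nat r) * (ldiff ^^ r) (tpow n * g)"
        unfolding En euler_deriv ldiff_iter_add ldiff_iter_const_mult by (simp add: single_diff algebra_simps)
      have d: "?E (a + b) = ?E a + ?E b" for a b by (simp add: distrib_left)
      have z: "?c y * (?c x * u) = ?c x * (?c y * u)" for x y u by (simp only: mult.left_commute)
      show ?thesis
        unfolding diffop_apply_Wf c d 1 2 by (simp only: distrib_left z[of "- 1 / 2"]) simp
    qed
    then have e: "?E (diffop_apply (Wf r (tpow n)) g) = diffop_apply (Wf r (tpow n)) (?E g) +
        ?c (of_int n - of_nat r) * diffop_apply (Wf r (tpow n)) g" by (simp only: diff_eq_eq add.commute)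
    show "diffop_apply ?L g = diffop_apply ?R g"
      unfolding diffop_apply_diff diffop_apply_dcomp W diffop_apply_arg_diff diffop_apply_arg_uminus cA e
         diffop_apply_dscale
      by (simp add: single_diff left_diff_distrib)
  qed
  then show ?thesis by (simp add: dhat_bracket_def dcocycle_Wf_1_t)
qed

section \<open>Modes of a vertex algebra smeared with Laurent polynomials\<close>

text \<open>The Borcherds identity for a vertex algebra \<open>Y\<close> and a module \<open>act\<close>, with the operations
  total on types. The sums are infinite sums of which almost all terms vanish; asking that their
  partial sums eventually agree avoids any mention of the point from which the terms vanish.\<close>

locale va_action = V: vector_space sV + M: vector_space sM
  for sV :: "complex \<Rightarrow> 'v::ab_group_add \<Rightarrow> 'v" and sM :: "complex \<Rightarrow> 'm::ab_group_add \<Rightarrow> 'm" +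
  fixes Y :: "'v \<Rightarrow> int \<Rightarrow> 'v \<Rightarrow> 'v" and act :: "'v \<Rightarrow> int \<Rightarrow> 'm \<Rightarrow> 'm"
  assumes act_add: "act (a + b) n u = act a n u + act b n u"
    and act_scale: "act (sV z a) n u = sM z (act a n u)"
    and act_arg_add: "act a n (u + v) = act a n u + act a n v"
    and act_arg_scale: "act a n (sM z u) = sM z (act a n u)"
    and borcherds: "\<forall>\<^sub>F N in sequentially.
      (\<Sum>j<N. sM (of_int m gchoose j) (act (Y a (n + int j) b) (m + k - int j) u)) =
      (\<Sum>j<N. sM ((-1) ^ j * (of_int n gchoose j))
        (act a (m + n - int j) (act b (k + int j) u)
         - sM ((-1) powi n) (act b (n + k - int j) (act a (m + int j) u))))"
begin

lemma act_0 [simp]: "act 0 n u = 0" using act_add[of 0 0 n u] by simp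
lemma act_arg_0 [simp]: "act a n 0 = 0" using act_arg_add[of a n 0 0] by simp
lemma act_sum: "act (sum f S) n u = (\<Sum>i\<in>S. act (f i) n u)"
  by (induction S rule: infinite_finite_induct) (auto simp: act_add)

text \<open>\<open>md a f\<close> is $\mathrm{Res}_z\, a(z) f(z)$, the mode of \<open>a\<close> smeared with the Laurent
  polynomial \<open>f\<close>. The products of Zhu are smeared modes with $f = (1+t)^m t^{-1}$ and
  $f = (1+t)^m t^{-2}$.\<close>

definition md :: "'v \<Rightarrow> laurent \<Rightarrow> 'm \<Rightarrow> 'm" where
  "md a f u = (\<Sum>k\<in>Poly_Mapping.keys f. sM (coef f k) (act a k u))"

lemma md_superset:
  "finite S \<Longrightarrow> Poly_Mapping.keys f \<subseteq> S \<Longrightarrow> md a f u = (\<Sum>k\<in>S. sM (coef f k) (act a k u))"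
  unfolding md_def by (rule keys_sum_superset) auto

lemma md_single [simp]: "md a (Poly_Mapping.single k x) u = sM x (act a k u)"
  by (cases "x = 0") (simp_all add: md_def)

lemma md_fun_0 [simp]: "md a 0 u = 0" by (simp add: md_def)

lemma md_fun_add: "md a (f + g) u = md a f u + md a g u"
proof -
  let ?S = "Poly_Mapping.keys f \<union> Poly_Mapping.keys g"
  have "Poly_Mapping.keys (f + g) \<subseteq> ?S" by (rule keys_add)
  then show ?thesis
    by (simp add: md_superset[of ?S] lookup_add sum.distrib M.scale_left_distrib)
qed

lemma md_fun_sum: "md a (sum f S) u = (\<Sum>i\<in>S. md a (f i) u)"
  by (induction S rule: infinite_finite_induct) (auto simp: md_fun_add)
lemma md_fun_const_mult: "md a (Poly_Mapping.single 0 z * f) u = sM z (md a f u)"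
proof -
  have "Poly_Mapping.keys (Poly_Mapping.single 0 z * f) \<subseteq> Poly_Mapping.keys f"
    by (auto simp: in_keys_iff coef_single_mult)
  then show ?thesis
    by (simp add: md_superset[of "Poly_Mapping.keys f"] coef_single_mult M.scale_sum_right)
qed
lemma md_fun_of_nat_mult: "md a (of_nat n * f) u = sM (of_nat n) (md a f u)"
  using md_fun_const_mult[of a "of_nat n" f u] by simp

lemma md_add: "md (a + b) f u = md a f u + md b f u"
  by (simp add: md_def act_add M.scale_right_distrib sum.distrib)
lemma md_scale: "md (sV z a) f u = sM z (md a f u)"
  by (simp add: md_def act_scale M.scale_sum_right mult.commute)
lemma md_0 [simp]: "md 0 f u = 0" by (simp add: md_def)
lemma md_arg_0 [simp]: "md a f 0 = 0" by (simp add: md_def)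
lemma md_arg_add: "md a f (u + v) = md a f u + md a f v"
  by (simp add: md_def act_arg_add M.scale_right_distrib sum.distrib)
lemma md_arg_scale: "md a f (sM z u) = sM z (md a f u)"
  by (simp add: md_def act_arg_scale M.scale_sum_right mult.commute)
lemma md_arg_sum: "md a f (sum h S) = (\<Sum>i\<in>S. md a f (h i))"
  by (induction S rule: infinite_finite_induct) (auto simp: md_arg_add)

end

text \<open>The divided derivative $f^{(j)} / j!$. It appears on the left of the Borcherds identity
  when the monomials are replaced by Laurent polynomials.\<close>

definition hasse :: "nat \<Rightarrow> laurent \<Rightarrow> laurent" where
  "hasse j f = (\<Sum>k\<in>Poly_Mapping.keys f. Poly_Mapping.single (k - int j) ((of_int k gchoose j) * coef f k))"

lemma hasse_superset:
  "finite S \<Longrightarrow> Poly_Mapping.keys f \<subseteq> S \<Longrightarrow>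
    hasse j f = (\<Sum>k\<in>S. Poly_Mapping.single (k - int j) ((of_int k gchoose j) * coef f k))"
  unfolding hasse_def by (rule keys_sum_superset) auto

lemma hasse_single [simp]: "hasse j (Poly_Mapping.single k x) = Poly_Mapping.single (k - int j) ((of_int k gchoose j) * x)"
  by (cases "x = 0") (simp_all add: hasse_def)

lemma hasse_zero [simp]: "hasse j 0 = 0" by (simp add: hasse_def)

lemma hasse_add: "hasse j (f + g) = hasse j f + hasse j g"
proof -
  let ?S = "Poly_Mapping.keys f \<union> Poly_Mapping.keys g"
  have "Poly_Mapping.keys (f + g) \<subseteq> ?S" by (rule keys_add)
  then show ?thesis
    by (simp add: hasse_superset[of ?S] lookup_add distrib_left single_add sum.distrib)
qed

lemma hasse_tshift_mult: "hasse (Suc j) (tshift * f) = tshift * hasse (Suc j) f + hasse j f"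
proof (induction f rule: pm_induct)
  case (single k x)
  have 1: "tshift * Poly_Mapping.single k x = Poly_Mapping.single k x + Poly_Mapping.single (k + 1) x" for k x
    by (simp add: tshift_mult mult_single add.commute)
  have 2: "k + 1 - int (Suc j) = k - int j" "k - int (Suc j) + 1 = k - int j" by auto
  show ?case
    unfolding 1 hasse_add hasse_single 2 of_int_add of_int_1 gbinomial_Suc_Suc
    by (simp only: distrib_right single_add add_ac)
qed (simp_all add: hasse_add distrib_left add_ac)

lemma hasse_0 [simp]: "hasse 0 f = f"
  by (induction f rule: pm_induct) (simp_all add: hasse_add)

lemma hasse_tshift_power: "hasse j (tshift ^ m) = of_nat (m choose j) * tshift ^ (m - j)"
proof (induction m arbitrary: j)
  case 0
  show ?case using hasse_single[of j 0 1] by (cases j) simp_all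
next
  case (Suc m)
  show ?case
  proof (cases j)
    case (Suc i)
    have "hasse j (tshift ^ Suc m) = of_nat (m choose Suc i) * (tshift * tshift ^ (m - Suc i)) + of_nat (m choose i) * tshift ^ (m - i)"
      unfolding power_Suc Suc hasse_tshift_mult Suc.IH by (simp only: mult.left_commute)
    also have "of_nat (m choose Suc i) * (tshift * tshift ^ (m - Suc i)) = of_nat (m choose Suc i) * tshift ^ (m - i)"
    proof (cases "Suc i \<le> m")
      case True
      then have "m - i = Suc (m - Suc i)" by simp
      then show ?thesis by simp
    qed simp
    finally show ?thesis by (simp add: Suc distrib_right add.commute)
  qed simp
qed

lemma tpow_power: "tpow 1 ^ j = tpow (int j)"
  by (induction j) (simp_all add: mult_single)

lemma tshift_power_expand: "tshift ^ m * tpow k = (\<Sum>j\<le>m. of_nat (m choose j) * tpow (k + int j))"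
proof -
  have "tshift ^ m = (\<Sum>j\<le>m. of_nat (m choose j) * tpow (int j))"
    unfolding tshift_def using binomial_ring[of "tpow 1" 1 m] by (simp add: tpow_power add.commute)
  then show ?thesis by (simp add: sum_distrib_right mult.assoc mult_single add.commute)
qed

context va_action
begin

lemma md_tshift_tpow: "md a (tshift ^ m * tpow k) u = (\<Sum>j\<le>m. sM (of_nat (m choose j)) (act a (k + int j) u))"
  by (simp add: tshift_power_expand md_fun_sum md_fun_of_nat_mult)

text \<open>Both sides are bilinear in \<open>f\<close> and \<open>g\<close>, and for monomials this is the Borcherds identity
  itself.\<close>

lemma borcherds_smeared:
  "\<forall>\<^sub>F N in sequentially.
    (\<Sum>j<N. md (Y a (n + int j) b) (hasse j f * g) u) =
    (\<Sum>j<N. sM ((-1) ^ j * (of_int n gchoose j))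
      (md a (tpow (n - int j) * f) (md b (tpow (int j) * g) u)
       - sM ((-1) powi n) (md b (tpow (n - int j) * g) (md a (tpow (int j) * f) u))))"
proof (induction f rule: pm_induct)
  case zero then show ?case by simp
next
  case (add f h)
  then show ?case
    by eventually_elim
      (simp add: hasse_add distrib_right distrib_left md_fun_add md_arg_add sum.distrib M.scale_right_distrib
         M.scale_right_diff_distrib sum_subtractf)
next
  case (single m x)
  show ?case
  proof (induction g rule: pm_induct)
    case zero then show ?case by simp
  next
    case (add f h)
    then show ?case
      by eventually_elim
        (simp add: distrib_right distrib_left md_fun_add md_arg_add sum.distrib M.scale_right_distrib
         M.scale_right_diff_distrib sum_subtractf)
  next
    case (single k y)
    have e: "m - int j + k = m + k - int j" "n - int j + m = m + n - int j" "int j + k = k + int j"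
       "n - int j + k = n + k - int j" "int j + m = m + int j" "k + (m - int j) = m + k - int j"
       "m + (n - int j) = m + n - int j" "k + (n - int j) = n + k - int j" for j
      by auto
    from borcherds[of m a n b k u] show ?case
    proof eventually_elim
      case (elim N)
      have "(\<Sum>j<N. md (Y a (n + int j) b) (hasse j (Poly_Mapping.single m x) * Poly_Mapping.single k y) u) =
        sM (x * y) (\<Sum>j<N. sM (of_int m gchoose j) (act (Y a (n + int j) b) (m + k - int j) u))"
        by (simp add: mult_single e M.scale_sum_right mult_ac)
      also have "\<dots> = sM (x * y) (\<Sum>j<N. sM ((-1) ^ j * (of_int n gchoose j))
        (act a (m + n - int j) (act b (k + int j) u)
         - sM ((-1) powi n) (act b (n + k - int j) (act a (m + int j) u))))"
        by (simp only: elim)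
      also have "\<dots> = (\<Sum>j<N. sM ((-1) ^ j * (of_int n gchoose j))
      (md a (tpow (n - int j) * Poly_Mapping.single m x) (md b (tpow (int j) * Poly_Mapping.single k y) u)
       - sM ((-1) powi n) (md b (tpow (n - int j) * Poly_Mapping.single k y) (md a (tpow (int j) * Poly_Mapping.single m x) u))))"
        by (simp add: mult_single e M.scale_sum_right act_arg_scale M.scale_right_diff_distrib mult_ac)
      finally show ?case .
    qed
  qed
qed

text \<open>For $f = (1+t)^m$ the divided derivatives are $\binom{m}{j} (1+t)^{m-j}$. These are the
  functions that belong to the weight of $a(n+j)b$ in the Zhu product, and all the properties of
  this product follow from this identity with $n = -1$ and $n = -2$.\<close>

lemma borcherds_tshift:
  "\<forall>\<^sub>F N in sequentially.
    (\<Sum>j\<le>m. sM (of_nat (m choose j)) (md (Y a (n + int j) b) (tshift ^ (m - j) * g) u)) =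
    (\<Sum>j<N. sM ((-1) ^ j * (of_int n gchoose j))
      (md a (tpow (n - int j) * tshift ^ m) (md b (tpow (int j) * g) u)
       - sM ((-1) powi n) (md b (tpow (n - int j) * g) (md a (tpow (int j) * tshift ^ m) u))))"
  using borcherds_smeared[of a n b "tshift ^ m" g u] eventually_gt_at_top[of m]
proof eventually_elim
  case (elim N)
  have "(\<Sum>j<N. md (Y a (n + int j) b) (hasse j (tshift ^ m) * g) u) =
     (\<Sum>j<N. sM (of_nat (m choose j)) (md (Y a (n + int j) b) (tshift ^ (m - j) * g) u))"
    by (simp add: hasse_tshift_power mult.assoc md_fun_of_nat_mult)
  also have "\<dots> = (\<Sum>j\<le>m. sM (of_nat (m choose j)) (md (Y a (n + int j) b) (tshift ^ (m - j) * g) u))"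
    using elim(2) by (intro sum.mono_neutral_right) (auto simp: binomial_eq_0)
  finally show ?case using elim(1) by simp
qed

end

section \<open>The Zhu product\<close>

text \<open>A vertex algebra graded by nonnegative weights. The state space is only a direct summand
  of the type: \<open>G m\<close> are the homogeneous subspaces, \<open>cmp m\<close> is the projection to \<open>G m\<close>, and
  their sum over \<open>m\<close> is the projection to the state space. This projection fixes the values of
  \<open>Y\<close>, can be inserted in its second argument, and is the action of the vacuum in the mode $-1$.
  \<open>T\<close> is the translation operator.\<close>

locale graded_va = va_action s s Y Y
  for s :: "complex \<Rightarrow> 'v::ab_group_add \<Rightarrow> 'v" and Y :: "'v \<Rightarrow> int \<Rightarrow> 'v \<Rightarrow> 'v" +
  fixes G :: "nat \<Rightarrow> 'v set" and T :: "'v \<Rightarrow> 'v" and cmp :: "nat \<Rightarrow> 'v \<Rightarrow> 'v" and vac :: 'v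
  assumes Y_weight: "a \<in> G m \<Longrightarrow> b \<in> G p \<Longrightarrow> Y a n b \<noteq> 0 \<Longrightarrow> \<exists>q. Y a n b \<in> G q \<and> int q = int m + int p - n - 1"
    and T_weight: "a \<in> G m \<Longrightarrow> T a \<in> G (Suc m)"
    and T_mode: "Y (T a) n b = s (- of_int n) (Y a (n - 1) b)"
    and cmp_add: "cmp m (a + b) = cmp m a + cmp m b"
    and cmp_scale: "cmp m (s z a) = s z (cmp m a)"
    and cmp_weight: "cmp m a \<in> G m"
    and cmp_hom: "a \<in> G m \<Longrightarrow> cmp p a = (if p = m then a else 0)"
    and cmp_finite: "finite {m. cmp m a \<noteq> 0}"
    and Y_cmp: "Y a n (\<Sum>m | cmp m b \<noteq> 0. cmp m b) = Y a n b"
    and cmp_Y: "(\<Sum>m | cmp m (Y a n b) \<noteq> 0. cmp m (Y a n b)) = Y a n b"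
    and vac_weight: "vac \<in> G 0"
    and vac_mode: "Y vac (-1) b = (\<Sum>m | cmp m b \<noteq> 0. cmp m b)"
begin

definition hsum :: "'v \<Rightarrow> 'v" where "hsum b = (\<Sum>m | cmp m b \<noteq> 0. cmp m b)"

text \<open>Expressions that are linear in the homogeneous components are additive, although the range
  of summation depends on the vector.\<close>

lemma cmp_sum_superset:
  assumes "finite S" "{m. cmp m a \<noteq> 0} \<subseteq> S" "\<And>m. h m 0 = 0"
  shows "(\<Sum>m | cmp m a \<noteq> 0. h m (cmp m a)) = (\<Sum>m\<in>S. h m (cmp m a))"
  using assms by (intro sum.mono_neutral_left) auto

lemma cmp_sum_add:
  assumes "\<And>m. h m 0 = 0" "\<And>m x y. h m (x + y) = h m x + h m y"
  shows "(\<Sum>m | cmp m (a + b) \<noteq> 0. h m (cmp m (a + b))) =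
    (\<Sum>m | cmp m a \<noteq> 0. h m (cmp m a)) + (\<Sum>m | cmp m b \<noteq> 0. h m (cmp m b))"
proof -
  let ?S = "{m. cmp m a \<noteq> 0} \<union> {m. cmp m b \<noteq> 0}"
  have "{m. cmp m (a + b) \<noteq> 0} \<subseteq> ?S" by (auto simp: cmp_add)
  then have "(\<Sum>m | cmp m (a + b) \<noteq> 0. h m (cmp m (a + b))) = (\<Sum>m\<in>?S. h m (cmp m (a + b)))"
    by (intro cmp_sum_superset) (auto simp: cmp_finite assms(1))
  moreover have "(\<Sum>m | cmp m a \<noteq> 0. h m (cmp m a)) = (\<Sum>m\<in>?S. h m (cmp m a))"
    "(\<Sum>m | cmp m b \<noteq> 0. h m (cmp m b)) = (\<Sum>m\<in>?S. h m (cmp m b))"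
    by (intro cmp_sum_superset; auto simp: cmp_finite assms(1))+
  ultimately show ?thesis by (simp add: cmp_add assms(2) sum.distrib)
qed

lemma cmp_sum_scale:
  assumes "\<And>m. h m 0 = 0" "\<And>m x z. h m (s z x) = sM z (h m x)" "vector_space sM"
  shows "(\<Sum>m | cmp m (s z a) \<noteq> 0. h m (cmp m (s z a))) = sM z (\<Sum>m | cmp m a \<noteq> 0. h m (cmp m a))"
proof -
  interpret W: vector_space sM by fact
  let ?S = "{m. cmp m a \<noteq> 0}"
  have "{m. cmp m (s z a) \<noteq> 0} \<subseteq> ?S" by (auto simp: cmp_scale)
  then have "(\<Sum>m | cmp m (s z a) \<noteq> 0. h m (cmp m (s z a))) = (\<Sum>m\<in>?S. h m (cmp m (s z a)))"
    by (intro cmp_sum_superset) (auto simp: cmp_finite assms(1))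
  then show ?thesis by (simp add: cmp_scale assms(2) W.scale_sum_right)
qed

lemma cmp_sum_hom:
  assumes "\<And>m. h m 0 = 0" "a \<in> G m"
  shows "(\<Sum>m | cmp m a \<noteq> 0. h m (cmp m a)) = h m a"
proof -
  have "(\<Sum>m | cmp m a \<noteq> 0. h m (cmp m a)) = (\<Sum>m\<in>{m}. h m (cmp m a))"
    by (rule cmp_sum_superset) (auto simp: cmp_hom[OF assms(2)] assms(1) split: if_splits)
  then show ?thesis by (simp add: cmp_hom[OF assms(2)])
qed

definition star :: "'v \<Rightarrow> 'v \<Rightarrow> 'v" where
  "star a b = (\<Sum>m | cmp m a \<noteq> 0. md (cmp m a) (tshift ^ m * tpow (-1)) b)"

lemma star_add: "star (a + a') b = star a b + star a' b"
  unfolding star_def by (rule cmp_sum_add) (auto simp: md_add)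
lemma star_scale: "star (s z a) b = s z (star a b)"
  unfolding star_def by (rule cmp_sum_scale) (auto simp: md_scale V.vector_space_axioms)
lemma star_hom: "a \<in> G m \<Longrightarrow> star a b = md a (tshift ^ m * tpow (-1)) b"
  unfolding star_def by (rule cmp_sum_hom) auto
lemma star_0 [simp]: "star 0 b = 0" using star_add[of 0 0 b] by simp
lemma star_sum: "star (sum f S) b = (\<Sum>i\<in>S. star (f i) b)"
  by (induction S rule: infinite_finite_induct) (auto simp: star_add)
lemma star_arg_add: "star a (b + b') = star a b + star a b'"
  by (simp add: star_def md_arg_add sum.distrib)
lemma star_arg_scale: "star a (s z b) = s z (star a b)"
  by (simp add: star_def md_arg_scale V.scale_sum_right)
lemma star_arg_0 [simp]: "star a 0 = 0" using star_arg_add[of a 0 0] by simp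

lemma md_hsum: "md a f (hsum b) = md a f b"
  by (simp add: md_def hsum_def Y_cmp)
lemma star_arg_hsum: "star a (hsum b) = star a b"
  by (simp add: star_def md_hsum)
lemma star_cmp: "star a b = (\<Sum>m | cmp m a \<noteq> 0. star (cmp m a) b)"
  unfolding star_def by (intro sum.cong refl) (simp add: star_hom[OF cmp_weight] flip: star_def)
lemma star_hsum: "star (hsum a) b = star a b"
  by (subst (2) star_cmp) (simp add: hsum_def star_sum)
lemma hsum_add: "hsum (a + b) = hsum a + hsum b"
  unfolding hsum_def by (rule cmp_sum_add) auto
lemma hsum_scale: "hsum (s z a) = s z (hsum a)"
  unfolding hsum_def by (rule cmp_sum_scale) (auto simp: V.vector_space_axioms)
lemma hsum_0 [simp]: "hsum 0 = 0" using hsum_add[of 0 0] by simp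
lemma hsum_sum: "hsum (sum f S) = (\<Sum>i\<in>S. hsum (f i))"
  by (induction S rule: infinite_finite_induct) (auto simp: hsum_add)
lemma hsum_hom: "a \<in> G m \<Longrightarrow> hsum a = a"
  unfolding hsum_def by (rule cmp_sum_hom) auto
lemma hsum_Y: "hsum (Y a n b) = Y a n b"
  by (simp add: hsum_def cmp_Y)
lemma hsum_md: "hsum (md a f b) = md a f b"
  by (simp add: md_def hsum_sum hsum_scale hsum_Y)
lemma star_vac: "star vac b = hsum b"
  by (simp add: star_hom[OF vac_weight] vac_mode hsum_def)
lemma md_cmp: "md a f b = (\<Sum>m | cmp m b \<noteq> 0. md a f (cmp m b))"
  by (subst md_hsum[symmetric]) (simp add: hsum_def md_arg_sum)

definition O_sub :: "'v set" where
  "O_sub = V.span {md a (tshift ^ m * tpow (-2)) b | a m b. a \<in> G m}"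

lemma O_simps [intro]:
  "0 \<in> O_sub" "x \<in> O_sub \<Longrightarrow> y \<in> O_sub \<Longrightarrow> x + y \<in> O_sub" "x \<in> O_sub \<Longrightarrow> y \<in> O_sub \<Longrightarrow> x - y \<in> O_sub"
  "x \<in> O_sub \<Longrightarrow> s z x \<in> O_sub" "x \<in> O_sub \<Longrightarrow> - x \<in> O_sub" "(\<And>i. i \<in> S \<Longrightarrow> h i \<in> O_sub) \<Longrightarrow> sum h S \<in> O_sub"
  by (simp_all add: O_sub_def V.span_zero V.span_add V.span_diff V.span_scale V.span_neg V.span_sum)

lemma md_T: "md (T a) g b = - md a (ldiff g) b"
proof (induction g rule: pm_induct)
  case (single k x)
  show ?case by (simp add: T_mode V.scale_minus_left mult.commute)
qed (simp_all add: md_fun_add)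

text \<open>The smeared mode of \<open>T a\<close>, which has weight $m + 1$, with $g = (1+t)^{m+1} t^{-2-k}$ lies
  in $O$ by induction. It is the mode of \<open>a\<close> smeared with $-g'$, and in $g'$ the function
  $(1+t)^m t^{-2-k-1}$ has the nonzero coefficient $-2-k$, besides functions covered by the
  induction hypothesis.\<close>

lemma md_O_tpow: "a \<in> G m \<Longrightarrow> md a (tshift ^ m * tpow (-2 - int k)) b \<in> O_sub"
proof (induction k arbitrary: a m)
  case 0
  then show ?case unfolding O_sub_def by (auto intro: V.span_base)
next
  case (Suc k)
  let ?X = "\<lambda>k. md a (tshift ^ m * tpow (-2 - int k)) b"
  let ?c = "\<lambda>z. Poly_Mapping.single 0 z :: laurent"
  let ?g = "tshift ^ Suc m * tpow (-2 - int k)"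
  have i: "-2 - int k - 1 = -2 - int (Suc k)" by simp
  have t: "tpow 1 * tpow (-2 - int (Suc k)) = tpow (-2 - int k)"
    by (simp add: mult_single)
  have d: "ldiff (tpow (-2 - int k)) = ?c (of_int (-2 - int k)) * tpow (-2 - int (Suc k))"
    by (simp only: ldiff_single mult_single i) simp
  have "ldiff ?g = ldiff (tshift ^ Suc m) * tpow (-2 - int k) + tshift ^ Suc m * ldiff (tpow (-2 - int k))"
    by (rule ldiff_mult)
  also have "\<dots> = of_nat (Suc m) * (tshift ^ m * tpow (-2 - int k)) +
      ?c (of_int (-2 - int k)) * (tshift ^ m * (tshift * tpow (-2 - int (Suc k))))"
    unfolding d ldiff_power[OF ldiff_tshift] diff_Suc_1 by (simp only: power_Suc mult_ac)
  also have "tshift * tpow (-2 - int (Suc k)) = tpow (-2 - int (Suc k)) + tpow (-2 - int k)"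
    unfolding tshift_mult t ..
  finally have "md a (ldiff ?g) b = s (of_nat (Suc m)) (?X k) + s (of_int (-2 - int k)) (?X (Suc k) + ?X k)"
    by (simp only: md_fun_add distrib_left md_fun_const_mult md_fun_of_nat_mult V.scale_right_distrib)
  then have "s (of_int (-2 - int k)) (?X (Suc k)) =
      - md (T a) ?g b - s (of_nat (Suc m)) (?X k) - s (of_int (-2 - int k)) (?X k)"
    by (simp only: md_T V.scale_right_distrib) simp
  moreover have "md (T a) ?g b \<in> O_sub" "?X k \<in> O_sub"
    using Suc.IH[OF T_weight[OF Suc.prems]] Suc.IH[OF Suc.prems] by auto
  ultimately have "s (of_int (-2 - int k)) (?X (Suc k)) \<in> O_sub"
    by auto
  then have "s (1 / of_int (-2 - int k)) (s (of_int (-2 - int k)) (?X (Suc k))) \<in> O_sub"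
    by (rule O_simps)
  moreover have "(of_int (-2 - int k) :: complex) \<noteq> 0"
    unfolding of_int_eq_0_iff by simp
  ultimately show ?case by (simp del: of_int_diff)
qed

lemma md_O:
  assumes "a \<in> G m" "deg_le (-2) h" shows "md a (tshift ^ m * h) b \<in> O_sub"
proof -
  have "h = (\<Sum>k\<in>Poly_Mapping.keys h. Poly_Mapping.single 0 (coef h k) * tpow k)"
    by (rule poly_mapping_eqI)
      (simp add: mult_single lookup_sum lookup_single when_def in_keys_iff sum.delta)
  from arg_cong[OF this, of "(*) (tshift ^ m)"]
  have "tshift ^ m * h = (\<Sum>k\<in>Poly_Mapping.keys h. Poly_Mapping.single 0 (coef h k) * (tshift ^ m * tpow k))"
    by (simp only: sum_distrib_left mult.left_commute)
  then have "md a (tshift ^ m * h) b = (\<Sum>k\<in>Poly_Mapping.keys h. s (coef h k) (md a (tshift ^ m * tpow k) b))"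
    by (simp only: md_fun_sum md_fun_const_mult)
  also have "\<dots> \<in> O_sub"
  proof (intro O_simps)
    fix k assume "k \<in> Poly_Mapping.keys h"
    then have "k \<le> -2" using assms(2) by (meson deg_le_def in_keys_iff not_le)
    then have "k = -2 - int (nat (-2 - k))" by simp
    then show "md a (tshift ^ m * tpow k) b \<in> O_sub" using md_O_tpow[OF assms(1)] by metis
  qed
  finally show ?thesis .
qed

lemma gbinomial_m1: "(-1) ^ j * ((-1 :: complex) gchoose j) = 1"
  using gbinomial_minus[of "1::complex" j] by (simp add: binomial_gbinomial[symmetric] flip: of_nat_add)

text \<open>The Borcherds identity with $n = -1$ for $(1+t)^m$ and \<open>g\<close>. Its right-hand side consists
  of terms $a[(1+t)^m t^{-1-j}] (\ldots)$, which lie in $O$ except for $j = 0$, and of terms in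
  which the outer operator is a mode of \<open>b\<close> smeared with $t^{-1-j} g$, which lie in $O$ by
  assumption. The choice $g = (1+t)^p t^{-1}$, with \<open>p\<close> the weight of \<open>b\<close>, gives associativity,
  and $g = (1+t)^p t^{-2}$ shows that $O$ is a left ideal.\<close>

lemma star_mod_assoc_general:
  assumes a: "a \<in> G m" and b: "\<And>j x. md b (tpow (-1 - int j) * g) x \<in> O_sub"
  shows "md a (tshift ^ m * tpow (-1)) (md b g c) -
    (\<Sum>j\<le>m. s (of_nat (m choose j)) (md (Y a (int j - 1) b) (tshift ^ (m - j) * g) c)) \<in> O_sub"
proof -
  let ?R = "\<lambda>j. md a (tpow (-1 - int j) * tshift ^ m) (md b (tpow (int j) * g) c)"
  let ?Q = "\<lambda>j. md b (tpow (-1 - int j) * g) (md a (tpow (int j) * tshift ^ m) c)"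
  let ?S = "\<Sum>j\<le>m. s (of_nat (m choose j)) (md (Y a (int j - 1) b) (tshift ^ (m - j) * g) c)"
  have "\<forall>\<^sub>F N in sequentially. ?S = (\<Sum>j<N. ?R j + ?Q j)"
    using borcherds_tshift[of m a "-1" b g c] by (simp add: gbinomial_m1)
  then have "\<forall>\<^sub>F N in sequentially. N > 0 \<and> ?S = (\<Sum>j<N. ?R j + ?Q j)"
    using eventually_gt_at_top[of 0] by eventually_elim blast
  from eventually_happens'[OF sequentially_bot this]
  obtain N where N: "N > 0" "?S = (\<Sum>j<N. ?R j + ?Q j)" by blast
  obtain K where K: "N = Suc K" using N(1) gr0_implies_Suc by blast
  define Z where "Z = (\<Sum>j<K. ?R (Suc j)) + (\<Sum>j<N. ?Q j)"
  have "(\<Sum>j<N. ?R j) = ?R 0 + (\<Sum>j<K. ?R (Suc j))"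
    unfolding K by (rule sum.lessThan_Suc_shift)
  moreover have "?R 0 = md a (tshift ^ m * tpow (-1)) (md b g c)"
    by (simp add: mult.commute)
  ultimately have S: "?S = md a (tshift ^ m * tpow (-1)) (md b g c) + Z"
    unfolding N(2) Z_def sum.distrib by (simp only: add.assoc)
  have "Z \<in> O_sub" unfolding Z_def
  proof (intro O_simps b)
    fix j
    show "?R (Suc j) \<in> O_sub"
      unfolding mult.commute[of "tpow _" "tshift ^ m"] by (intro md_O a deg_le_single) simp
  qed
  then show ?thesis unfolding S using O_simps(5)[of Z] by simp
qed

lemma Y_weight_cases:
  assumes "a \<in> G m" "b \<in> G p" "int q = int m + int p - n - 1"
  shows "Y a n b \<in> G q \<or> Y a n b = 0"
proof (cases "Y a n b = 0")
  case False
  then obtain q' where q': "Y a n b \<in> G q'" "int q' = int m + int p - n - 1"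
    using Y_weight[OF assms(1,2)] by blast
  then have "q' = q" using assms(3) by simp
  then show ?thesis using q'(1) by simp
qed simp

lemma star_O_hom:
  assumes a: "a \<in> G m" and b: "b \<in> G p"
  shows "star a (md b (tshift ^ p * tpow (-2)) c) \<in> O_sub"
proof -
  have t: "tpow (- 1 - int j) * (tshift ^ p * tpow (-2)) = tshift ^ p * tpow (-3 - int j)" for j
    by (simp add: mult.left_commute mult_single)
  let ?X = "md a (tshift ^ m * tpow (-1)) (md b (tshift ^ p * tpow (-2)) c)"
  let ?S = "\<Sum>j\<le>m. s (of_nat (m choose j)) (md (Y a (int j - 1) b) (tshift ^ (m - j) * (tshift ^ p * tpow (-2))) c)"
  have "?X - ?S \<in> O_sub"
    by (rule star_mod_assoc_general[OF a]) (unfold t, intro md_O b deg_le_single, simp)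
  moreover have "md (Y a (int j - 1) b) (tshift ^ (m - j) * (tshift ^ p * tpow (-2))) c \<in> O_sub" if "j \<le> m" for j
  proof -
    have "Y a (int j - 1) b \<in> G (m - j + p) \<or> Y a (int j - 1) b = 0"
      using that by (intro Y_weight_cases[OF a b]) simp
    then show ?thesis
      unfolding mult.assoc[symmetric] power_add[symmetric]
    proof
      assume "Y a (int j - 1) b \<in> G (m - j + p)"
      then show "md (Y a (int j - 1) b) (tshift ^ (m - j + p) * tpow (-2)) c \<in> O_sub"
        by (intro md_O deg_le_single) simp_all
    qed auto
  qed
  then have "?S \<in> O_sub"
    by (intro O_simps) simp
  ultimately have "(?X - ?S) + ?S \<in> O_sub" by (rule O_simps(2))
  then show ?thesis unfolding star_hom[OF a] by (simp only: diff_add_cancel)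
qed

lemma star_O_right:
  assumes "x \<in> O_sub" shows "star a x \<in> O_sub"
proof -
  have "star a' x \<in> O_sub" if "a' \<in> G m" for a' m
    using assms[unfolded O_sub_def]
  proof (induction rule: V.span_induct_alt)
    case (step z y w)
    from step(1) obtain e n u where y: "y = md e (tshift ^ n * tpow (-2)) u" "e \<in> G n" by blast
    have "star a' y \<in> O_sub" unfolding y(1) by (rule star_O_hom[OF that y(2)])
    then show ?case unfolding star_arg_add star_arg_scale by (rule O_simps(2)[OF O_simps(4) step(2)])
  qed auto
  then have "\<And>m. star (cmp m a) x \<in> O_sub" using cmp_weight by blast
  then show ?thesis by (subst star_cmp) auto
qed

lemma star_star_hom:
  assumes a: "a \<in> G m" and b: "b \<in> G p"
  shows "star (star a b) c = (\<Sum>j\<le>m. s (of_nat (m choose j)) (md (Y a (int j - 1) b) (tshift ^ (m - j) * (tshift ^ p * tpow (-1))) c))"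
proof -
  have "star (Y a (int j - 1) b) c = md (Y a (int j - 1) b) (tshift ^ (m - j) * (tshift ^ p * tpow (-1))) c" if "j \<le> m" for j
  proof -
    have "Y a (int j - 1) b \<in> G (m - j + p) \<or> Y a (int j - 1) b = 0"
      using that by (intro Y_weight_cases[OF a b]) (simp add: of_nat_diff)
    then show ?thesis
      unfolding mult.assoc[symmetric] power_add[symmetric] by (auto simp: star_hom)
  qed
  then show ?thesis
    unfolding star_hom[OF a, of b] md_tshift_tpow star_sum star_scale by (simp add: add.commute[of "-1"])
qed

lemma star_assoc: "star (star a b) c - star a (star b c) \<in> O_sub"
proof -
  have hom: "star (star a b) c - star a (star b c) \<in> O_sub" if a: "a \<in> G m" and b: "b \<in> G p" for a m b p
  proof -
    have t: "tpow (- 1 - int j) * (tshift ^ p * tpow (-1)) = tshift ^ p * tpow (-2 - int j)" for j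
      by (simp add: mult.left_commute mult_single)
    have "star a (star b c) - star (star a b) c \<in> O_sub"
      unfolding star_star_hom[OF a b] unfolding star_hom[OF b] unfolding star_hom[OF a]
      by (rule star_mod_assoc_general[OF a]) (unfold t, intro md_O b deg_le_single, simp)
    then show ?thesis using O_simps(5) by fastforce
  qed
  have "star (star a b) c - star a (star b c) = (\<Sum>m | cmp m a \<noteq> 0. \<Sum>p | cmp p b \<noteq> 0.
     star (star (cmp m a) (cmp p b)) c - star (cmp m a) (star (cmp p b) c))"
  proof -
    have "star (star a b) c = (\<Sum>m | cmp m a \<noteq> 0. star (star (cmp m a) (hsum b)) c)"
      by (simp only: star_arg_hsum star_sum[symmetric]) (simp only: hsum_def[symmetric] star_hsum)
    moreover have "star a (star b c) = (\<Sum>m | cmp m a \<noteq> 0. star (cmp m a) (star (hsum b) c))"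
      by (simp only: star_hsum star_cmp[symmetric])
    moreover have "star a' (sum f S) = (\<Sum>i\<in>S. star a' (f i))" for a' f and S :: "nat set"
      by (induction S rule: infinite_finite_induct) (auto simp: star_arg_add)
    ultimately show ?thesis by (simp add: hsum_def star_sum sum_subtractf)
  qed
  also have "\<dots> \<in> O_sub" by (intro O_simps(6) hom[OF cmp_weight cmp_weight])
  finally show ?thesis .
qed

text \<open>The Borcherds identity with $n = -2$ for $(1+t)^m$ and $g = (1+t)^{p+1} t^{-1}$: on the
  left stands $(a \circ b) * c$, and on the right all outer operators are smeared with functions
  of degree at most $-2$ times the power of $1 + t$ that belongs to their weight.\<close>

lemma star_O_left:
  assumes "x \<in> O_sub" shows "star x c \<in> O_sub"
proof -
  have hom: "star (md a (tshift ^ m * tpow (-2)) b) c \<in> O_sub" if a: "a \<in> G m" and b: "b \<in> G p" for a m b p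
  proof -
    let ?g = "tshift ^ Suc p * tpow (-1)"
    have "star (Y a (int j - 2) b) c = md (Y a (int j - 2) b) (tshift ^ (m - j) * ?g) c" if "j \<le> m" for j
    proof -
      have "Y a (int j - 2) b \<in> G (m - j + Suc p) \<or> Y a (int j - 2) b = 0"
        using that by (intro Y_weight_cases[OF a b]) (simp add: of_nat_diff)
      then show ?thesis
        unfolding mult.assoc[symmetric] power_add[symmetric] by (auto simp: star_hom)
    qed
    then have e: "star (md a (tshift ^ m * tpow (-2)) b) c =
       (\<Sum>j\<le>m. s (of_nat (m choose j)) (md (Y a (-2 + int j) b) (tshift ^ (m - j) * ?g) c))"
      unfolding md_tshift_tpow star_sum star_scale by (simp add: add.commute[of "-2"])
    \<comment> \<open>one of the \<open>p + 1\<close> factors $1 + t$ exceeds the weight of \<open>b\<close> and is expanded\<close>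
    have t: "tpow (-2 - int j) * ?g = tshift ^ p * (tpow (-3 - int j) + tpow (-2 - int j))" for j
    proof -
      have "tpow (-2 - int j) * ?g = tshift ^ p * (tshift * (tpow (-2 - int j) * tpow (-1)))"
        by (simp only: power_Suc mult_ac)
      then show ?thesis by (simp add: tshift_mult mult_single)
    qed
    have "\<exists>N. star (md a (tshift ^ m * tpow (-2)) b) c =
     (\<Sum>j<N. s ((-1) ^ j * (of_int (-2) gchoose j))
      (md a (tpow (-2 - int j) * tshift ^ m) (md b (tpow (int j) * ?g) c)
       - s ((-1) powi (-2)) (md b (tpow (-2 - int j) * ?g) (md a (tpow (int j) * tshift ^ m) c))))"
      unfolding e by (rule eventually_happens'[OF sequentially_bot borcherds_tshift])
    then obtain N where "star (md a (tshift ^ m * tpow (-2)) b) c =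
     (\<Sum>j<N. s ((-1) ^ j * (of_int (-2) gchoose j))
      (md a (tpow (-2 - int j) * tshift ^ m) (md b (tpow (int j) * ?g) c)
       - s ((-1) powi (-2)) (md b (tpow (-2 - int j) * ?g) (md a (tpow (int j) * tshift ^ m) c))))" ..
    also have "\<dots> \<in> O_sub"
      unfolding t mult.commute[of "tpow _" "tshift ^ m"]
      by (intro O_simps md_O a b deg_le_add deg_le_single) simp_all
    finally show ?thesis .
  qed
  have gen: "star (md a (tshift ^ m * tpow (-2)) b) c \<in> O_sub" if a: "a \<in> G m" for a m b
    by (subst md_cmp) (auto simp: star_sum intro!: hom[OF a cmp_weight])
  show ?thesis
    using assms[unfolded O_sub_def]
  proof (induction rule: V.span_induct_alt)
    case (step z y w)
    from step(1) obtain e n u where y: "y = md e (tshift ^ n * tpow (-2)) u" "e \<in> G n" by blast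
    have "star y c \<in> O_sub" unfolding y(1) by (rule gen[OF y(2)])
    then show ?case unfolding star_add star_scale by (rule O_simps(2)[OF O_simps(4) step(2)])
  qed auto
qed

end

section \<open>Commutativity from commuting generators\<close>

text \<open>Modulo $O$ the algebra is spanned by iterated products of the generators \<open>w i\<close>, and left
  multiplications by generators commute.\<close>

locale zhu_generated = graded_va s Y G T cmp vac
  for s :: "complex \<Rightarrow> 'v::ab_group_add \<Rightarrow> 'v" and Y G T cmp vac +
  fixes I :: "'i set" and w :: "'i \<Rightarrow> 'v" and d :: "'i \<Rightarrow> nat"
  assumes w_weight: "i \<in> I \<Longrightarrow> w i \<in> G (d i)"
    and w_comm: "i \<in> I \<Longrightarrow> j \<in> I \<Longrightarrow> star (w i) (star (w j) x) - star (w j) (star (w i) x) \<in> O_sub"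
    and w_span: "hsum a \<in> V.span ({foldr (\<lambda>i. star (w i)) is vac | is. set is \<subseteq> I} \<union> O_sub)"
begin

abbreviation L :: "'i list \<Rightarrow> 'v \<Rightarrow> 'v" where
  "L is \<equiv> foldr (\<lambda>i. star (w i)) is"

lemma O_trans: "x - y \<in> O_sub \<Longrightarrow> y - z \<in> O_sub \<Longrightarrow> x - z \<in> O_sub"
  using O_simps(2)[of "x - y" "y - z"] by simp
lemma O_sym: "x - y \<in> O_sub \<Longrightarrow> y - x \<in> O_sub"
  using O_simps(5)[of "x - y"] by simp
lemma star_arg_diff: "star a (x - y) = star a x - star a y"
  using star_arg_add[of a "x - y" y] by (simp add: eq_diff_eq)

text \<open>By associativity a product of generators acts by left multiplication as the composite of
  the left multiplications by its factors.\<close>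

lemma star_L: "star (L is vac) b - L is (hsum b) \<in> O_sub"
proof (induction "is")
  case (Cons i "is")
  have "star (star (w i) (L is vac)) b - star (w i) (star (L is vac) b) \<in> O_sub" by (rule star_assoc)
  moreover have "star (w i) (star (L is vac) b) - star (w i) (L is (hsum b)) \<in> O_sub"
    using star_O_right[OF Cons] by (simp add: star_arg_diff)
  ultimately show ?case unfolding foldr.simps o_def by (rule O_trans)
qed (auto simp: star_vac)

lemma L_swap1: "i \<in> I \<Longrightarrow> set is \<subseteq> I \<Longrightarrow> star (w i) (L is x) - L is (star (w i) x) \<in> O_sub"
proof (induction "is")
  case (Cons j "is")
  have "star (w i) (star (w j) (L is x)) - star (w j) (star (w i) (L is x)) \<in> O_sub"
    using Cons.prems by (intro w_comm) auto
  moreover have "star (w j) (star (w i) (L is x)) - star (w j) (L is (star (w i) x)) \<in> O_sub"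
    using star_O_right[OF Cons.IH] Cons.prems by (simp add: star_arg_diff)
  ultimately show ?case unfolding foldr.simps o_def by (rule O_trans)
qed auto

lemma L_swap: "set is \<subseteq> I \<Longrightarrow> set js \<subseteq> I \<Longrightarrow> L is (L js x) - L js (L is x) \<in> O_sub"
proof (induction "is")
  case (Cons i "is")
  have "star (w i) (L is (L js x)) - star (w i) (L js (L is x)) \<in> O_sub"
    using star_O_right[OF Cons.IH] Cons.prems by (simp add: star_arg_diff)
  moreover have "star (w i) (L js (L is x)) - L js (star (w i) (L is x)) \<in> O_sub"
    using Cons.prems by (intro L_swap1) auto
  ultimately show ?case unfolding foldr.simps o_def by (rule O_trans)
qed auto

lemma hsum_L: "hsum (L is vac) = L is vac"
proof (cases "is")
  case Nil then show ?thesis by (simp add: hsum_hom[OF vac_weight])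
next
  case (Cons i js)
  then show ?thesis by (simp add: star_def hsum_sum hsum_md)
qed

text \<open>Modulo $O$ both factors can be taken to be products of generators; then the two orders
  differ by a permutation of commuting left multiplications. That $O$ is a two-sided ideal takes
  care of the rest.\<close>

theorem star_comm: "star a b - star b a \<in> O_sub"
proof -
  let ?S = "{L is vac | is. set is \<subseteq> I}"
  have 1: "star x y - star y x \<in> O_sub" if x: "x \<in> ?S \<union> O_sub" and y: "y \<in> ?S \<union> O_sub" for x y
  proof -
    consider "x \<in> O_sub \<or> y \<in> O_sub" | "x \<in> ?S" "y \<in> ?S" using x y by auto
    then show ?thesis
    proof cases
      case 1 then show ?thesis by (auto intro: star_O_left star_O_right)
    next
      case 2
      then obtain "is" js where i: "x = L is vac" "set is \<subseteq> I" and j: "y = L js vac" "set js \<subseteq> I" by auto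
      have "star x y - L is y \<in> O_sub" using star_L[of "is" y] by (simp add: i j hsum_L)
      moreover have "star y x - L js x \<in> O_sub" using star_L[of js x] by (simp add: i j hsum_L)
      moreover have "L is y - L js x \<in> O_sub" unfolding i j using i j by (intro L_swap)
      ultimately show ?thesis by (meson O_trans O_sym)
    qed
  qed
  have 2: "star x y - star y x \<in> O_sub" if x: "x \<in> V.span (?S \<union> O_sub)" and y: "y \<in> ?S \<union> O_sub" for x y
    using x
  proof (induction rule: V.span_induct_alt)
    case base then show ?case by auto
  next
    case (step z u v)
    have "star (s z u + v) y - star y (s z u + v) = s z (star u y - star y u) + (star v y - star y v)"
      by (simp add: star_add star_scale star_arg_add star_arg_scale V.scale_right_diff_distrib)
    then show ?case using 1[OF step(1) y] step(2) by auto
  qed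
  have 3: "star x y - star y x \<in> O_sub" if x: "x \<in> V.span (?S \<union> O_sub)" and y: "y \<in> V.span (?S \<union> O_sub)" for x y
    using y
  proof (induction rule: V.span_induct_alt)
    case base then show ?case by auto
  next
    case (step z u v)
    have "star x (s z u + v) - star (s z u + v) x = s z (star x u - star u x) + (star x v - star v x)"
      by (simp add: star_add star_scale star_arg_add star_arg_scale V.scale_right_diff_distrib)
    then show ?case using 2[OF x step(1)] step(2) by auto
  qed
  show ?thesis using 3[OF w_span w_span, of a b] by (simp add: star_hsum star_arg_hsum)
qed

end

section \<open>The lowest component of a module\<close>

text \<open>Of an admissible module only the component \<open>M0\<close> of degree $0$ is kept: for \<open>a\<close> of weight
  \<open>m\<close> the modes $a(n)$ with $n \ge m$ have negative degree and kill it, and $a(m-1)$ preserves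
  it.\<close>

locale graded_va_module = graded_va s Y G T cmp vac + N: va_action s sM Y act
  for s :: "complex \<Rightarrow> 'v::ab_group_add \<Rightarrow> 'v" and Y G T cmp vac
    and sM :: "complex \<Rightarrow> 'm::ab_group_add \<Rightarrow> 'm" and act +
  fixes M0 :: "'m set"
  assumes M0_subspace: "N.M.subspace M0"
    and M0_kill: "a \<in> G m \<Longrightarrow> u \<in> M0 \<Longrightarrow> n \<ge> int m \<Longrightarrow> act a n u = 0"
    and M0_zero_mode: "a \<in> G m \<Longrightarrow> u \<in> M0 \<Longrightarrow> act a (int m - 1) u \<in> M0"
    and M0_vac: "u \<in> M0 \<Longrightarrow> act vac (-1) u = u"
begin

text \<open>The zero mode $o(a) = a(m-1)$ for \<open>a\<close> of weight \<open>m\<close>, extended linearly. On \<open>M0\<close> this is a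
  representation of the Zhu algebra.\<close>

definition om :: "'v \<Rightarrow> 'm \<Rightarrow> 'm" where
  "om a u = (\<Sum>m | cmp m a \<noteq> 0. act (cmp m a) (int m - 1) u)"

lemma om_add: "om (a + b) u = om a u + om b u"
  unfolding om_def by (rule cmp_sum_add) (auto simp: N.act_add)
lemma om_scale: "om (s z a) u = sM z (om a u)"
  unfolding om_def by (rule cmp_sum_scale) (auto simp: N.act_scale N.M.vector_space_axioms)
lemma om_hom: "a \<in> G m \<Longrightarrow> om a u = act a (int m - 1) u"
  unfolding om_def by (rule cmp_sum_hom) auto
lemma om_0 [simp]: "om 0 u = 0" using om_add[of 0 0 u] by simp
lemma om_sum: "om (sum f S) u = (\<Sum>i\<in>S. om (f i) u)"
  by (induction S rule: infinite_finite_induct) (auto simp: om_add)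
lemma om_arg_add: "om a (u + v) = om a u + om a v"
  by (simp add: om_def N.act_arg_add sum.distrib)
lemma om_arg_scale: "om a (sM z u) = sM z (om a u)"
  by (simp add: om_def N.act_arg_scale N.M.scale_sum_right)
lemma om_arg_0 [simp]: "om a 0 = 0" using om_arg_add[of a 0 0] by simp
lemma om_arg_sum: "om a (sum f S) = (\<Sum>i\<in>S. om a (f i))"
  by (induction S rule: infinite_finite_induct) (auto simp: om_arg_add)
lemma om_cmp: "om a u = (\<Sum>m | cmp m a \<noteq> 0. om (cmp m a) u)"
  unfolding om_def by (intro sum.cong refl) (simp add: om_hom[OF cmp_weight] flip: om_def)
lemma om_hsum: "om (hsum a) u = om a u"
  by (subst (2) om_cmp) (simp add: hsum_def om_sum)
lemma om_mem: "u \<in> M0 \<Longrightarrow> om a u \<in> M0"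
  by (subst om_cmp) (auto simp: om_hom[OF cmp_weight] intro!: N.M.subspace_sum M0_subspace M0_zero_mode cmp_weight)
lemma om_vac: "u \<in> M0 \<Longrightarrow> om vac u = u"
  by (simp add: om_hom[OF vac_weight] M0_vac)

lemma gchoose_int: "(of_int (int m) :: complex) gchoose j = of_nat (m choose j)"
  by (simp add: binomial_gbinomial)

lemma om_Y:
  assumes "a \<in> G m" "b \<in> G p" "int m + int p - n - 1 \<ge> 0"
  shows "om (Y a n b) u = act (Y a n b) (int m + int p - n - 2) u"
proof -
  define q where "q = nat (int m + int p - n - 1)"
  have q: "int q = int m + int p - n - 1" using assms(3) by (simp add: q_def)
  then have e: "int m + int p - n - 2 = int q - 1" by simp
  show ?thesis unfolding e using Y_weight_cases[OF assms(1,2) q] by (auto simp: om_hom)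
qed

text \<open>This is the left-hand side of the Borcherds identity for the exponent $m$ of the first
  factor, so that zero modes of Zhu products can be expanded by the right-hand side.\<close>

lemma om_md:
  assumes a: "a \<in> G m" and b: "b \<in> G p" and n: "n \<le> -1"
  shows "\<forall>\<^sub>F N in sequentially. om (md a (tshift ^ m * tpow n) b) u =
     (\<Sum>j<N. sM (of_int (int m) gchoose j) (act (Y a (n + int j) b) (int m + (int p - n - 2) - int j) u))"
  using eventually_gt_at_top[of m]
proof eventually_elim
  case (elim N)
  have "om (md a (tshift ^ m * tpow n) b) u = (\<Sum>j\<le>m. sM (of_nat (m choose j)) (om (Y a (n + int j) b) u))"
    by (simp add: md_tshift_tpow om_sum om_scale)
  also have "\<dots> = (\<Sum>j\<le>m. sM (of_nat (m choose j)) (act (Y a (n + int j) b) (int m + (int p - n - 2) - int j) u))"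
  proof (intro sum.cong refl)
    fix j assume "j \<in> {..m}"
    then have "om (Y a (n + int j) b) u = act (Y a (n + int j) b) (int m + int p - (n + int j) - 2) u"
      using n by (intro om_Y a b) auto
    moreover have "int m + int p - (n + int j) - 2 = int m + (int p - n - 2) - int j" by simp
    ultimately show "sM (of_nat (m choose j)) (om (Y a (n + int j) b) u) =
       sM (of_nat (m choose j)) (act (Y a (n + int j) b) (int m + (int p - n - 2) - int j) u)" by simp
  qed
  also have "\<dots> = (\<Sum>j<N. sM (of_int (int m) gchoose j) (act (Y a (n + int j) b) (int m + (int p - n - 2) - int j) u))"
    unfolding gchoose_int using elim by (intro sum.mono_neutral_left) (auto simp: binomial_eq_0)
  finally show ?case .
qed

text \<open>On the right-hand side of the Borcherds identity with $n = -1$ the inner operators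
  $a(m+j)$ and $b(p-1+j)$ with $j > 0$ kill \<open>M0\<close>, so only $a(m-1) b(p-1)$ remains.\<close>

lemma om_star_hom:
  assumes a: "a \<in> G m" and b: "b \<in> G p" and u: "u \<in> M0"
  shows "om (star a b) u = om a (om b u)"
proof -
  have "\<forall>\<^sub>F N in sequentially. om (star a b) u = om a (om b u)"
    using om_md[OF a b order_refl, of u] N.borcherds[of "int m" a "-1" b "int p - (-1) - 2" u] eventually_gt_at_top[of 0]
  proof eventually_elim
    case (elim N)
    have z1: "act a (int m + int j) u = 0" for j by (rule M0_kill[OF a u]) simp
    have z2: "act b (int p - (-1) - 2 + int j) u = (if j = 0 then om b u else 0)" for j
      using M0_kill[OF b u, of "int p - (-1) - 2 + int j"] by (auto simp: om_hom[OF b])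
    obtain K where K: "N = Suc K" using elim(3) gr0_implies_Suc by blast
    have "om (star a b) u = (\<Sum>j<N. sM ((-1) ^ j * (of_int (-1) gchoose j))
        (act a (int m + (-1) - int j) (act b (int p - (-1) - 2 + int j) u)
         - sM ((-1) powi (-1)) (act b (int p - (-1) - 2 + (-1) - int j) (act a (int m + int j) u))))"
      using elim(1,2) unfolding star_hom[OF a] by (simp add: add.commute)
    also have "\<dots> = act a (int m - 1) (om b u)"
      unfolding z1 z2 K sum.lessThan_Suc_shift by simp
    finally show ?case by (simp add: om_hom[OF a])
  qed
  then show ?thesis by simp
qed

text \<open>With $n = -2$ the inner operators are $a(m+j)$ and $b(p+j)$, all of which kill \<open>M0\<close>.\<close>

lemma om_O_hom:
  assumes a: "a \<in> G m" and b: "b \<in> G p" and u: "u \<in> M0"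
  shows "om (md a (tshift ^ m * tpow (-2)) b) u = 0"
proof -
  have n2: "(-2 :: int) \<le> -1" by simp
  have "\<forall>\<^sub>F N in sequentially. om (md a (tshift ^ m * tpow (-2)) b) u = 0"
    using om_md[OF a b n2, of u] N.borcherds[of "int m" a "-2" b "int p - (-2) - 2" u]
  proof eventually_elim
    case (elim N)
    have z1: "act a (int m + int j) u = 0" for j by (rule M0_kill[OF a u]) simp
    have z2: "act b (int p - (-2) - 2 + int j) u = 0" for j by (rule M0_kill[OF b u]) simp
    have "om (md a (tshift ^ m * tpow (-2)) b) u = (\<Sum>j<N. sM ((-1) ^ j * (of_int (-2) gchoose j))
        (act a (int m + (-2) - int j) (act b (int p - (-2) - 2 + int j) u)
         - sM ((-1) powi (-2)) (act b (-2 + (int p - (-2) - 2) - int j) (act a (int m + int j) u))))"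
      using elim by simp
    then show ?case unfolding z1 z2 by simp
  qed
  then show ?thesis by simp
qed

lemma om_O: assumes "x \<in> O_sub" and u: "u \<in> M0" shows "om x u = 0"
  using assms(1)[unfolded O_sub_def]
proof (induction rule: V.span_induct_alt)
  case (step z y w)
  then obtain a m b where y: "y = md a (tshift ^ m * tpow (-2)) b" "a \<in> G m" by blast
  have "om y u = 0"
    unfolding y(1) by (subst md_cmp) (simp add: om_sum om_O_hom[OF y(2) cmp_weight u])
  then show ?case by (simp add: om_add om_scale step)
qed simp

lemma om_star: assumes u: "u \<in> M0" shows "om (star a b) u = om a (om b u)"
proof -
  have "star a b = (\<Sum>m | cmp m a \<noteq> 0. \<Sum>p | cmp p b \<noteq> 0. star (cmp m a) (cmp p b))"
  proof -
    have "star a b = star (hsum a) (hsum b)" by (simp add: star_hsum star_arg_hsum)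
    moreover have "star a' (sum f S) = (\<Sum>i\<in>S. star a' (f i))" for a' f and S :: "nat set"
      by (induction S rule: infinite_finite_induct) (auto simp: star_arg_add)
    ultimately show ?thesis by (simp only: hsum_def star_sum) (rule sum.swap)
  qed
  then have "om (star a b) u = (\<Sum>m | cmp m a \<noteq> 0. \<Sum>p | cmp p b \<noteq> 0. om (cmp m a) (om (cmp p b) u))"
    by (simp add: om_sum om_star_hom[OF cmp_weight cmp_weight u])
  also have "\<dots> = (\<Sum>m | cmp m a \<noteq> 0. om (cmp m a) (om b u))"
    by (intro sum.cong refl) (simp only: om_arg_sum[symmetric] om_cmp[symmetric])
  also have "\<dots> = om a (om b u)" by (rule om_cmp[symmetric])
  finally show ?thesis .
qed

end

section \<open>Linear maps into modules and quotient modules\<close>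

text \<open>Along such a map the elements of a module with a carrier are represented by vectors of a
  type. The main examples are realizations and the quotient map onto $\mathcal V_c$, for which
  no section is chosen.\<close>

locale linear_into = F: vector_space s + Q: Module.module complex_ring Q
  for s :: "complex \<Rightarrow> 'f::ab_group_add \<Rightarrow> 'f" and Q :: "(complex, 'q, 'x) module_scheme" (structure) +
  fixes th :: "'f \<Rightarrow> 'q"
  assumes th_closed [simp]: "th u \<in> carrier Q"
    and th_add: "th (u + v) = th u \<oplus>\<^bsub>Q\<^esub> th v"
    and th_scale: "th (s z u) = z \<odot>\<^bsub>Q\<^esub> th u"
begin

lemma th_0 [simp]: "th 0 = \<zero>\<^bsub>Q\<^esub>"
  using th_scale[of 0 0] Q.smult_l_null[of "th 0"] by simp

lemma th_uminus: "th (- u) = \<ominus>\<^bsub>Q\<^esub> th u"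
  using th_scale[of "-1" u] Q.smult_l_minus[of 1 "th u"] th_add[of "- u" u]
  by (intro Q.minus_equality[symmetric]) simp_all

lemma th_diff: "th (u - v) = th u \<ominus>\<^bsub>Q\<^esub> th v"
  using th_add[of u "- v"] by (simp add: th_uminus a_minus_def)

lemma th_sum: "finite S \<Longrightarrow> th (sum g S) = finsum Q (\<lambda>i. th (g i)) S"
  by (induction S rule: finite_induct) (auto simp: th_add)

lemma fin_sum_th:
  assumes "finite S" "\<And>i. i \<notin> S \<Longrightarrow> th (g i) = \<zero>\<^bsub>Q\<^esub>"
  shows "fin_sum Q (\<lambda>i. th (g i)) = th (sum g S)"
proof -
  have "finsum Q (\<lambda>i. th (g i)) {i. th (g i) \<noteq> \<zero>\<^bsub>Q\<^esub>} = finsum Q (\<lambda>i. th (g i)) S"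
    using assms by (intro Q.add.finprod_mono_neutral_cong_left) auto
  then show ?thesis using assms(1) by (simp add: fin_sum_def th_sum)
qed

lemma subspace_vimage:
  assumes "subspace_of H Q" shows "F.subspace {u. th u \<in> H}"
proof -
  note E = Q.submoduleE[OF assms]
  from E(2) obtain x where "x \<in> H" by auto
  then have "\<zero>\<^bsub>Q\<^esub> \<in> H" using E(4)[of 0 x] E(1) Q.smult_l_null[of x] by auto
  then show ?thesis using E(4,5) by (auto simp: F.subspace_def th_add th_scale)
qed

end

text \<open>A module with a carrier, together with a linear surjection \<open>th\<close> from a type and a linear
  section \<open>em\<close>. Identities in the module can then be proved in the type, where the simplifier
  needs no carrier conditions; \<open>em \<circ> th\<close> is a projection onto the copy of the module.\<close>

locale realization = linear_into s Q th
  for s :: "complex \<Rightarrow> 'f::ab_group_add \<Rightarrow> 'f" and Q :: "(complex, 'q, 'x) module_scheme" (structure) and th +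
  fixes em :: "'q \<Rightarrow> 'f"
  assumes em_add: "x \<in> carrier Q \<Longrightarrow> y \<in> carrier Q \<Longrightarrow> em (x \<oplus>\<^bsub>Q\<^esub> y) = em x + em y"
    and em_scale: "x \<in> carrier Q \<Longrightarrow> em (z \<odot>\<^bsub>Q\<^esub> x) = s z (em x)"
    and th_em [simp]: "x \<in> carrier Q \<Longrightarrow> th (em x) = x"
begin

lemma em_0 [simp]: "em \<zero>\<^bsub>Q\<^esub> = 0"
  using em_add[of "\<zero>\<^bsub>Q\<^esub>" "\<zero>\<^bsub>Q\<^esub>"] by simp

lemma em_minus: "x \<in> carrier Q \<Longrightarrow> y \<in> carrier Q \<Longrightarrow> em (x \<ominus>\<^bsub>Q\<^esub> y) = em x - em y"
proof -
  assume a: "x \<in> carrier Q" "y \<in> carrier Q"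
  have "em (x \<ominus>\<^bsub>Q\<^esub> y) + em y = em ((x \<ominus>\<^bsub>Q\<^esub> y) \<oplus>\<^bsub>Q\<^esub> y)" using a by (simp add: em_add)
  also have "(x \<ominus>\<^bsub>Q\<^esub> y) \<oplus>\<^bsub>Q\<^esub> y = x" using a by (simp add: a_minus_def Q.a_assoc Q.l_neg)
  finally show ?thesis by (simp add: eq_diff_eq)
qed

lemma em_th_add: "em (th (u + v)) = em (th u) + em (th v)" by (simp add: th_add em_add)
lemma em_th_scale: "em (th (s z u)) = s z (em (th u))" by (simp add: th_scale em_scale)
lemma em_th_sum: "em (th (sum g S)) = (\<Sum>i\<in>S. em (th (g i)))"
  by (induction S rule: infinite_finite_induct) (auto simp: em_th_add)

lemma em_fin_sum:
  assumes "finite S" "\<And>i. h i \<in> carrier Q" "\<And>i. i \<notin> S \<Longrightarrow> h i = \<zero>\<^bsub>Q\<^esub>"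
  shows "em (fin_sum Q h) = (\<Sum>i\<in>S. em (h i))"
proof -
  have "fin_sum Q (\<lambda>i. th (em (h i))) = th (\<Sum>i\<in>S. em (h i))"
    using assms by (intro fin_sum_th) auto
  then show ?thesis using assms(2) by (simp add: em_th_sum)
qed

lemma em_inj: "x \<in> carrier Q \<Longrightarrow> y \<in> carrier Q \<Longrightarrow> em x = em y \<longleftrightarrow> x = y"
  by (metis th_em)

lemma subspace_of_em:
  assumes "F.subspace U" shows "subspace_of {x \<in> carrier Q. em x \<in> U} Q"
proof (rule Q.submoduleI)
  fix x assume x: "x \<in> {x \<in> carrier Q. em x \<in> U}"
  then have "em (\<ominus>\<^bsub>Q\<^esub> x) = - em x"
    using em_minus[of "\<zero>\<^bsub>Q\<^esub>" x] by (simp add: a_minus_def)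
  then show "\<ominus>\<^bsub>Q\<^esub> x \<in> {x \<in> carrier Q. em x \<in> U}" using x assms by (auto intro: F.subspace_neg)
qed (use assms in \<open>auto simp: em_add em_scale intro: F.subspace_0 F.subspace_add F.subspace_scale\<close>)

end

text \<open>The type of finitely supported functions on an arbitrary set is the supply of vector
  spaces for realizations.\<close>

definition pm_scale :: "complex \<Rightarrow> ('a \<Rightarrow>\<^sub>0 complex) \<Rightarrow> 'a \<Rightarrow>\<^sub>0 complex" where
  "pm_scale z = Poly_Mapping.map ((*) z)"

lemma coef_pm_scale [simp]: "coef (pm_scale z f) k = z * coef f k"
  by (simp add: pm_scale_def Poly_Mapping.map.rep_eq when_def)

lemma pm_scale_single: "pm_scale z (Poly_Mapping.single k x) = Poly_Mapping.single k (z * x)"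
  by (rule poly_mapping_eqI) (simp add: lookup_single when_def)

interpretation pm: complex_vector_space pm_scale
  by unfold_locales (rule poly_mapping_eqI, simp add: lookup_add algebra_simps)+

text \<open>The module is the quotient of the space of formal linear combinations of its elements, and
  the kernel of the quotient map has a complement, since every subspace of a vector space does.\<close>

lemma realization_exists:
  fixes M :: "(complex, 'm, 'x) module_scheme"
  assumes "Module.module complex_ring M"
  shows "\<exists>th em. realization (pm_scale :: _ \<Rightarrow> ('m \<Rightarrow>\<^sub>0 complex) \<Rightarrow> _) M th em"
proof -
  interpret M: Module.module complex_ring M by fact
  let ?K = "\<lambda>f. Poly_Mapping.keys f \<inter> carrier M"
  define th where "th f = finsum M (\<lambda>v. coef f v \<odot>\<^bsub>M\<^esub> v) (?K f)" for f :: "'m \<Rightarrow>\<^sub>0 complex"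
  have th_sup: "th f = finsum M (\<lambda>v. coef f v \<odot>\<^bsub>M\<^esub> v) S" if "finite S" "?K f \<subseteq> S" "S \<subseteq> carrier M" for f S
    unfolding th_def using that
    by (intro M.add.finprod_mono_neutral_cong_left) (auto simp: in_keys_iff M.smult_l_null[simplified])
  have th_single: "th (Poly_Mapping.single x 1) = x" if "x \<in> carrier M" for x
    using that th_sup[of "{x}" "Poly_Mapping.single x 1"] by (simp add: M.smult_one[simplified])
  interpret L: linear_into pm_scale M th
  proof
    fix f g :: "'m \<Rightarrow>\<^sub>0 complex" and z
    show "th f \<in> carrier M" unfolding th_def by (rule M.finsum_closed) auto
    let ?S = "?K f \<union> ?K g"
    have "?K (f + g) \<subseteq> ?S" using keys_add[of f g] by auto
    then have "th (f + g) = finsum M (\<lambda>v. coef (f + g) v \<odot>\<^bsub>M\<^esub> v) ?S"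
      by (intro th_sup) auto
    also have "\<dots> = finsum M (\<lambda>v. coef f v \<odot>\<^bsub>M\<^esub> v \<oplus>\<^bsub>M\<^esub> coef g v \<odot>\<^bsub>M\<^esub> v) ?S"
      by (rule M.finsum_cong') (auto simp: lookup_add M.smult_l_distr[simplified])
    also have "\<dots> = th f \<oplus>\<^bsub>M\<^esub> th g"
      by (subst M.finsum_addf) (auto simp: th_sup[of ?S])
    finally show "th (f + g) = th f \<oplus>\<^bsub>M\<^esub> th g" .
    have "?K (pm_scale z f) \<subseteq> ?K f" by (auto simp: in_keys_iff)
    then have "th (pm_scale z f) = finsum M (\<lambda>v. z \<odot>\<^bsub>M\<^esub> (coef f v \<odot>\<^bsub>M\<^esub> v)) (?K f)"
      by (subst th_sup[of "?K f"]) (auto simp: M.smult_assoc1[simplified] intro!: M.finsum_cong')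
    also have "\<dots> = z \<odot>\<^bsub>M\<^esub> th f"
      unfolding th_def by (subst M.finsum_smult_ldistr) auto
    finally show "th (pm_scale z f) = z \<odot>\<^bsub>M\<^esub> th f" .
  qed
  interpret pp: vector_space_pair pm_scale "pm_scale :: _ \<Rightarrow> ('m \<Rightarrow>\<^sub>0 complex) \<Rightarrow> _" ..
  let ?N = "{f. th f = \<zero>\<^bsub>M\<^esub>}"
  have N: "pm.subspace ?N"
    by (auto simp: pm.subspace_def L.th_add L.th_scale)
  \<comment> \<open>\<open>g\<close> projects onto the kernel, so \<open>f - g f\<close> depends only on the class of \<open>f\<close>\<close>
  have "\<exists>g. g ` UNIV \<subseteq> ?N \<and> Vector_Spaces.linear pm_scale pm_scale g \<and> (\<forall>v\<in>?N. g v = v)"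
    using pp.linear_exists_left_inverse_on[OF pm.linear_id N] by (auto simp: id_def)
  then obtain g where g: "\<And>f. th (g f) = \<zero>\<^bsub>M\<^esub>" "Vector_Spaces.linear pm_scale pm_scale g" "\<And>f. th f = \<zero>\<^bsub>M\<^esub> \<Longrightarrow> g f = f"
    by blast
  interpret g: Vector_Spaces.linear pm_scale pm_scale g by (rule g(2))
  have cong: "f - g f = h - g h" if "th f = th h" for f h
  proof -
    have "th (f - h) = \<zero>\<^bsub>M\<^esub>" using that by (simp add: L.th_diff a_minus_def M.r_neg)
    then show ?thesis using g(3)[of "f - h"] by (simp add: g.diff algebra_simps)
  qed
  define em where "em x = Poly_Mapping.single x 1 - g (Poly_Mapping.single x 1)" for x
  have em: "em x = f - g f" if "x \<in> carrier M" "th f = x" for x f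
    unfolding em_def using that th_single by (intro cong) simp
  have "realization pm_scale M th em"
  proof
    fix x y z assume x: "x \<in> carrier M"
    show "th (em x) = x" using x by (simp add: em_def L.th_diff g(1) th_single a_minus_def)
    let ?s = "\<lambda>x. Poly_Mapping.single x (1::complex)"
    show "em (z \<odot>\<^bsub>M\<^esub> x) = pm_scale z (em x)"
      using x by (subst em[of _ "pm_scale z (?s x)"]) (auto simp: L.th_scale th_single em_def g.scale pm.scale_right_diff_distrib)
    assume y: "y \<in> carrier M"
    show "em (x \<oplus>\<^bsub>M\<^esub> y) = em x + em y"
      using x y by (subst em[of _ "?s x + ?s y"]) (auto simp: L.th_add th_single em_def g.add)
  qed
  then show ?thesis by blast
qed

lemma va_moduleD:
  assumes "va_module W M act"
  shows "Module.module complex_ring M"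
    and "a \<in> carrier W \<Longrightarrow> u \<in> carrier M \<Longrightarrow> act a n u \<in> carrier M"
    and "a \<in> carrier W \<Longrightarrow> b \<in> carrier W \<Longrightarrow> u \<in> carrier M \<Longrightarrow> act (a \<oplus>\<^bsub>W\<^esub> b) n u = act a n u \<oplus>\<^bsub>M\<^esub> act b n u"
    and "a \<in> carrier W \<Longrightarrow> u \<in> carrier M \<Longrightarrow> act (z \<odot>\<^bsub>W\<^esub> a) n u = z \<odot>\<^bsub>M\<^esub> act a n u"
    and "a \<in> carrier W \<Longrightarrow> u \<in> carrier M \<Longrightarrow> v \<in> carrier M \<Longrightarrow> act a n (u \<oplus>\<^bsub>M\<^esub> v) = act a n u \<oplus>\<^bsub>M\<^esub> act a n v"
    and "a \<in> carrier W \<Longrightarrow> u \<in> carrier M \<Longrightarrow> act a n (z \<odot>\<^bsub>M\<^esub> u) = z \<odot>\<^bsub>M\<^esub> act a n u"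
    and "a \<in> carrier W \<Longrightarrow> u \<in> carrier M \<Longrightarrow> \<exists>N. \<forall>n\<ge>N. act a n u = \<zero>\<^bsub>M\<^esub>"
    and "u \<in> carrier M \<Longrightarrow> act (vac W) n u = (if n = -1 then u else \<zero>\<^bsub>M\<^esub>)"
    and "borcherds_identity W M act"
  using assms by (simp_all add: va_module_def)

text \<open>Carrying the operations over to a realization of the module. The finite sums over all \<open>j\<close>
  become partial sums, which are constant from the point on where $a(n)b$, $a(n)u$ and $b(n)u$
  vanish.\<close>

lemma linear_into_realization_of_vertex_action:
  assumes M: "va_module W M act" and R: "realization sM M prj em"
    and th: "linear_into sV W th"
    and Y: "\<And>a n b. nprod W (th a) n (th b) = th (Y a n b)"
    and trunc: "\<And>a b. a \<in> carrier W \<Longrightarrow> b \<in> carrier W \<Longrightarrow> \<exists>N. \<forall>n\<ge>N. nprod W a n b = \<zero>\<^bsub>W\<^esub>"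
  shows "va_action sV sM Y (\<lambda>a n u. em (act (th a) n (prj u)))"
proof -
  interpret R: realization sM M prj em by fact
  interpret L: linear_into sV W th by fact
  note cl = va_moduleD(2)[OF M] and add1 = va_moduleD(3)[OF M] and sc1 = va_moduleD(4)[OF M]
    and add2 = va_moduleD(5)[OF M] and sc2 = va_moduleD(6)[OF M] and tr = va_moduleD(7)[OF M] and B = va_moduleD(9)[OF M]
  have act0: "act \<zero>\<^bsub>W\<^esub> n u = \<zero>\<^bsub>M\<^esub>" if "u \<in> carrier M" for n u
    using sc1[of "\<zero>\<^bsub>W\<^esub>" u 0 n] that cl[of "\<zero>\<^bsub>W\<^esub>" u n] L.Q.smult_l_null[of "\<zero>\<^bsub>W\<^esub>"] R.Q.smult_l_null[of "act \<zero>\<^bsub>W\<^esub> n u"]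
    by simp
  have act0': "act a n \<zero>\<^bsub>M\<^esub> = \<zero>\<^bsub>M\<^esub>" if "a \<in> carrier W" for n a
    using sc2[of a "\<zero>\<^bsub>M\<^esub>" n 0] that cl[of a "\<zero>\<^bsub>M\<^esub>" n] R.Q.smult_l_null[of "\<zero>\<^bsub>M\<^esub>"] R.Q.smult_l_null[of "act a n \<zero>\<^bsub>M\<^esub>"]
    by simp
  have mz: "\<ominus>\<^bsub>M\<^esub> \<zero>\<^bsub>M\<^esub> = \<zero>\<^bsub>M\<^esub>" by (rule R.Q.minus_equality) simp_all
  let ?act = "\<lambda>a n u. em (act (th a) n (prj u))"
  have pact: "prj (?act a n u) = act (th a) n (prj u)" for a n u by (simp add: cl)
  show ?thesis
  proof
    fix a b u v n z
    show "?act (a + b) n u = ?act a n u + ?act b n u" by (simp add: L.th_add add1 R.em_add cl)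
    show "?act (sV z a) n u = sM z (?act a n u)" by (simp add: L.th_scale sc1 R.em_scale cl)
    show "?act a n (u + v) = ?act a n u + ?act a n v" by (simp add: R.th_add add2 R.em_add cl)
    show "?act a n (sM z u) = sM z (?act a n u)" by (simp add: R.th_scale sc2 R.em_scale cl)
  next
    fix a b u and m n k :: int
    let ?l = "\<lambda>j::nat. (of_int m gchoose j) \<odot>\<^bsub>M\<^esub> act (nprod W (th a) (n + int j) (th b)) (m + k - int j) (prj u)"
    let ?r = "\<lambda>j::nat. ((-1) ^ j * (of_int n gchoose j)) \<odot>\<^bsub>M\<^esub>
          (act (th a) (m + n - int j) (act (th b) (k + int j) (prj u))
           \<ominus>\<^bsub>M\<^esub> ((-1) powi n) \<odot>\<^bsub>M\<^esub> act (th b) (n + k - int j) (act (th a) (m + int j) (prj u)))"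
    have eq: "fin_sum M ?l = fin_sum M ?r" using B unfolding borcherds_identity_def by simp
    obtain N1 where N1: "\<And>n. n \<ge> N1 \<Longrightarrow> nprod W (th a) n (th b) = \<zero>\<^bsub>W\<^esub>" using trunc by (meson L.th_closed)
    obtain N2 where N2: "\<And>n. n \<ge> N2 \<Longrightarrow> act (th b) n (prj u) = \<zero>\<^bsub>M\<^esub>" using tr by (meson L.th_closed R.th_closed)
    obtain N3 where N3: "\<And>n. n \<ge> N3 \<Longrightarrow> act (th a) n (prj u) = \<zero>\<^bsub>M\<^esub>" using tr by (meson L.th_closed R.th_closed)
    have lc: "?l j \<in> carrier M" for j by (simp add: Y cl)
    have rc: "?r j \<in> carrier M" for j by (simp add: cl)
    show "\<forall>\<^sub>F N in sequentially.
       (\<Sum>j<N. sM (of_int m gchoose j) (?act (Y a (n + int j) b) (m + k - int j) u)) =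
       (\<Sum>j<N. sM ((-1) ^ j * (of_int n gchoose j)) (?act a (m + n - int j) (?act b (k + int j) u)
           - sM ((-1) powi n) (?act b (n + k - int j) (?act a (m + int j) u))))"
      using eventually_ge_at_top[of "nat (max (N1 - n) (max (N2 - k) (N3 - m)))"]
    proof eventually_elim
      case (elim N)
      have big: "n + int j \<ge> N1" "k + int j \<ge> N2" "m + int j \<ge> N3" if "j \<notin> {..<N}" for j
        using that elim by auto
      have "em (fin_sum M ?l) = (\<Sum>j<N. em (?l j))"
        using big by (intro R.em_fin_sum lc) (auto simp: N1 act0)
      moreover have "em (fin_sum M ?r) = (\<Sum>j<N. em (?r j))"
        using big by (intro R.em_fin_sum rc) (auto simp: N2 N3 act0' a_minus_def mz)
      ultimately have "(\<Sum>j<N. em (?l j)) = (\<Sum>j<N. em (?r j))" using eq by simp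
      then show ?case
        by (simp add: R.em_scale R.em_minus cl Y pact)
    qed
  qed
qed

section \<open>Quotients\<close>

locale quotient_module = Module.module complex_ring M for M :: "(complex, 'm, 'x) module_scheme" (structure) +
  fixes N :: "'m set"
  assumes N: "subspace_of N M"
begin

lemma N_abelian_subgroup: "abelian_subgroup N M"
  by (intro abelian_subgroupI3 additive_subgroupI submodule.axioms(1)[OF N] abelian_group_axioms)

sublocale N: abelian_subgroup N M by (rule N_abelian_subgroup)

lemma coset_mem: "x \<in> carrier M \<Longrightarrow> x' \<in> N +> x \<Longrightarrow> x' \<in> carrier M \<and> N +> x' = N +> x"
  using N.a_elemrcos_carrier N.a_repr_independence' by metis

lemma coset_self: "x \<in> carrier M \<Longrightarrow> x \<in> N +> x"
  by (rule N.a_rcos_self)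

lemma coset_eq_iff:
  assumes "x \<in> carrier M" "y \<in> carrier M" shows "N +> x = N +> y \<longleftrightarrow> x \<ominus> y \<in> N"
proof
  assume "N +> x = N +> y"
  then show "x \<ominus> y \<in> N"
    using coset_self[OF assms(1)] N.a_rcos_module_imp[OF assms(2)] by (simp add: a_minus_def)
next
  assume "x \<ominus> y \<in> N"
  then have "x \<in> N +> y" using N.a_rcos_module_rev[OF assms(2,1)] by (simp add: a_minus_def)
  then show "N +> x = N +> y" using coset_mem[OF assms(2)] by simp
qed

text \<open>The operations on quotients are unions over representatives; they have the value at any
  representative if the value does not depend on it.\<close>

lemma UN_coset:
  assumes "x \<in> carrier M" "\<And>x'. x' \<in> carrier M \<Longrightarrow> N +> x' = N +> x \<Longrightarrow> f x' = A"
  shows "(\<Union>x'\<in>N +> x. f x') = A"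
proof -
  have "f x' = A" if "x' \<in> N +> x" for x' using coset_mem[OF assms(1) that] assms(2) by blast
  then show ?thesis using coset_self[OF assms(1)] by auto
qed

lemma carrier_quot: "carrier (quot_space M N) = (\<lambda>x. N +> x) ` carrier M"
  by (auto simp: quot_space_def A_RCOSETS_def')

lemma quot_simps [simp]: "\<zero>\<^bsub>quot_space M N\<^esub> = N" "X \<oplus>\<^bsub>quot_space M N\<^esub> X' = X <+> X'"
  by (simp_all add: quot_space_def)

lemma coset_zero: "N +> \<zero> = N"
  using N.a_subset by simp

lemma quot_add: "x \<in> carrier M \<Longrightarrow> y \<in> carrier M \<Longrightarrow> (N +> x) <+> (N +> y) = N +> (x \<oplus> y)"
  by (rule N.a_rcos_sum)

lemma smult_minus_mem:
  assumes "x \<in> carrier M" "y \<in> carrier M" "N +> x = N +> y"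
  shows "N +> (z \<odot> x) = N +> (z \<odot> y)"
proof -
  have "z \<odot> (x \<ominus> y) \<in> N" using assms coset_eq_iff submoduleE(4)[OF N, of z] by auto
  moreover have "z \<odot> (x \<ominus> y) = z \<odot> x \<ominus> z \<odot> y"
    using assms by (simp add: a_minus_def smult_r_distr smult_r_minus)
  ultimately show ?thesis using assms by (subst coset_eq_iff) auto
qed

lemma quot_smult: "x \<in> carrier M \<Longrightarrow> z \<odot>\<^bsub>quot_space M N\<^esub> (N +> x) = N +> (z \<odot> x)"
  unfolding quot_space_def by simp (rule UN_coset, assumption, rule smult_minus_mem)

lemma module_quot: "Module.module complex_ring (quot_space M N)"
proof (rule moduleI[OF cring_complex_ring])
  show "abelian_group (quot_space M N)"
  proof (rule abelian_groupI)
    fix X assume "X \<in> carrier (quot_space M N)"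
    then obtain x where x: "x \<in> carrier M" "X = N +> x" by (auto simp: carrier_quot)
    show "\<exists>X'\<in>carrier (quot_space M N). X' \<oplus>\<^bsub>quot_space M N\<^esub> X = \<zero>\<^bsub>quot_space M N\<^esub>"
      using x by (intro bexI[of _ "N +> (\<ominus> x)"]) (auto simp: carrier_quot quot_add l_neg coset_zero)
    show "\<zero>\<^bsub>quot_space M N\<^esub> \<oplus>\<^bsub>quot_space M N\<^esub> X = X"
      using x quot_add[of \<zero> x] by (simp add: coset_zero)
  next
    show "\<zero>\<^bsub>quot_space M N\<^esub> \<in> carrier (quot_space M N)"
      unfolding carrier_quot using coset_zero by (intro image_eqI[of _ _ \<zero>]) auto
  qed (auto simp: carrier_quot quot_add a_ac)
qed (auto simp: carrier_quot quot_add quot_smult smult_l_distr[simplified] smult_r_distr[simplified] smult_assoc1[simplified] smult_one[simplified])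

lemma quot_map_coset:
  assumes "x \<in> carrier M" "\<And>y. y \<in> carrier M \<Longrightarrow> g y \<in> carrier M"
    "\<And>x y. x \<in> carrier M \<Longrightarrow> y \<in> carrier M \<Longrightarrow> x \<ominus> y \<in> N \<Longrightarrow> g x \<ominus> g y \<in> N"
  shows "quot_map M N g (N +> x) = N +> g x"
  unfolding quot_map_def using assms by (intro UN_coset) (auto simp: coset_eq_iff)

end

lemma quot_va_simps [simp]:
  "carrier (quot_va W I) = carrier (quot_space W I)" "\<zero>\<^bsub>quot_va W I\<^esub> = \<zero>\<^bsub>quot_space W I\<^esub>"
  "X \<oplus>\<^bsub>quot_va W I\<^esub> X' = X \<oplus>\<^bsub>quot_space W I\<^esub> X'" "z \<odot>\<^bsub>quot_va W I\<^esub> X = z \<odot>\<^bsub>quot_space W I\<^esub> X"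
  "vac (quot_va W I) = I +>\<^bsub>W\<^esub> vac W"
  "nprod (quot_va W I) X n X' = (\<Union>x\<in>X. \<Union>y\<in>X'. I +>\<^bsub>W\<^esub> nprod W x n y)"
  "wt (quot_va W I) n = (\<lambda>x. I +>\<^bsub>W\<^esub> x) ` wt W n"
  by (simp_all add: quot_va_def module.extend_def vertex_alg.fields_def)

lemma module_record_cong:
  assumes "Module.module complex_ring M" "carrier M' = carrier M" "\<zero>\<^bsub>M'\<^esub> = \<zero>\<^bsub>M\<^esub>"
    "\<And>x y. x \<oplus>\<^bsub>M'\<^esub> y = x \<oplus>\<^bsub>M\<^esub> y" "\<And>z x. z \<odot>\<^bsub>M'\<^esub> x = z \<odot>\<^bsub>M\<^esub> x"
  shows "Module.module complex_ring M'"
proof -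
  interpret Module.module complex_ring M by fact
  show ?thesis
  proof (rule moduleI[OF cring_complex_ring])
    show "abelian_group M'"
    proof (rule abelian_groupI)
      fix x assume "x \<in> carrier M'"
      then show "\<exists>y\<in>carrier M'. y \<oplus>\<^bsub>M'\<^esub> x = \<zero>\<^bsub>M'\<^esub>"
        using assms(2-5) l_neg by (intro bexI[of _ "\<ominus>\<^bsub>M\<^esub> x"]) auto
    qed (use assms(2-5) a_assoc a_comm in auto)
  qed (use assms(2-5) in \<open>auto simp: smult_l_distr[simplified] smult_r_distr[simplified] smult_assoc1[simplified] smult_one[simplified]\<close>)
qed

section \<open>The generalized Verma module\<close>

lemma dscale_0 [simp]: "dscale z 0 = 0" "dscale 0 A = 0"
  by simp_all

lemma D_plus_hat_scale_add:
  "x \<in> D_plus_hat \<Longrightarrow> y \<in> D_plus_hat \<Longrightarrow> dhat_scale a x + dhat_scale b y \<in> D_plus_hat"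
  using dop.subspace_add[OF D_plus_subspace] dop.subspace_scale[OF D_plus_subspace]
  by (auto simp: D_plus_hat_def dhat_scale_def)

lemma D_plus_hat_bracket: "x \<in> D_plus_hat \<Longrightarrow> y \<in> D_plus_hat \<Longrightarrow> dhat_bracket x y \<in> D_plus_hat"
  by (auto simp: D_plus_hat_def dhat_bracket_def D_plus_commutator)

lemma kappa_mem: "kappa \<in> D_plus_hat"
  by (simp add: D_plus_hat_def kappa_def dop.subspace_0[OF D_plus_subspace])

lemma P_plus_hat_mem: "p \<in> P_plus \<Longrightarrow> (p, 0) \<in> D_plus_hat"
  using P_plus_subset_D_plus by (auto simp: D_plus_hat_def)

lemma free_scale_eq: "free_scale = pm_scale"
  by (simp add: fun_eq_iff free_scale_def pm_scale_def)

definition free_words :: "free_alg set" where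
  "free_words = {f. Poly_Mapping.keys f \<subseteq> lists D_plus_hat}"

lemma free_space_eq: "free_space = vec_space free_words pm_scale"
  by (simp add: free_space_def free_words_def free_scale_eq)

lemma free_words_subspace: "pm.subspace free_words"
proof (rule pm.subspaceI)
  fix f g assume "f \<in> free_words" "g \<in> free_words"
  then show "f + g \<in> free_words" using keys_add[of f g] by (auto simp: free_words_def)
next
  fix z f assume "f \<in> free_words"
  moreover have "Poly_Mapping.keys (pm_scale z f) \<subseteq> Poly_Mapping.keys f" by (auto simp: in_keys_iff)
  ultimately show "pm_scale z f \<in> free_words" by (auto simp: free_words_def)
qed (simp add: free_words_def)

lemma word_mem: "w \<in> lists D_plus_hat \<Longrightarrow> word w \<in> free_words"
  by (simp add: word_def free_words_def)

lemma free_words_span: "free_words = pm.span (word ` lists D_plus_hat)"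
proof
  show "free_words \<subseteq> pm.span (word ` lists D_plus_hat)"
  proof
    fix f assume f: "f \<in> free_words"
    have "f = (\<Sum>w\<in>Poly_Mapping.keys f. Poly_Mapping.single w (coef f w))"
      by (rule poly_mapping_eqI) (simp add: lookup_sum lookup_single when_def in_keys_iff sum.delta)
    also have "\<dots> = (\<Sum>w\<in>Poly_Mapping.keys f. pm_scale (coef f w) (word w))"
      by (simp add: word_def pm_scale_single)
    also have "\<dots> \<in> pm.span (word ` lists D_plus_hat)"
      using f by (intro pm.span_sum pm.span_scale pm.span_base) (auto simp: free_words_def)
    finally show "f \<in> pm.span (word ` lists D_plus_hat)" .
  qed
  show "pm.span (word ` lists D_plus_hat) \<subseteq> free_words"
    using word_mem by (intro pm.span_minimal free_words_subspace) auto
qed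

text \<open>The relations are the plain span of these elements, since these are closed under
  multiplication from the left.\<close>

definition M_gens :: "complex \<Rightarrow> free_alg set" where
  "M_gens c = enveloping_relations \<union> induction_relations c"

lemma M_gens_subset: "M_gens c \<subseteq> free_words"
proof
  fix g assume "g \<in> M_gens c"
  moreover have d: "f \<in> free_words \<Longrightarrow> h \<in> free_words \<Longrightarrow> f - h \<in> free_words" for f h
    by (rule pm.subspace_diff[OF free_words_subspace])
  moreover have s: "f \<in> free_words \<Longrightarrow> pm_scale z f \<in> free_words" for f z
    by (rule pm.subspace_scale[OF free_words_subspace])
  ultimately show "g \<in> free_words"
    unfolding M_gens_def enveloping_relations_def induction_relations_def free_scale_eq
    using D_plus_hat_scale_add D_plus_hat_bracket kappa_mem P_plus_hat_mem
    by (elim UnE CollectE exE conjE; simp only:; intro d s word_mem; auto)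
qed

lemma M_relations_span: "M_relations c = pm.span (M_gens c)"
  unfolding M_relations_def free_space_eq M_gens_def[symmetric]
  by (rule pm.lspan_vec_space[OF free_words_subspace M_gens_subset])

lemma M_relations_subset: "M_relations c \<subseteq> free_words"
  unfolding M_relations_span by (rule pm.span_minimal[OF M_gens_subset free_words_subspace])

lemma quotient_module_M: "quotient_module free_space (M_relations c)"
proof (rule quotient_module.intro)
  show "Module.module complex_ring free_space"
    unfolding free_space_eq by (rule pm.module_vec_space[OF free_words_subspace])
  have "subspace_of (M_relations c) free_space"
    unfolding free_space_eq pm.subspace_of_vec_space[OF free_words_subspace]
    using M_relations_subset by (simp add: M_relations_span pm.subspace_span)
  then show "quotient_module_axioms free_space (M_relations c)"
    by (rule quotient_module_axioms.intro)
qed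

interpretation MQ: quotient_module free_space "M_relations c" for c
  by (rule quotient_module_M)

abbreviation cls :: "complex \<Rightarrow> free_alg \<Rightarrow> M_elem" where
  "cls c f \<equiv> M_relations c +>\<^bsub>free_space\<^esub> f"

lemma free_space_simps [simp]:
  "carrier free_space = free_words" "x \<oplus>\<^bsub>free_space\<^esub> y = x + y" "z \<odot>\<^bsub>free_space\<^esub> x = pm_scale z x"
  "\<zero>\<^bsub>free_space\<^esub> = 0"
  by (simp_all add: free_space_eq)

lemma free_space_minus: "x \<in> free_words \<Longrightarrow> y \<in> free_words \<Longrightarrow> x \<ominus>\<^bsub>free_space\<^esub> y = x - y"
  using pm.a_inv_vec_space[OF free_words_subspace, of y] by (simp add: free_space_eq a_minus_def)

lemma cls_eq_iff: "f \<in> free_words \<Longrightarrow> g \<in> free_words \<Longrightarrow> cls c f = cls c g \<longleftrightarrow> f - g \<in> M_relations c"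
  using MQ.coset_eq_iff[of f g c] by (simp add: free_space_minus)

lemma carrier_M: "carrier (M_space c) = cls c ` free_words"
  using MQ.carrier_quot by (simp add: M_space_def)

lemma M_space_add: "f \<in> free_words \<Longrightarrow> g \<in> free_words \<Longrightarrow> cls c f \<oplus>\<^bsub>M_space c\<^esub> cls c g = cls c (f + g)"
  using MQ.quot_add[of f g c] by (simp add: M_space_def)

lemma M_space_smult: "f \<in> free_words \<Longrightarrow> z \<odot>\<^bsub>M_space c\<^esub> cls c f = cls c (pm_scale z f)"
  using MQ.quot_smult[of f c z] by (simp add: M_space_def)

lemma M_space_zero: "\<zero>\<^bsub>M_space c\<^esub> = cls c 0"
  using MQ.coset_zero[of c] by (simp add: M_space_def)

lemma M_word_carrier: "w \<in> lists D_plus_hat \<Longrightarrow> M_word c w \<in> carrier (M_space c)"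
  by (simp add: M_word_def carrier_M word_mem)

lemma flm_word [simp]: "free_left_mult x (word w) = word (x # w)"
  by (simp add: free_left_mult_def word_def)

lemma flm_superset:
  "finite S \<Longrightarrow> Poly_Mapping.keys f \<subseteq> S \<Longrightarrow> free_left_mult x f = (\<Sum>w\<in>S. Poly_Mapping.single (x # w) (coef f w))"
  unfolding free_left_mult_def by (rule keys_sum_superset) auto

lemma flm_add: "free_left_mult x (f + g) = free_left_mult x f + free_left_mult x g"
proof -
  let ?S = "Poly_Mapping.keys f \<union> Poly_Mapping.keys g"
  have "Poly_Mapping.keys (f + g) \<subseteq> ?S" by (rule keys_add)
  then show ?thesis by (simp add: flm_superset[of ?S] lookup_add single_add sum.distrib)
qed

lemma flm_scale: "free_left_mult x (pm_scale z f) = pm_scale z (free_left_mult x f)"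
proof -
  have "Poly_Mapping.keys (pm_scale z f) \<subseteq> Poly_Mapping.keys f" by (auto simp: in_keys_iff)
  then show ?thesis by (simp add: flm_superset[of "Poly_Mapping.keys f"] pm.scale_sum_right pm_scale_single)
qed

lemma flm_0 [simp]: "free_left_mult x 0 = 0" by (simp add: free_left_mult_def)
lemma flm_diff: "free_left_mult x (f - g) = free_left_mult x f - free_left_mult x g"
  using flm_add[of x "f - g" g] by (simp add: eq_diff_eq)

lemma flm_mem: "x \<in> D_plus_hat \<Longrightarrow> f \<in> free_words \<Longrightarrow> free_left_mult x f \<in> free_words"
  unfolding free_left_mult_def
  by (intro pm.subspace_sum[OF free_words_subspace]) (auto simp: free_words_def)

lemma linear_relation_mem:
  assumes "x \<in> D_plus_hat" "y \<in> D_plus_hat" "u \<in> lists D_plus_hat" "v \<in> lists D_plus_hat"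
  shows "word (u @ [dhat_scale a x + dhat_scale b y] @ v) - free_scale a (word (u @ [x] @ v))
    - free_scale b (word (u @ [y] @ v)) \<in> M_gens c"
  using assms unfolding M_gens_def enveloping_relations_def by blast

lemma bracket_relation_mem:
  assumes "x \<in> D_plus_hat" "y \<in> D_plus_hat" "u \<in> lists D_plus_hat" "v \<in> lists D_plus_hat"
  shows "word (u @ [x, y] @ v) - word (u @ [y, x] @ v) - word (u @ [dhat_bracket x y] @ v) \<in> M_gens c"
  using assms unfolding M_gens_def enveloping_relations_def by blast

lemma P_plus_relation_mem: "p \<in> P_plus \<Longrightarrow> u \<in> lists D_plus_hat \<Longrightarrow> word (u @ [(p, 0)]) \<in> M_gens c"
  unfolding M_gens_def induction_relations_def by blast

lemma kappa_relation_mem: "u \<in> lists D_plus_hat \<Longrightarrow> word (u @ [kappa]) - free_scale c (word u) \<in> M_gens c"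
  unfolding M_gens_def induction_relations_def by blast

lemma flm_gens:
  assumes x: "x \<in> D_plus_hat" and g: "g \<in> M_gens c" shows "free_left_mult x g \<in> M_gens c"
proof -
  consider a b y z u v where "g = word (u @ [dhat_scale a y + dhat_scale b z] @ v) - free_scale a (word (u @ [y] @ v)) - free_scale b (word (u @ [z] @ v))"
      "y \<in> D_plus_hat" "z \<in> D_plus_hat" "u \<in> lists D_plus_hat" "v \<in> lists D_plus_hat"
    | y z u v where "g = word (u @ [y, z] @ v) - word (u @ [z, y] @ v) - word (u @ [dhat_bracket y z] @ v)"
      "y \<in> D_plus_hat" "z \<in> D_plus_hat" "u \<in> lists D_plus_hat" "v \<in> lists D_plus_hat"
    | p u where "g = word (u @ [(p, 0)])" "p \<in> P_plus" "u \<in> lists D_plus_hat"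
    | u where "g = word (u @ [kappa]) - free_scale c (word u)" "u \<in> lists D_plus_hat"
    using g unfolding M_gens_def enveloping_relations_def induction_relations_def
    by (elim UnE CollectE exE conjE) blast+
  then show ?thesis
  proof cases
    case (1 a b y z u v)
    show ?thesis using linear_relation_mem[of y z "x # u" v a b c] 1 x
      by (simp add: flm_diff free_scale_eq flm_scale)
  next
    case (2 y z u v)
    show ?thesis using bracket_relation_mem[of y z "x # u" v c] 2 x by (simp add: flm_diff)
  next
    case (3 p u)
    show ?thesis using P_plus_relation_mem[of p "x # u" c] 3 x by simp
  next
    case (4 u)
    show ?thesis using kappa_relation_mem[of "x # u" c] 4 x by (simp add: flm_diff free_scale_eq flm_scale)
  qed
qed

lemma M_rel_simps:
  "0 \<in> M_relations c" "f \<in> M_relations c \<Longrightarrow> g \<in> M_relations c \<Longrightarrow> f + g \<in> M_relations c"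
  "f \<in> M_relations c \<Longrightarrow> g \<in> M_relations c \<Longrightarrow> f - g \<in> M_relations c"
  "f \<in> M_relations c \<Longrightarrow> pm_scale z f \<in> M_relations c"
  by (simp_all add: M_relations_span pm.span_zero pm.span_add pm.span_diff pm.span_scale)

lemma flm_relations: assumes "x \<in> D_plus_hat" "f \<in> M_relations c" shows "free_left_mult x f \<in> M_relations c"
  using assms(2) unfolding M_relations_span
proof (induction rule: pm.span_induct_alt)
  case (step z g h)
  then show ?case
    using flm_gens[OF assms(1) step(1)]
    by (simp add: flm_add flm_scale pm.span_add pm.span_scale pm.span_base)
qed (simp add: pm.span_zero)

lemma M_action_cls:
  assumes "x \<in> D_plus_hat" "f \<in> free_words" shows "M_action c x (cls c f) = cls c (free_left_mult x f)"
  unfolding M_action_def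
  using assms flm_mem[OF assms(1)] flm_relations[OF assms(1)]
  by (intro MQ.quot_map_coset) (auto simp: free_space_minus flm_mem simp flip: flm_diff)

lemma free_words_linear:
  assumes "f \<in> free_words" "\<And>f g. T (f + g) = T f + T g" "\<And>z f. T (pm_scale z f) = pm_scale z (T f)"
    "\<And>w. w \<in> lists D_plus_hat \<Longrightarrow> T (word w) \<in> M_relations c"
  shows "T f \<in> M_relations c"
  using assms(1) unfolding free_words_span
proof (induction rule: pm.span_induct_alt)
  case base
  then show ?case using assms(3)[of 0 0] by (simp add: M_rel_simps)
next
  case (step z g h)
  then show ?case using assms(4) by (auto simp: assms(2,3) intro!: M_rel_simps)
qed

lemma M_action_closed:
  "x \<in> D_plus_hat \<Longrightarrow> v \<in> carrier (M_space c) \<Longrightarrow> M_action c x v \<in> carrier (M_space c)"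
  by (auto simp: carrier_M M_action_cls flm_mem)

lemma M_action_add:
  "x \<in> D_plus_hat \<Longrightarrow> v \<in> carrier (M_space c) \<Longrightarrow> v' \<in> carrier (M_space c) \<Longrightarrow>
    M_action c x (v \<oplus>\<^bsub>M_space c\<^esub> v') = M_action c x v \<oplus>\<^bsub>M_space c\<^esub> M_action c x v'"
  by (auto simp: carrier_M M_action_cls flm_mem M_space_add flm_add pm.subspace_add[OF free_words_subspace])

lemma M_action_smult:
  "x \<in> D_plus_hat \<Longrightarrow> v \<in> carrier (M_space c) \<Longrightarrow>
    M_action c x (z \<odot>\<^bsub>M_space c\<^esub> v) = z \<odot>\<^bsub>M_space c\<^esub> M_action c x v"
  by (auto simp: carrier_M M_action_cls flm_mem M_space_smult flm_scale pm.subspace_scale[OF free_words_subspace])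

lemma M_action_word: "x \<in> D_plus_hat \<Longrightarrow> w \<in> lists D_plus_hat \<Longrightarrow> M_action c x (M_word c w) = M_word c (x # w)"
  by (simp add: M_word_def M_action_cls word_mem)

lemma M_gens_relations: "g \<in> M_gens c \<Longrightarrow> g \<in> M_relations c"
  unfolding M_relations_span by (rule pm.span_base)

lemma linear_relation:
  assumes "x \<in> D_plus_hat" "y \<in> D_plus_hat" "w \<in> lists D_plus_hat"
  shows "word ((dhat_scale a x + dhat_scale b y) # w) - pm_scale a (word (x # w)) - pm_scale b (word (y # w)) \<in> M_relations c"
  using M_gens_relations[OF linear_relation_mem[of x y "[]" w a b c]] assms by (simp add: free_scale_eq)

lemma bracket_relation:
  assumes "x \<in> D_plus_hat" "y \<in> D_plus_hat" "w \<in> lists D_plus_hat"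
  shows "word (x # y # w) - word (y # x # w) - word (dhat_bracket x y # w) \<in> M_relations c"
  using M_gens_relations[OF bracket_relation_mem[of x y "[]" w c]] assms by simp

lemma M_action_linear:
  assumes x: "x \<in> D_plus_hat" and y: "y \<in> D_plus_hat" and v: "v \<in> carrier (M_space c)"
  shows "M_action c (dhat_scale a x + dhat_scale b y) v =
    a \<odot>\<^bsub>M_space c\<^esub> M_action c x v \<oplus>\<^bsub>M_space c\<^esub> b \<odot>\<^bsub>M_space c\<^esub> M_action c y v"
proof -
  obtain f where f: "v = cls c f" "f \<in> free_words" using v by (auto simp: carrier_M)
  let ?xy = "dhat_scale a x + dhat_scale b y"
  have "free_left_mult ?xy f - pm_scale a (free_left_mult x f) - pm_scale b (free_left_mult y f) \<in> M_relations c"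
    by (rule free_words_linear[OF f(2)])
      (use linear_relation[OF x y] in \<open>auto simp: flm_add flm_scale pm.scale_right_distrib pm.scale_right_diff_distrib mult.commute\<close>)
  then have "cls c (free_left_mult ?xy f) = cls c (pm_scale a (free_left_mult x f) + pm_scale b (free_left_mult y f))"
    using f(2) x y D_plus_hat_scale_add[OF x y]
    by (subst cls_eq_iff) (auto intro!: flm_mem pm.subspace_add[OF free_words_subspace] pm.subspace_scale[OF free_words_subspace] simp: diff_diff_eq)
  then show ?thesis
    using f x y D_plus_hat_scale_add[OF x y]
    by (simp add: M_action_cls M_space_smult flm_mem M_space_add pm.subspace_scale[OF free_words_subspace])
qed

lemma M_action_bracket:
  assumes x: "x \<in> D_plus_hat" and y: "y \<in> D_plus_hat" and v: "v \<in> carrier (M_space c)"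
  shows "M_action c x (M_action c y v) = M_action c y (M_action c x v) \<oplus>\<^bsub>M_space c\<^esub> M_action c (dhat_bracket x y) v"
proof -
  obtain f where f: "v = cls c f" "f \<in> free_words" using v by (auto simp: carrier_M)
  let ?b = "dhat_bracket x y"
  have "free_left_mult x (free_left_mult y f) - free_left_mult y (free_left_mult x f) - free_left_mult ?b f \<in> M_relations c"
    by (rule free_words_linear[OF f(2)])
      (use bracket_relation[OF x y] in \<open>auto simp: flm_add flm_scale pm.scale_right_diff_distrib\<close>)
  then have "cls c (free_left_mult x (free_left_mult y f)) = cls c (free_left_mult y (free_left_mult x f) + free_left_mult ?b f)"
    using f(2) x y D_plus_hat_bracket[OF x y]
    by (subst cls_eq_iff) (auto intro!: flm_mem pm.subspace_add[OF free_words_subspace] simp: diff_diff_eq)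
  then show ?thesis
    using f x y D_plus_hat_bracket[OF x y] by (simp add: M_action_cls flm_mem M_space_add)
qed

text \<open>By the relations of induction $\kappa$ acts on the vacuum by \<open>c\<close>, and as it is central it
  does so on every word.\<close>

lemma M_action_kappa:
  assumes v: "v \<in> carrier (M_space c)" shows "M_action c kappa v = c \<odot>\<^bsub>M_space c\<^esub> v"
proof -
  obtain f where f: "v = cls c f" "f \<in> free_words" using v by (auto simp: carrier_M)
  have w: "word (kappa # w) - pm_scale c (word w) \<in> M_relations c" if "w \<in> lists D_plus_hat" for w
    using that
  proof (induction w)
    case Nil
    show ?case using M_gens_relations[OF kappa_relation_mem[of "[]" c]] by (simp add: free_scale_eq)
  next
    case (Cons x w)
    then have x: "x \<in> D_plus_hat" and w: "w \<in> lists D_plus_hat" and IH: "word (kappa # w) - pm_scale c (word w) \<in> M_relations c"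
      by auto
    have b: "dhat_bracket kappa x = dhat_scale 0 x + dhat_scale 0 x"
      by (simp add: dhat_bracket_def kappa_def dcomp_def dcocycle_def dhat_scale_def zero_prod_def)
    have "word (dhat_bracket kappa x # w) \<in> M_relations c"
      using linear_relation[OF x x w, of 0 0 c] unfolding b by simp
    from M_rel_simps(2)[OF bracket_relation[OF kappa_mem x w] this]
    have "word (kappa # x # w) - word (x # kappa # w) \<in> M_relations c" by simp
    from M_rel_simps(2)[OF this flm_relations[OF x IH]]
    show ?case by (simp add: flm_diff flm_scale)
  qed
  have "free_left_mult kappa f - pm_scale c f \<in> M_relations c"
    by (rule free_words_linear[OF f(2)])
      (use w in \<open>auto simp: flm_add flm_scale pm.scale_right_distrib pm.scale_right_diff_distrib mult.commute\<close>)
  then have "cls c (free_left_mult kappa f) = cls c (pm_scale c f)"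
    using f(2) kappa_mem by (subst cls_eq_iff) (auto intro: flm_mem pm.subspace_scale[OF free_words_subspace])
  then show ?thesis using f by (simp add: M_action_cls kappa_mem M_space_smult)
qed

lemma M_action_P_plus: "p \<in> P_plus \<Longrightarrow> M_action c (p, 0) (M_word c []) = \<zero>\<^bsub>M_space c\<^esub>"
proof -
  assume p: "p \<in> P_plus"
  have "word [(p, 0)] \<in> M_relations c"
    using M_gens_relations[OF P_plus_relation_mem[OF p, of "[]" c]] by simp
  then have "cls c (word [(p, 0)]) = cls c 0"
    using p by (subst cls_eq_iff) (auto intro!: word_mem P_plus_hat_mem pm.subspace_0[OF free_words_subspace])
  then show ?thesis using p by (simp add: M_action_word P_plus_hat_mem M_space_zero M_word_def[of _ "[(p, 0)]"])
qed

lemma M_induct: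
  assumes v: "v \<in> carrier (M_space c)" and H: "subspace_of H (M_space c)" and "M_word c [] \<in> H"
    and "\<And>x u. x \<in> D_plus_hat \<Longrightarrow> u \<in> H \<Longrightarrow> M_action c x u \<in> H"
  shows "v \<in> H"
proof -
  interpret MS: Module.module complex_ring "M_space c" unfolding M_space_def by (rule MQ.module_quot)
  note E = MS.submoduleE[OF H]
  obtain f where f: "v = cls c f" "f \<in> free_words" using v by (auto simp: carrier_M)
  have w: "M_word c w \<in> H" if "w \<in> lists D_plus_hat" for w
    using that by (induction w) (auto simp: assms(3) simp flip: M_action_word intro: assms(4))
  have "f \<in> free_words \<and> cls c f \<in> H"
    using f(2)[unfolded free_words_span]
  proof (induction rule: pm.span_induct_alt)
    case base
    have "cls c 0 = 0 \<odot>\<^bsub>M_space c\<^esub> M_word c []"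
      by (simp add: M_word_def M_space_smult word_mem)
    then show ?case using E(4)[of 0 "M_word c []"] assms(3) by (simp add: pm.subspace_0[OF free_words_subspace])
  next
    case (step z g h)
    then obtain u where u: "u \<in> lists D_plus_hat" "g = word u" by auto
    have "z \<odot>\<^bsub>M_space c\<^esub> M_word c u \<oplus>\<^bsub>M_space c\<^esub> cls c h \<in> H"
      using step w[OF u(1)] by (intro E(5) E(4)) auto
    then show ?case
      using step u by (simp add: M_word_def M_space_smult M_space_add word_mem pm.subspace_add[OF free_words_subspace] pm.subspace_scale[OF free_words_subspace])
  qed
  then show ?thesis by (simp add: f)
qed

section \<open>The vertex algebra of the generalized Verma module\<close>

context va_action
begin

lemma iterate_formula:
  "\<forall>\<^sub>F N in sequentially. act (Y a n b) k u = (\<Sum>j<N. sM ((-1) ^ j * (of_int n gchoose j))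
        (act a (n - int j) (act b (k + int j) u) - sM ((-1) powi n) (act b (n + k - int j) (act a (int j) u))))"
  using borcherds[of 0 a n b k u] eventually_gt_at_top[of 0]
proof eventually_elim
  case (elim N)
  then obtain K where K: "N = Suc K" using gr0_implies_Suc by blast
  have "(\<Sum>j<N. sM (of_int 0 gchoose j) (act (Y a (n + int j) b) (0 + k - int j) u)) = act (Y a n b) k u"
    unfolding K sum.lessThan_Suc_shift by simp
  then show ?case using elim(1) by simp
qed

lemma commutator_formula:
  "\<forall>\<^sub>F N in sequentially. (\<Sum>j<N. sM (of_int m gchoose j) (act (Y a (int j) b) (m + k - int j) u)) =
     act a m (act b k u) - act b k (act a m u)"
  using borcherds[of m a 0 b k u] eventually_gt_at_top[of 0]
proof eventually_elim
  case (elim N)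
  then obtain K where K: "N = Suc K" using gr0_implies_Suc by blast
  have "(\<Sum>j<N. sM ((-1) ^ j * (of_int 0 gchoose j))
        (act a (m + 0 - int j) (act b (k + int j) u)
         - sM ((-1) powi 0) (act b (0 + k - int j) (act a (m + int j) u)))) = act a m (act b k u) - act b k (act a m u)"
    unfolding K sum.lessThan_Suc_shift by simp
  then show ?case using elim(1) by simp
qed

end

lemma M_with_simps [simp]:
  "carrier (M_with c Y) = carrier (M_space c)" "\<zero>\<^bsub>M_with c Y\<^esub> = \<zero>\<^bsub>M_space c\<^esub>"
  "x \<oplus>\<^bsub>M_with c Y\<^esub> y = x \<oplus>\<^bsub>M_space c\<^esub> y" "z \<odot>\<^bsub>M_with c Y\<^esub> x = z \<odot>\<^bsub>M_space c\<^esub> x"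
  "vac (M_with c Y) = M_word c []" "nprod (M_with c Y) = Y" "wt (M_with c Y) = M_weight c"
  by (simp_all add: M_with_def module.extend_def vertex_alg.fields_def)

lemma subspace_of_M_with: "subspace_of H (M_with c Y) \<longleftrightarrow> subspace_of H (M_space c)"
  by (simp add: submodule_def submodule_axioms_def subgroup_def m_inv_def)

text \<open>The vertex algebra $\mathcal M_c^+$ transported to a vector space that is a whole type.\<close>

locale verma_va = realization s "M_with c Y" th em
  for s :: "complex \<Rightarrow> 'f::ab_group_add \<Rightarrow> 'f" and c Y th em +
  assumes sfm: "state_field_map c Y"
begin

text \<open>\<open>rho\<close> is the action of $\hat{\mathcal D}^+$, \<open>pr\<close> is the projection onto the copy of
  $\mathcal M_c^+$ in the type, and \<open>w r\<close> is the generating state $W^r_{-r-1} 1$ of weight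
  $r + 1$.\<close>

definition rho :: "dhat \<Rightarrow> 'f \<Rightarrow> 'f" where "rho x u = em (M_action c x (th u))"
definition YY :: "'f \<Rightarrow> int \<Rightarrow> 'f \<Rightarrow> 'f" where "YY a n b = em (Y (th a) n (th b))"
definition one :: 'f where "one = em (M_word c [])"
definition pr :: "'f \<Rightarrow> 'f" where "pr u = em (th u)"
definition w :: "nat \<Rightarrow> 'f" where "w r = em (M_word c [(W_op r (- int r - 1), 0)])"

lemma vertex: "vertex_algebra (M_with c Y)"
  using sfm by (simp add: state_field_map_def)

lemma va_mod: "va_module (M_with c Y) (M_with c Y) Y"
  using vertex by (simp add: vertex_algebra_def)

lemma Y_closed: "a \<in> carrier (M_space c) \<Longrightarrow> b \<in> carrier (M_space c) \<Longrightarrow> Y a n b \<in> carrier (M_space c)"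
  using va_moduleD(2)[OF va_mod] by simp

lemma th_in [simp]: "th u \<in> carrier (M_space c)" using th_closed by simp
lemma th_em' [simp]: "x \<in> carrier (M_space c) \<Longrightarrow> th (em x) = x" using th_em by simp

lemma th_YY: "th (YY a n b) = Y (th a) n (th b)" by (simp add: YY_def Y_closed)

sublocale VA: va_action s s YY YY
proof -
  have tr: "\<exists>N. \<forall>n\<ge>N. nprod (M_with c Y) a n b = \<zero>\<^bsub>M_with c Y\<^esub>"
    if "a \<in> carrier (M_with c Y)" "b \<in> carrier (M_with c Y)" for a b
    using va_moduleD(7)[OF va_mod] that by simp
  have Y: "nprod (M_with c Y) (th a) n (th b) = th (YY a n b)" for a n b by (simp add: th_YY)
  have "va_action s s YY (\<lambda>a n u. em (Y (th a) n (th u)))"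
    by (rule linear_into_realization_of_vertex_action[OF va_mod realization_axioms linear_into_axioms Y tr])
  moreover have "(\<lambda>a n u. em (Y (th a) n (th u))) = YY" by (simp add: fun_eq_iff YY_def)
  ultimately show "va_action s s YY YY" by simp
qed

lemma pr_add: "pr (u + v) = pr u + pr v" by (simp add: pr_def em_th_add)
lemma pr_scale: "pr (s z u) = s z (pr u)" by (simp add: pr_def em_th_scale)
lemma pr_sum: "pr (sum f S) = (\<Sum>i\<in>S. pr (f i))" by (simp add: pr_def em_th_sum)
lemma pr_pr [simp]: "pr (pr u) = pr u" by (simp add: pr_def)
lemma pr_YY [simp]: "pr (YY a n b) = YY a n b" by (simp add: pr_def YY_def Y_closed)
lemma YY_pr [simp]: "YY a n (pr b) = YY a n b" "YY (pr a) n b = YY a n b" by (simp_all add: pr_def YY_def)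
lemma M_empty_carrier: "M_word c [] \<in> carrier (M_space c)" by (simp add: M_word_carrier)
lemma pr_one [simp]: "pr one = one" by (simp add: pr_def one_def M_empty_carrier)
lemma pr_rho [simp]: "x \<in> D_plus_hat \<Longrightarrow> pr (rho x u) = rho x u" by (simp add: pr_def rho_def M_action_closed)
lemma pr_fix_subspace: "F.subspace {u. pr u = u}"
  using pr_add[of 0 0] by (auto simp: F.subspace_def pr_add pr_scale)

lemma W_hat_mem: "odd r \<Longrightarrow> (W_op r k, 0) \<in> D_plus_hat"
  by (simp add: D_plus_hat_def W_op_eq_Wf Wf_in_D_plus)

lemma pr_w [simp]: "odd r \<Longrightarrow> pr (w r) = w r"
  by (simp add: pr_def w_def M_word_carrier W_hat_mem)

lemma YY_one: "YY one n u = (if n = -1 then pr u else 0)"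
  using va_moduleD(8)[OF va_mod, of "th u" n] em_0
  by (simp add: YY_def one_def M_empty_carrier pr_def split: if_splits)

lemma YY_one_right: "YY u (-1) one = pr u" "n \<ge> 0 \<Longrightarrow> YY u n one = 0"
  using vertex em_0 by (simp_all add: vertex_algebra_def YY_def one_def pr_def M_empty_carrier)

lemma rho_arg_add: "x \<in> D_plus_hat \<Longrightarrow> rho x (u + v) = rho x u + rho x v"
  using th_add[of u v] em_add by (simp add: rho_def M_action_add M_action_closed)
lemma rho_arg_scale: "x \<in> D_plus_hat \<Longrightarrow> rho x (s z u) = s z (rho x u)"
  using th_scale[of z u] em_scale by (simp add: rho_def M_action_smult M_action_closed)
lemma rho_linear: "x \<in> D_plus_hat \<Longrightarrow> y \<in> D_plus_hat \<Longrightarrow> rho (dhat_scale a x + dhat_scale b y) u = s a (rho x u) + s b (rho y u)"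
  using em_add em_scale Q.smult_closed by (simp add: rho_def M_action_linear M_action_closed)
lemma rho_bracket: "x \<in> D_plus_hat \<Longrightarrow> y \<in> D_plus_hat \<Longrightarrow> rho x (rho y u) = rho y (rho x u) + rho (dhat_bracket x y) u"
  using em_add by (simp add: rho_def M_action_closed M_action_bracket[of x y] D_plus_hat_bracket)
lemma rho_kappa: "rho kappa u = s c (pr u)"
  using em_scale by (simp add: rho_def M_action_kappa pr_def)
lemma rho_P_plus: "p \<in> P_plus \<Longrightarrow> rho (p, 0) one = 0"
  using em_0 by (simp add: rho_def one_def M_empty_carrier M_action_P_plus)

lemma D_hat_mem: "A \<in> D_plus \<Longrightarrow> (A, z) \<in> D_plus_hat" by (simp add: D_plus_hat_def)

lemma rho_add: "A \<in> D_plus \<Longrightarrow> B \<in> D_plus \<Longrightarrow> rho (A + B, 0) u = rho (A, 0) u + rho (B, 0) u"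
  using rho_linear[of "(A, 0)" "(B, 0)" 1 1 u] by (simp add: D_hat_mem dhat_scale_def)
lemma rho_scale: "A \<in> D_plus \<Longrightarrow> rho (dscale z A, 0) u = s z (rho (A, 0) u)"
  using rho_linear[of "(A, 0)" "(A, 0)" z 0 u] by (simp add: D_hat_mem dhat_scale_def)
lemma rho_zero: "rho (0, 0) u = 0"
  using rho_scale[of 0 0 u] by (simp add: dop.subspace_0[OF D_plus_subspace])
lemma rho_central: "A \<in> D_plus \<Longrightarrow> rho (A, z) u = rho (A, 0) u + s (z * c) (pr u)"
  using rho_linear[of "(A, 0)" kappa 1 z u] by (simp add: D_hat_mem dhat_scale_def kappa_mem rho_kappa) (simp add: kappa_def)

lemma YY_w: "odd r \<Longrightarrow> YY (w r) n u = rho (Wf r (tpow n), 0) u"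
proof -
  assume r: "odd r"
  have "Y (M_word c [(W_op r (- int r - 1), 0)]) n (th u) = M_action c (W_op r (n - int r), 0) (th u)"
    using sfm r by (simp add: state_field_map_def)
  then show ?thesis
    using r by (simp add: YY_def w_def M_word_carrier W_hat_mem rho_def W_op_eq_Wf[of r "n - int r"])
qed

text \<open>The point of smearing: modes of the generators are differential operators, and products of
  functions need no expansion into modes.\<close>

lemma md_w: assumes r: "odd r" shows "VA.md (w r) f u = rho (Wf r f, 0) u"
proof (induction f rule: pm_induct)
  case zero then show ?case by (simp add: rho_zero)
next
  case (single k x)
  show ?case using r by (simp add: YY_w Wf_single[of r k x] rho_scale Wf_in_D_plus)
next
  case (add f g)
  then show ?case using r by (simp add: VA.md_fun_add Wf_add rho_add Wf_in_D_plus)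
qed

text \<open>The Lie algebra is spanned by the $W^r_k$ and $\kappa$, so it suffices to know the modes
  of the generators and the vector itself.\<close>

lemma rho_in_subspace:
  assumes H: "F.subspace H" and x: "x \<in> D_plus_hat"
    and "pr u \<in> H" "\<And>r n. odd r \<Longrightarrow> YY (w r) n u \<in> H"
  shows "rho x u \<in> H"
proof -
  obtain A z where xA: "x = (A, z)" "A \<in> D_plus" using x by (auto simp: D_plus_hat_def)
  have "A \<in> D_plus \<and> rho (A, 0) u \<in> H"
    using xA(2)[unfolded D_plus_span]
  proof (induction rule: dop.span_induct_alt)
    case base then show ?case by (simp add: rho_zero F.subspace_0[OF H] dop.subspace_0[OF D_plus_subspace])
  next
    case (step a B D)
    then obtain m k where m: "odd m" "B = Wf m (tpow (k + int m))" by (auto simp: W_op_eq_Wf)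
    have B: "B \<in> D_plus" using m by (simp add: Wf_in_D_plus)
    have "rho (B, 0) u \<in> H" using assms(4)[OF m(1), of "k + int m"] by (simp add: YY_w m)
    then show ?case using step B D_plus_subspace
      by (auto simp: rho_add rho_scale dop.subspace_scale dop.subspace_add intro!: F.subspace_add[OF H] F.subspace_scale[OF H])
  qed
  then show ?thesis using xA assms(3) by (simp add: rho_central[of A z] F.subspace_add[OF H] F.subspace_scale[OF H])
qed

text \<open>Words in the Lie algebra applied to the vacuum span, and the modes of the generators span
  the Lie algebra together with the central element.\<close>

lemma generator_induct:
  assumes H: "F.subspace H" and "one \<in> H"
    and step: "\<And>r n u. odd r \<Longrightarrow> u \<in> H \<Longrightarrow> pr u = u \<Longrightarrow> YY (w r) n u \<in> H"
  shows "pr v \<in> H"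
proof -
  have "th v \<in> {x \<in> carrier (M_with c Y). em x \<in> H}"
  proof (rule M_induct)
    show "subspace_of {x \<in> carrier (M_with c Y). em x \<in> H} (M_space c)"
      using subspace_of_em[OF H] by (simp add: subspace_of_M_with)
    show "M_word c [] \<in> {x \<in> carrier (M_with c Y). em x \<in> H}"
      using assms(2) by (simp add: M_empty_carrier one_def)
    fix x u assume x: "x \<in> D_plus_hat" and u: "u \<in> {x \<in> carrier (M_with c Y). em x \<in> H}"
    have "rho x (em u) \<in> H"
      using u by (intro rho_in_subspace[OF H x] step) (auto simp: pr_def)
    then show "M_action c x u \<in> {x \<in> carrier (M_with c Y). em x \<in> H}"
      using u x by (simp add: rho_def M_action_closed)
  qed simp
  then show ?thesis by (simp add: pr_def)
qed

lemma YY_w_one: "odd r \<Longrightarrow> n \<ge> 0 \<Longrightarrow> YY (w r) n one = 0"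
  by (simp add: YY_w rho_P_plus Wf_in_P_plus lookup_single when_def)

subsection \<open>Translation and weight\<close>

text \<open>Besides the translation operator \<open>T\<close> of the vertex algebra there are the modes \<open>D\<close> and
  \<open>L0\<close> of the generator of weight $2$, which is a conformal vector: \<open>D\<close> turns out to be \<open>T\<close>, and
  the eigenvalues of \<open>L0\<close> are the weights.\<close>

definition T :: "'f \<Rightarrow> 'f" where "T a = YY a (-2) one"
definition L0 :: "'f \<Rightarrow> 'f" where "L0 = YY (w 1) 1"
definition D :: "'f \<Rightarrow> 'f" where "D = YY (w 1) 0"

lemma D_YY_w: "odd r \<Longrightarrow> D (YY (w r) n u) = YY (w r) n (D u) - s (of_int n) (YY (w r) (n - 1) u)"
proof -
  assume r: "odd r"
  have "rho (Wf (Suc 0) 1, 0) (rho (Wf r (tpow n), 0) u) =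
    rho (Wf r (tpow n), 0) (rho (Wf (Suc 0) 1, 0) u) + rho (- Wf r (ldiff (tpow n)), 0) u"
    using rho_bracket[of "(Wf (Suc 0) 1, 0)" "(Wf r (tpow n), 0)" u] r
    by (simp add: D_hat_mem Wf_in_D_plus translation_bracket)
  moreover have e: "- Wf r (ldiff (tpow n)) = dscale (- of_int n) (Wf r (tpow (n - 1)))"
    using Wf_single[of r "n - 1" "of_int n"] by simp
  moreover have "rho (- Wf r (ldiff (tpow n)), 0) u = s (- of_int n) (rho (Wf r (tpow (n - 1)), 0) u)"
    unfolding e using r by (intro rho_scale Wf_in_D_plus)
  ultimately show ?thesis
    using r by (simp add: D_def YY_w)
qed

lemma L0_YY_w: "odd r \<Longrightarrow> L0 (YY (w r) n u) = YY (w r) n (L0 u) + s (of_nat r - of_int n) (YY (w r) n u)"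
proof -
  assume r: "odd r"
  have "rho (Wf (Suc 0) (tpow 1), 0) (rho (Wf r (tpow n), 0) u) =
    rho (Wf r (tpow n), 0) (rho (Wf (Suc 0) (tpow 1), 0) u) + rho (dscale (of_nat r - of_int n) (Wf r (tpow n)), 0) u"
    using rho_bracket[of "(Wf (Suc 0) (tpow 1), 0)" "(Wf r (tpow n), 0)" u] r
    by (simp add: D_hat_mem Wf_in_D_plus euler_bracket)
  then show ?thesis
    using r by (simp add: L0_def YY_w rho_scale Wf_in_D_plus)
qed

lemma YY_diff: "YY a n (u - v) = YY a n u - YY a n v"
  using VA.act_arg_add[of a n "u - v" v] by (simp add: eq_diff_eq)

text \<open>The iterate formula for $a(-2)1$; as the vacuum acts by $1$ in the mode $-1$ and by $0$
  otherwise, a single term survives.\<close>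

lemma T_mode: "YY (T a) n u = s (- of_int n) (YY a (n - 1) u)"
proof -
  have g: "(-1) ^ j * ((-2 :: complex) gchoose j) = of_nat (Suc j)" for j
  proof -
    have "(-2 :: complex) gchoose j = (-1) ^ j * (of_nat (Suc j) gchoose j)"
      using gbinomial_minus[of "2::complex" j] by (simp add: add.commute)
    also have "(of_nat (Suc j) :: complex) gchoose j = of_nat (Suc j choose j)"
      by (rule binomial_gbinomial[symmetric])
    finally show ?thesis by (simp flip: power_mult_distrib mult.assoc)
  qed
  have "\<forall>\<^sub>F N in sequentially. YY (T a) n u = s (- of_int n) (YY a (n - 1) u)"
    using VA.iterate_formula[of a "-2" one n u] eventually_gt_at_top[of "nat \<bar>n\<bar>"]
  proof eventually_elim
    case (elim N)
    have "YY (T a) n u = (\<Sum>j<N. s (of_nat (Suc j)) (YY a (-2 - int j) (YY one (n + int j) u) - YY one (-2 + n - int j) (YY a (int j) u)))"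
      using elim(1) by (simp add: T_def g)
    \<comment> \<open>the surviving term is in the first part for \<open>n < 0\<close>, in the second for \<open>n > 0\<close>,
      and absent for \<open>n = 0\<close>\<close>
    also have "\<dots> = (\<Sum>j<N. (if j = nat (-1 - n) then s (if n < 0 then - of_int n else 0) (YY a (n - 1) u) else 0)
       + (if j = nat (n - 1) then s (if n > 0 then - of_int n else 0) (YY a (n - 1) u) else 0))"
    proof (intro sum.cong refl)
      fix j
      have 1: "n + int j = -1 \<longleftrightarrow> n < 0 \<and> j = nat (-1 - n)" by auto
      have 2: "-2 + n - int j = -1 \<longleftrightarrow> n > 0 \<and> j = nat (n - 1)" by auto
      consider "n < 0" | "n = 0" | "n > 0" by linarith
      then show "s (of_nat (Suc j)) (YY a (-2 - int j) (YY one (n + int j) u) - YY one (-2 + n - int j) (YY a (int j) u)) =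
        (if j = nat (-1 - n) then s (if n < 0 then - of_int n else 0) (YY a (n - 1) u) else 0)
       + (if j = nat (n - 1) then s (if n > 0 then - of_int n else 0) (YY a (n - 1) u) else 0)"
      proof cases
        case 1
        show ?thesis
        proof (cases "j = nat (-1 - n)")
          case True
          then have "int j = -1 - n" using 1 by simp
          then have "int (Suc j) = - n" and e2: "-2 - int j = n - 1" "n + int j = -1" by simp_all
          then have "of_int (int (Suc j)) = (- of_int n :: complex)" by (simp only: of_int_minus)
          then have e: "of_nat (Suc j) = (- of_int n :: complex)" "-2 - int j = n - 1" "n + int j = -1"
            using e2 by (simp_all only: of_int_of_nat_eq)
          show ?thesis using 1 True unfolding e by (simp add: YY_one)
        next
          case False
          then have "n + int j \<noteq> -1" using 1 by auto
          then show ?thesis using 1 False by (simp add: YY_one)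
        qed
      next
        case 2 then show ?thesis by (simp add: YY_one)
      next
        case 3
        show ?thesis
        proof (cases "j = nat (n - 1)")
          case True
          then have "int j = n - 1" using 3 by simp
          then have "int (Suc j) = n" and e2: "-2 + n - int j = -1" "int j = n - 1" by simp_all
          then have "of_int (int (Suc j)) = (of_int n :: complex)" by (simp only:)
          then have e: "of_nat (Suc j) = (of_int n :: complex)" "-2 + n - int j = -1" "int j = n - 1"
            using e2 by (simp_all only: of_int_of_nat_eq)
          show ?thesis using 3 True unfolding e by (simp add: YY_one F.scale_minus_left)
        next
          case False
          then have "-2 + n - int j \<noteq> -1" using 3 by auto
          then show ?thesis using 3 False by (simp add: YY_one)
        qed
      qed
    qed
    also have "\<dots> = s (- of_int n) (YY a (n - 1) u)"
      using elim(2) by (cases "n = 0") (auto simp: sum.distrib sum.delta)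
    finally show ?case .
  qed
  then show ?thesis by simp
qed

lemma T_add: "T (a + b) = T a + T b" by (simp add: T_def VA.act_add)
lemma T_0 [simp]: "T 0 = 0" by (simp add: T_def)
lemma T_scale: "T (s z a) = s z (T a)" by (simp add: T_def VA.act_scale)

lemma T_YY: "(\<And>j. j \<ge> 0 \<Longrightarrow> YY a j one = 0) \<Longrightarrow> T (YY a n u) = YY a n (T u) - s (of_int n) (YY a (n - 1) u)"
proof -
  assume a: "\<And>j. j \<ge> 0 \<Longrightarrow> YY a j one = 0"
  have "\<forall>\<^sub>F N in sequentially. T (YY a n u) = YY a n (T u) - s (of_int n) (YY a (n - 1) u)"
    using VA.iterate_formula[of a n u "-2" one] eventually_gt_at_top[of 2]
  proof eventually_elim
    case (elim N)
    then obtain K where K: "N = Suc (Suc K)" using less_imp_Suc_add[of 1 N] by auto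
    have z: "YY u (-2 + int (Suc (Suc j))) one = 0" for j by (rule YY_one_right) simp
    have "T (YY a n u) = (\<Sum>j<N. s ((-1) ^ j * (of_int n gchoose j)) (YY a (n - int j) (YY u (-2 + int j) one)))"
      using elim(1) a by (simp add: T_def)
    also have "\<dots> = YY a n (T u) + s (- of_int n) (YY a (n - 1) (YY u (-1) one))"
      unfolding K sum.lessThan_Suc_shift z by (simp add: T_def)
    finally show ?case by (simp add: YY_one_right)
  qed
  then show ?thesis by simp
qed

text \<open>Both operators kill the vacuum and have the same commutators with the modes of the
  generators. The consequence that matters: the translation operator preserves every submodule.\<close>

lemma D_eq_T: "D u = T u"
proof -
  have DT: "D (pr u) = D u" "T (pr u) = T u" by (simp_all add: D_def T_def)
  have "pr u \<in> {u. D u = T u}"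
  proof (rule generator_induct)
    show "F.subspace {u. D u = T u}"
      by (auto simp: F.subspace_def D_def T_add T_scale T_0 VA.act_arg_add VA.act_arg_scale)
    show "one \<in> {u. D u = T u}" by (simp add: D_def T_def YY_w_one YY_one)
    fix r :: nat and n u assume "odd r" "u \<in> {u. D u = T u}" "pr u = u"
    then show "YY (w r) n u \<in> {u. D u = T u}"
      by (simp add: D_YY_w T_YY YY_w_one)
  qed
  then show ?thesis by (simp add: DT)
qed

text \<open>The commutator formula for the mode $1$ of the generator of weight $2$, of which only the
  terms with \<open>D b\<close> and \<open>L0 b\<close> are present. It says that $a(n)$ has degree $m - n - 1$ for \<open>a\<close> of
  weight \<open>m\<close>.\<close>

lemma L0_YY: "L0 (YY b k u) = YY b k (L0 u) + YY (L0 b) k u - s (of_int (k + 1)) (YY b k u)"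
proof -
  have "\<forall>\<^sub>F N in sequentially. L0 (YY b k u) = YY b k (L0 u) + YY (L0 b) k u - s (of_int (k + 1)) (YY b k u)"
    using VA.commutator_formula[of 1 "w 1" b k u] eventually_gt_at_top[of 2]
  proof eventually_elim
    case (elim N)
    then obtain K where K: "N = Suc (Suc K)" using less_imp_Suc_add[of 1 N] by auto
    have g: "(1 :: complex) gchoose Suc (Suc j) = 0" for j
      using binomial_gbinomial[of 1 "Suc (Suc j)", where ?'a = complex] by simp
    have "(\<Sum>j<N. s (of_int 1 gchoose j) (YY (YY (w 1) (int j) b) (1 + k - int j) u)) =
        YY (D b) (1 + k) u + YY (L0 b) k u"
      unfolding K sum.lessThan_Suc_shift by (simp add: g D_def L0_def)
    also have "YY (D b) (1 + k) u = - s (of_int (k + 1)) (YY b k u)"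
      unfolding D_eq_T T_mode F.scale_minus_left by (simp add: add.commute)
    finally have "YY (w 1) 1 (YY b k u) - YY b k (YY (w 1) 1 u) = - s (of_int (k + 1)) (YY b k u) + YY (L0 b) k u"
      using elim(1) by simp
    moreover have "x - y = - z + v \<Longrightarrow> x = y + v - z" for x y z v :: 'f by (simp add: algebra_simps)
    ultimately show ?case unfolding L0_def by blast
  qed
  then show ?thesis by simp
qed

lemma L0_one: "L0 one = 0" by (simp add: L0_def YY_w_one)
lemma L0_add: "L0 (a + b) = L0 a + L0 b" by (simp add: L0_def VA.act_arg_add)
lemma L0_scale: "L0 (s z a) = s z (L0 a)" by (simp add: L0_def VA.act_arg_scale)

text \<open>The eigenspaces of \<open>L0\<close> in the copy of $\mathcal M_c^+$. They have the multiplicative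
  property of a grading because of the commutator of \<open>L0\<close> with modes; that they coincide with
  the spans \<open>Mw n\<close> of words is shown below.\<close>

definition E :: "int \<Rightarrow> 'f set" where "E m = {u. pr u = u \<and> L0 u = s (of_int m) u}"

lemma E_subspace: "F.subspace (E m)"
  using F.subspace_0[OF pr_fix_subspace]
  by (auto simp: F.subspace_def E_def pr_add pr_scale L0_add L0_scale F.scale_right_distrib mult.commute) 
    (simp add: L0_def)

lemma E_YY: "a \<in> E m \<Longrightarrow> b \<in> E p \<Longrightarrow> YY a n b \<in> E (m + p - n - 1)"
  by (simp add: E_def L0_YY VA.act_scale VA.act_arg_scale flip: F.scale_left_distrib F.scale_left_diff_distrib)

lemma one_E: "one \<in> E 0" by (simp add: E_def L0_one)

lemma w_eq: "odd r \<Longrightarrow> w r = YY (w r) (-1) one" by (simp add: YY_one_right)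

lemma w_E: "odd r \<Longrightarrow> w r \<in> E (int r + 1)"
  using L0_YY_w[of r "-1" one] by (simp add: E_def L0_one flip: w_eq)

lemma T_E: "a \<in> E m \<Longrightarrow> T a \<in> E (m + 1)"
  using E_YY[OF _ one_E, of a m "-2"] by (simp add: T_def add.commute)

end

section \<open>Eigenvectors and spans\<close>

text \<open>Eigenvectors for distinct eigenvalues are independent modulo every invariant subspace:
  applying $L - \lambda_k$ removes one summand and multiplies the others by nonzero numbers.\<close>

lemma (in vector_space) eigenvector_sum_in_subspace:
  assumes U: "subspace U" "\<And>u. u \<in> U \<Longrightarrow> L u \<in> U"
    and L: "\<And>u v. L (u + v) = L u + L v" "\<And>z u. L (scale z u) = scale z (L u)"
    and S: "finite S" "inj_on lam S" and eig: "\<And>i. i \<in> S \<Longrightarrow> L (a i) = scale (lam i) (a i)"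
    and sum: "sum a S \<in> U" and i: "i \<in> S"
  shows "a i \<in> U"
  using S eig sum i
proof (induction S arbitrary: a i rule: finite_induct)
  case (insert k S)
  have Lsum: "L (sum b R) = (\<Sum>i\<in>R. L (b i))" for b R
    by (induction R rule: infinite_finite_induct) (auto simp: L(1) L(2)[of 0 0, simplified])
  let ?b = "\<lambda>i. scale (lam i - lam k) (a i)"
  have "L (sum a (insert k S)) - scale (lam k) (sum a (insert k S)) = sum ?b S"
    using insert.hyps insert.prems(2)
    by (simp add: L Lsum scale_sum_right scale_right_distrib scale_left_diff_distrib sum_subtractf)
  then have "sum ?b S \<in> U"
    using subspace_diff[OF U(1) U(2)[OF insert.prems(3)] subspace_scale[OF U(1) insert.prems(3), of "lam k"]] by simp
  moreover have "L (?b j) = scale (lam j) (?b j)" if "j \<in> S" for j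
  proof -
    have e: "L (a j) = scale (lam j) (a j)" using insert.prems(2) that by simp
    have "L (scale z (a j)) = scale z (L (a j))" for z by (rule L)
    then show ?thesis by (simp add: e mult.commute)
  qed
  ultimately have b: "?b j \<in> U" if "j \<in> S" for j
    using insert.IH[of ?b j] insert.prems(1) that by auto
  have aj: "a j \<in> U" if "j \<in> S" for j
  proof -
    have "lam j - lam k \<noteq> 0" using insert.prems(1) insert.hyps that by (auto simp: inj_on_def)
    then have "a j = scale (1 / (lam j - lam k)) (?b j)" by simp
    then show ?thesis using subspace_scale[OF U(1) b[OF that]] by metis
  qed
  have "a k = sum a (insert k S) - sum a S" using insert.hyps by simp
  then have "a k \<in> U" using subspace_diff[OF U(1) insert.prems(3) subspace_sum[OF U(1) aj]] by simp
  then show ?case using aj insert.prems(4) by auto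
qed simp

lemma (in realization) mem_lspan_iff:
  assumes "S \<subseteq> carrier Q" "x \<in> carrier Q"
  shows "x \<in> lspan Q S \<longleftrightarrow> em x \<in> F.span (em ` S)"
proof
  assume "x \<in> lspan Q S"
  moreover have "subspace_of {x \<in> carrier Q. em x \<in> F.span (em ` S)} Q"
    by (rule subspace_of_em[OF F.subspace_span])
  moreover have "S \<subseteq> {x \<in> carrier Q. em x \<in> F.span (em ` S)}"
    using assms(1) by (auto intro: F.span_base)
  ultimately show "em x \<in> F.span (em ` S)" unfolding lspan_def by blast
next
  assume x: "em x \<in> F.span (em ` S)"
  show "x \<in> lspan Q S" unfolding lspan_def
  proof safe
    fix H assume H: "subspace_of H Q" "S \<subseteq> H"
    have "F.span (em ` S) \<subseteq> {u. th u \<in> H}"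
    proof (intro F.span_minimal subspace_vimage H(1) subsetI)
      fix v assume "v \<in> em ` S"
      then obtain y where y: "y \<in> S" "v = em y" by auto
      then have "y \<in> carrier Q" using assms(1) by blast
      then show "v \<in> {u. th u \<in> H}" using y H(2) by auto
    qed
    then show "x \<in> H" using x assms(2) by auto
  qed
qed

lemma (in linear_into) span_th_in_lspan:
  assumes "u \<in> F.span A" "th ` A \<subseteq> S" shows "th u \<in> lspan Q S"
  unfolding lspan_def
proof safe
  fix H assume H: "subspace_of H Q" "S \<subseteq> H"
  have "F.span A \<subseteq> {u. th u \<in> H}"
    using H assms(2) by (intro F.span_minimal subspace_vimage) auto
  then show "th u \<in> H" using assms(1) by auto
qed

context verma_va
begin

section \<open>Filtration by word length\<close>

text \<open>The vectors that can be written with at most \<open>p\<close> generators in negative modes.\<close>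

primrec Fil :: "nat \<Rightarrow> 'f set" where
  "Fil 0 = F.span {one}"
| "Fil (Suc p) = F.span (Fil p \<union> {YY (w r) (-1 - int k) u | r k u. odd r \<and> u \<in> Fil p})"

lemma Fil_subspace: "F.subspace (Fil p)" by (cases p) (auto intro: F.subspace_span)

lemma Fil_Suc: "Fil p \<subseteq> Fil (Suc p)" by (auto intro: F.span_base)

lemma Fil_mono: "p \<le> q \<Longrightarrow> Fil p \<subseteq> Fil q"
  using lift_Suc_mono_le[of Fil, OF Fil_Suc] by blast

lemma Fil_neg: "odd r \<Longrightarrow> u \<in> Fil p \<Longrightarrow> YY (w r) (-1 - int k) u \<in> Fil (Suc p)"
  by (auto intro: F.span_base)

lemma Fil_pr: "u \<in> Fil p \<Longrightarrow> pr u = u"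
proof -
  have "Fil p \<subseteq> {u. pr u = u}"
  proof (induction p)
    case 0 show ?case unfolding Fil.simps by (intro F.span_minimal pr_fix_subspace) simp
  next
    case (Suc p) then show ?case unfolding Fil.simps by (intro F.span_minimal pr_fix_subspace) auto
  qed
  then show "u \<in> Fil p \<Longrightarrow> pr u = u" by auto
qed

text \<open>Moving the mode to the right, past a negative mode, gives a commutator, which is a
  combination of single modes and a constant; so the word does not get longer. At the vacuum the
  mode vanishes.\<close>

lemma Fil_pos: "odd r \<Longrightarrow> n \<ge> 0 \<Longrightarrow> u \<in> Fil p \<Longrightarrow> YY (w r) n u \<in> Fil p"
proof (induction p arbitrary: r n u)
  case 0
  from 0(3)[unfolded Fil.simps] show ?case
  proof (induction rule: F.span_induct_alt)
    case (step z x y)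
    then show ?case using 0(1,2) by (simp add: VA.act_arg_add VA.act_arg_scale YY_w_one)
  qed (simp add: F.span_zero)
next
  case (Suc p)
  from Suc.prems(3)[unfolded Fil.simps] show ?case
  proof (induction rule: F.span_induct_alt)
    case base then show ?case by (simp add: F.span_zero)
  next
    case (step z x y)
    have "YY (w r) n x \<in> Fil (Suc p)"
    proof (cases "x \<in> Fil p")
      case True
      then show ?thesis using Suc.IH[OF Suc.prems(1,2) True] Fil_Suc by blast
    next
      case False
      then obtain q k u' where x: "x = YY (w q) (-1 - int k) u'" "odd q" "u' \<in> Fil p"
        using step(1) by blast
      let ?a = "(Wf r (tpow n), 0)" and ?b = "(Wf q (tpow (-1 - int k)), 0)"
      have ab: "?a \<in> D_plus_hat" "?b \<in> D_plus_hat" using Suc.prems(1) x(2) by (auto simp: D_hat_mem Wf_in_D_plus)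
      have "YY (w r) n x = YY (w q) (-1 - int k) (YY (w r) n u') + rho (dhat_bracket ?a ?b) u'"
        using rho_bracket[OF ab, of u'] Suc.prems(1) x(1,2) by (simp add: YY_w)
      moreover have "YY (w q) (-1 - int k) (YY (w r) n u') \<in> Fil (Suc p)"
        by (intro Fil_neg x(2) Suc.IH Suc.prems x(3))
      moreover have "rho (dhat_bracket ?a ?b) u' \<in> Fil (Suc p)"
      proof (rule rho_in_subspace[OF Fil_subspace D_plus_hat_bracket[OF ab]])
        show "pr u' \<in> Fil (Suc p)" using Fil_pr[OF x(3)] x(3) Fil_Suc by auto
        fix r' n' assume r': "odd (r' :: nat)"
        show "YY (w r') n' u' \<in> Fil (Suc p)"
        proof (cases "n' \<ge> 0")
          case True then show ?thesis using Suc.IH[OF r' True x(3)] Fil_Suc by blast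
        next
          case False
          then have "n' = -1 - int (nat (-1 - n'))" by simp
          then show ?thesis using Fil_neg[OF r' x(3)] by metis
        qed
      qed
      ultimately show ?thesis using F.subspace_add[OF Fil_subspace[of "Suc p"]] by (simp only:)
    qed
    then show ?case
      using step(2) F.subspace_add[OF Fil_subspace[of "Suc p"]] F.subspace_scale[OF Fil_subspace[of "Suc p"]]
      by (simp only: VA.act_arg_add VA.act_arg_scale)
  qed
qed

lemma Fil_exhaust: obtains p where "pr u \<in> Fil p"
proof -
  have "pr u \<in> (\<Union>p. Fil p)"
  proof (rule generator_induct)
    show "F.subspace (\<Union>p. Fil p)"
    proof (rule F.subspaceI)
      fix x y assume "x \<in> (\<Union>p. Fil p)" "y \<in> (\<Union>p. Fil p)"
      then obtain p q where "x \<in> Fil p" "y \<in> Fil q" by auto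
      then have "x \<in> Fil (max p q)" "y \<in> Fil (max p q)" using Fil_mono by (meson max.cobounded1 max.cobounded2 subsetD)+
      then show "x + y \<in> (\<Union>p. Fil p)" using F.subspace_add[OF Fil_subspace] by blast
    qed (use F.subspace_0[OF Fil_subspace] F.subspace_scale[OF Fil_subspace] in blast)+
    show "one \<in> (\<Union>p. Fil p)" by (auto intro!: exI[of _ 0] F.span_base)
    fix r :: nat and n u assume r: "odd r" and "u \<in> (\<Union>p. Fil p)"
    then obtain p where p: "u \<in> Fil p" by auto
    show "YY (w r) n u \<in> (\<Union>p. Fil p)"
    proof (cases "n \<ge> 0")
      case True then show ?thesis using Fil_pos[OF r True p] by blast
    next
      case False
      then have "n = -1 - int (nat (-1 - n))" by simp
      then show ?thesis using Fil_neg[OF r p] by (metis UN_I UNIV_I)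
    qed
  qed
  then show thesis using that by blast
qed

section \<open>The weight grading\<close>

definition W_words :: "int \<Rightarrow> M_elem set" where
  "W_words n = {M_word c (map (\<lambda>(m, k). (W_op m k, 0)) ws) | ws.
       (\<forall>(m, k)\<in>set ws. odd m) \<and> (\<Sum>(m, k)\<leftarrow>ws. - k) = n}"

definition Mw :: "int \<Rightarrow> 'f set" where "Mw n = F.span (em ` W_words n)"

lemma W_words_lists: "\<forall>(m, k)\<in>set ws. odd m \<Longrightarrow> map (\<lambda>(m, k). (W_op m k, 0)) ws \<in> lists D_plus_hat"
  by (fastforce simp: W_hat_mem)

lemma W_words_carrier: "W_words n \<subseteq> carrier (M_space c)"
  unfolding W_words_def using W_words_lists M_word_carrier by blast

lemma M_weight_iff: "x \<in> carrier (M_space c) \<Longrightarrow> x \<in> M_weight c n \<longleftrightarrow> em x \<in> Mw n"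
proof -
  assume x: "x \<in> carrier (M_space c)"
  have "M_weight c n = lspan (M_with c Y) (W_words n)"
    by (simp add: M_weight_def W_words_def lspan_def subspace_of_M_with)
  then show ?thesis
    using mem_lspan_iff[of "W_words n" x] W_words_carrier x by (simp add: Mw_def)
qed

lemma M_weight_carrier: "x \<in> M_weight c n \<Longrightarrow> x \<in> carrier (M_space c)"
proof -
  interpret MS: Module.module complex_ring "M_space c" unfolding M_space_def by (rule MQ.module_quot)
  have "subspace_of (carrier (M_space c)) (M_space c)" by (rule MS.submoduleI) auto
  then show "x \<in> M_weight c n \<Longrightarrow> x \<in> carrier (M_space c)"
    using W_words_carrier[of n] unfolding M_weight_def lspan_def W_words_def by blast
qed

lemma Mw_subspace: "F.subspace (Mw n)" by (simp add: Mw_def F.subspace_span)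

lemma YY_w_word:
  assumes "odd r" "v \<in> lists D_plus_hat"
  shows "YY (w r) n (em (M_word c v)) = em (M_word c ((W_op r (n - int r), 0) # v))"
  using assms by (simp add: YY_w rho_def M_word_carrier M_action_word W_op_eq_Wf D_hat_mem Wf_in_D_plus)

lemma Mw_one: "one \<in> Mw 0"
  unfolding Mw_def one_def W_words_def by (rule F.span_base) (force intro!: imageI exI[of _ "[]"])

lemma Mw_YY: assumes r: "odd r" and u: "u \<in> Mw n" shows "YY (w r) l u \<in> Mw (n + int r - l)"
  using u[unfolded Mw_def]
proof (induction rule: F.span_induct_alt)
  case base then show ?case by (simp add: F.subspace_0[OF Mw_subspace])
next
  case (step z x y)
  then obtain ws where ws: "x = em (M_word c (map (\<lambda>(m, k). (W_op m k, 0)) ws))"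
     "\<forall>(m, k)\<in>set ws. odd m" "(\<Sum>(m, k)\<leftarrow>ws. - k) = n" by (auto simp: W_words_def)
  have "YY (w r) l x = em (M_word c (map (\<lambda>(m, k). (W_op m k, 0)) ((r, l - int r) # ws)))"
    unfolding ws(1) by (subst YY_w_word[OF r W_words_lists[OF ws(2)]]) simp
  also have "\<dots> \<in> Mw (n + int r - l)"
    unfolding Mw_def W_words_def using ws r by (intro F.span_base imageI CollectI exI[of _ "(r, l - int r) # ws"]) auto
  finally show ?case using step(2) Mw_subspace
    by (simp add: VA.act_arg_add VA.act_arg_scale F.subspace_add F.subspace_scale)
qed

text \<open>Each letter $W^m_k$ of a word changes the eigenvalue of \<open>L0\<close> by $-k$.\<close>

lemma Mw_E: "Mw n \<subseteq> E n"
proof -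
  have "em (M_word c (map (\<lambda>(m, k). (W_op m k, 0)) ws)) \<in> E (\<Sum>(m, k)\<leftarrow>ws. - k)"
    if "\<forall>(m, k)\<in>set ws. odd m" for ws
    using that
  proof (induction ws)
    case Nil then show ?case using one_E by (simp add: one_def)
  next
    case (Cons mk ws)
    obtain m k where mk: "mk = (m, k)" by force
    have m: "odd m" using Cons.prems mk by auto
    have ws: "\<forall>(m, k)\<in>set ws. odd m" using Cons.prems by auto
    have "em (M_word c (map (\<lambda>(m, k). (W_op m k, 0)) (mk # ws))) = YY (w m) (k + int m) (em (M_word c (map (\<lambda>(m, k). (W_op m k, 0)) ws)))"
      by (simp add: YY_w_word[OF m W_words_lists[OF ws]] mk)
    also have "\<dots> \<in> E (int m + 1 + (\<Sum>(m, k)\<leftarrow>ws. - k) - (k + int m) - 1)"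
      by (intro E_YY w_E m Cons.IH ws)
    finally show ?case by (simp add: mk)
  qed
  then show ?thesis unfolding Mw_def by (intro F.span_minimal E_subspace) (auto simp: W_words_def)
qed

text \<open>A decomposition into homogeneous vectors of nonnegative weight.\<close>

definition is_dec :: "'f \<Rightarrow> (nat \<Rightarrow> 'f) \<Rightarrow> bool" where
  "is_dec v f \<longleftrightarrow> finite {i. f i \<noteq> 0} \<and> (\<forall>i. f i \<in> E (int i)) \<and> v = (\<Sum>i | f i \<noteq> 0. f i)"

lemma supp_sum: "finite S \<Longrightarrow> {i. f i \<noteq> 0} \<subseteq> S \<Longrightarrow> (\<Sum>i | f i \<noteq> 0. f i) = sum f S"
  for f :: "nat \<Rightarrow> 'f"
  by (intro sum.mono_neutral_left) auto

lemma is_dec_add: assumes "is_dec u f" "is_dec v g" shows "is_dec (u + v) (\<lambda>i. f i + g i)"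
proof -
  let ?S = "{i. f i \<noteq> 0} \<union> {i. g i \<noteq> 0}"
  have S: "finite ?S" "{i. f i + g i \<noteq> 0} \<subseteq> ?S" using assms by (auto simp: is_dec_def)
  have "(\<Sum>i | f i + g i \<noteq> 0. f i + g i) = sum f ?S + sum g ?S"
    by (subst supp_sum[OF S]) (simp add: sum.distrib)
  also have "\<dots> = u + v" using assms S(1) supp_sum[OF S(1), of f] supp_sum[OF S(1), of g] by (auto simp: is_dec_def)
  finally show ?thesis
    using assms finite_subset[OF S(2,1)] F.subspace_add[OF E_subspace] by (auto simp: is_dec_def)
qed

lemma is_dec_scale: assumes "is_dec u f" shows "is_dec (s z u) (\<lambda>i. s z (f i))"
proof -
  let ?S = "{i. f i \<noteq> 0}"
  have S: "finite ?S" "{i. s z (f i) \<noteq> 0} \<subseteq> ?S" using assms by (auto simp: is_dec_def)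
  have "(\<Sum>i | s z (f i) \<noteq> 0. s z (f i)) = s z u"
    using assms by (subst supp_sum[OF S]) (simp add: is_dec_def F.scale_sum_right)
  then show ?thesis
    using assms finite_subset[OF S(2,1)] F.subspace_scale[OF E_subspace] by (auto simp: is_dec_def)
qed

lemma is_dec_single: "u \<in> E (int m) \<Longrightarrow> is_dec u (\<lambda>i. if i = m then u else 0)"
  using F.subspace_0[OF E_subspace] by (cases "u = 0") (auto simp: is_dec_def)

lemma is_dec_zero: "is_dec 0 (\<lambda>i. 0)"
  using F.subspace_0[OF E_subspace] by (auto simp: is_dec_def)

lemma L0_eigen_independent:
  assumes U: "F.subspace U" "\<And>u. u \<in> U \<Longrightarrow> L0 u \<in> U"
    and S: "finite S" "\<And>i. i \<in> S \<Longrightarrow> a i \<in> E i" "sum a S \<in> U" "i \<in> S"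
  shows "a i \<in> U"
  using S(2)
  by (intro F.eigenvector_sum_in_subspace[OF U L0_add L0_scale S(1) _ _ S(3,4), where lam = of_int])
    (auto simp: E_def inj_on_def L0_scale[of 0 0, simplified] L0_scale)

text \<open>The components of a vector lie in every invariant subspace that contains it. For the zero
  subspace this is the uniqueness of the decomposition.\<close>

lemma is_dec_component_in:
  assumes U: "F.subspace U" "\<And>u. u \<in> U \<Longrightarrow> L0 u \<in> U" and f: "is_dec v f" and v: "v \<in> U"
  shows "f i \<in> U"
proof (cases "f i = 0")
  case True then show ?thesis using F.subspace_0[OF U(1)] by simp
next
  case False
  let ?S = "{i. f i \<noteq> 0}"
  have "(\<Sum>k\<in>int ` ?S. f (nat k)) = v"
    using f by (subst sum.reindex) (auto simp: is_dec_def)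
  then have sum: "(\<Sum>k\<in>int ` ?S. f (nat k)) \<in> U" using v by simp
  have fin: "finite (int ` ?S)" using f by (simp add: is_dec_def)
  have E: "f (nat k) \<in> E k" if "k \<in> int ` ?S" for k using that f by (auto simp: is_dec_def)
  have i: "int i \<in> int ` ?S" using False by simp
  show ?thesis using L0_eigen_independent[OF U fin E sum i] by simp
qed

lemma is_dec_unique: assumes "is_dec u f" "is_dec u g" shows "f = g"
proof
  fix i
  have "is_dec (u + s (-1) u) (\<lambda>i. f i + s (-1) (g i))"
    by (intro is_dec_add is_dec_scale assms)
  then have "is_dec 0 (\<lambda>i. f i - g i)" by simp
  moreover have U: "F.subspace {0}" "\<And>u. u \<in> {0} \<Longrightarrow> L0 u \<in> {0}"
    using L0_scale[of 0 0] by (auto simp: F.subspace_def)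
  ultimately have "f i - g i \<in> {0}" using is_dec_component_in[OF U] by blast
  then show "f i = g i" by simp
qed

text \<open>The vacuum and negative modes of generators have nonnegative weight, and they span by the
  filtration.\<close>

lemma dec_Mw: "\<exists>f. is_dec (pr u) f \<and> (\<forall>i. f i \<in> Mw (int i))"
proof -
  have "Fil p \<subseteq> F.span (\<Union>m::nat. Mw (int m))" for p
  proof (induction p)
    case 0
    then show ?case using Mw_one unfolding Fil.simps by (intro F.span_minimal F.subspace_span) (auto intro!: F.span_base UN_I[of 0])
  next
    case (Suc p)
    have "YY (w r) (-1 - int k) u \<in> F.span (\<Union>m::nat. Mw (int m))" if r: "odd r" and u: "u \<in> Fil p" for r k u
    proof -
      have "u \<in> F.span (\<Union>m::nat. Mw (int m))" using Suc u by auto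
      then show ?thesis
      proof (induction rule: F.span_induct_alt)
        case base then show ?case by (simp add: F.span_zero)
      next
        case (step z x y)
        then obtain m where "x \<in> Mw (int m)" by auto
        from Mw_YY[OF r this, of "-1 - int k"]
        have "YY (w r) (-1 - int k) x \<in> Mw (int (m + r + 1 + k))" by (simp add: algebra_simps)
        then have "YY (w r) (-1 - int k) x \<in> F.span (\<Union>m::nat. Mw (int m))" by (intro F.span_base) blast
        then show ?case using step(2) by (simp only: VA.act_arg_add VA.act_arg_scale F.span_add F.span_scale)
      qed
    qed
    then show ?case using Suc unfolding Fil.simps by (intro F.span_minimal F.subspace_span) auto
  qed
  then have "pr u \<in> F.span (\<Union>m::nat. Mw (int m))" using Fil_exhaust[of u] by blast
  then show ?thesis
  proof (induction rule: F.span_induct_alt)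
    case base
    then show ?case using is_dec_zero F.subspace_0[OF Mw_subspace] by blast
  next
    case (step z x y)
    then obtain m f where m: "x \<in> Mw (int m)" and f: "is_dec y f" "\<forall>i. f i \<in> Mw (int i)" by auto
    let ?g = "\<lambda>i. s z (if i = m then x else 0) + f i"
    have "is_dec (s z x + y) ?g"
      using m Mw_E by (intro is_dec_add is_dec_scale is_dec_single f(1)) auto
    moreover have "\<forall>i. ?g i \<in> Mw (int i)"
      using m f(2) F.subspace_0[OF Mw_subspace] by (auto intro!: F.subspace_add[OF Mw_subspace] F.subspace_scale[OF Mw_subspace])
    ultimately show ?case by blast
  qed
qed

definition cmp :: "nat \<Rightarrow> 'f \<Rightarrow> 'f" where "cmp m u = (SOME f. is_dec (pr u) f) m"

lemma cmp_dec: "is_dec (pr u) (\<lambda>m. cmp m u)"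
  unfolding cmp_def using dec_Mw[of u] someI_ex[of "\<lambda>f. is_dec (pr u) f"] by auto

lemma cmp_eqI: "is_dec (pr u) f \<Longrightarrow> cmp m u = f m"
  using is_dec_unique[OF cmp_dec] by metis

lemma cmp_Mw: "cmp m u \<in> Mw (int m)"
  using dec_Mw[of u] cmp_eqI by metis

lemma E_pr: "u \<in> E m \<Longrightarrow> pr u = u" by (simp add: E_def)

lemma E_nat_eq_Mw: "E (int m) = Mw (int m)"
proof
  show "E (int m) \<subseteq> Mw (int m)"
  proof
    fix u assume u: "u \<in> E (int m)"
    then have "cmp m u = u" using cmp_eqI[of u _ m] is_dec_single[OF u] by (simp add: E_pr)
    then show "u \<in> Mw (int m)" using cmp_Mw[of m u] by simp
  qed
qed (rule Mw_E)

text \<open>A vector of negative weight also has a decomposition into vectors of nonnegative weight,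
  and eigenvectors for different eigenvalues are independent.\<close>

lemma E_neg: assumes "n < 0" "u \<in> E n" shows "u = 0"
proof -
  let ?f = "\<lambda>m. cmp m u" let ?S = "{m. ?f m \<noteq> 0}"
  have d: "is_dec u ?f" using cmp_dec[of u] E_pr[OF assms(2)] by simp
  let ?a = "\<lambda>k. if k = n then - u else ?f (nat k)"
  have n: "n \<notin> int ` ?S" using assms(1) by auto
  have fin: "finite (insert n (int ` ?S))" using d by (simp add: is_dec_def)
  have "sum ?a (int ` ?S) = (\<Sum>k\<in>int ` ?S. ?f (nat k))"
    using n by (intro sum.cong) auto
  then have "sum ?a (insert n (int ` ?S)) = - u + (\<Sum>k\<in>int ` ?S. ?f (nat k))"
    using fin n by (subst sum.insert) simp_all
  also have "(\<Sum>k\<in>int ` ?S. ?f (nat k)) = u"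
    using d by (subst sum.reindex) (auto simp: is_dec_def)
  finally have sum: "sum ?a (insert n (int ` ?S)) \<in> {0}" by simp
  have E: "?a k \<in> E k" if "k \<in> insert n (int ` ?S)" for k
    using that d assms(2) F.subspace_neg[OF E_subspace] by (auto simp: is_dec_def)
  have U: "F.subspace {0}" "\<And>u. u \<in> {0} \<Longrightarrow> L0 u \<in> {0}"
    using L0_scale[of 0 0] by (auto simp: F.subspace_def)
  have "?a n \<in> {0}" by (rule L0_eigen_independent[OF U fin E sum]) auto
  then show ?thesis by simp
qed

lemma E_eq_Mw: "E n = Mw n"
proof (cases "n \<ge> 0")
  case True then show ?thesis using E_nat_eq_Mw[of "nat n"] by simp
next
  case False
  then have "E n \<subseteq> {0}" using E_neg[of n] by auto
  then show ?thesis using Mw_E[of n] F.subspace_0[OF Mw_subspace, of n] by auto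
qed

lemma hsum_cmp: "(\<Sum>m | cmp m u \<noteq> 0. cmp m u) = pr u"
  using cmp_dec[of u] by (simp add: is_dec_def)

sublocale G: graded_va s YY "\<lambda>m. E (int m)" T cmp one
proof
  fix a b :: 'f and m p :: nat and n :: int
  assume "a \<in> E (int m)" "b \<in> E (int p)" and ne: "YY a n b \<noteq> 0"
  then have e: "YY a n b \<in> E (int m + int p - n - 1)" by (intro E_YY)
  then have "int m + int p - n - 1 \<ge> 0" using E_neg ne by force
  then show "\<exists>q. YY a n b \<in> E (int q) \<and> int q = int m + int p - n - 1"
    using e by (intro exI[of _ "nat (int m + int p - n - 1)"]) simp
next
  fix a and m :: nat assume "a \<in> E (int m)"
  then show "T a \<in> E (int (Suc m))" using T_E[of a "int m"] by (simp add: add.commute)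
next
  fix m p :: nat and a assume a: "a \<in> E (int m)"
  show "cmp p a = (if p = m then a else 0)"
    using cmp_eqI[of a "\<lambda>i. if i = m then a else 0" p] is_dec_single[OF a] by (simp add: E_pr[OF a])
next
  fix m a b show "cmp m (a + b) = cmp m a + cmp m b"
    by (rule cmp_eqI) (auto simp: pr_add intro!: is_dec_add cmp_dec)
next
  fix m z a show "cmp m (s z a) = s z (cmp m a)"
    by (rule cmp_eqI) (auto simp: pr_scale intro!: is_dec_scale cmp_dec)
next
  fix m a show "cmp m a \<in> E (int m)" using cmp_dec[of a] by (simp add: is_dec_def)
next
  fix a show "finite {m. cmp m a \<noteq> 0}" using cmp_dec[of a] by (simp add: is_dec_def)
qed (use one_E in \<open>simp_all add: T_mode hsum_cmp YY_one\<close>)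

text \<open>The weight of \<open>w r\<close> is $r + 1$, so the function of the Zhu product is
  $(1+t)^{r+1} t^{-1}$.\<close>

lemma star_w: "odd r \<Longrightarrow> G.star (w r) x = rho (Lop r, 0) x"
  using G.star_hom[of "w r" "Suc r" x] w_E[of r] by (simp add: md_w Lop_def add.commute)

text \<open>An operator $W^p[(1+t)^{p+1} h]$ with \<open>h\<close> of degree at most $-2$ is a smeared mode of a
  state of weight $p + 1$ with values in $O$.\<close>

lemma rho_small_O:
  assumes "C \<in> dop.span {Wf p f | p f. odd p \<and> f \<in> small_coeffs p}"
  shows "C \<in> D_plus \<and> rho (C, 0) x \<in> G.O_sub"
  using assms
proof (induction rule: dop.span_induct_alt)
  case base then show ?case by (auto simp: rho_zero dop.subspace_0[OF D_plus_subspace])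
next
  case (step z A B)
  then obtain p f where p: "A = Wf p f" "odd p" "f \<in> small_coeffs p" by auto
  obtain h where h: "f = tshift ^ Suc p * h" "deg_le (-2) h" using small_coeffsE[OF p(3)] by blast
  have "w p \<in> E (int (Suc p))" using w_E[OF p(2)] by (simp add: add.commute)
  from G.md_O[OF this h(2), of x] have "rho (A, 0) x \<in> G.O_sub"
    using p by (simp add: md_w h)
  moreover have "A \<in> D_plus" using p by (simp add: Wf_in_D_plus)
  ultimately show ?case
    using step(2) D_plus_subspace by (auto simp: rho_add rho_scale dop.subspace_add dop.subspace_scale)
qed

text \<open>Expanding $(1+t)^{r+1}$ in $w_r[(1+t)^{r+1} t^{-1-k}] u$ expresses $w_r(-1-k) u$ by this
  vector and by modes $w_r(n) u$ with larger \<open>n\<close>. For $k > 0$ this vector is in $O$, and for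
  $k = 0$ it is the product $w_r * u$. Negative modes that remain are covered by induction on
  \<open>k\<close>, and nonnegative modes do not lengthen \<open>u\<close>.\<close>

lemma Fil_span:
  "Fil p \<subseteq> F.span ({foldr (\<lambda>i. G.star (w i)) is one | is. set is \<subseteq> {r. odd r}} \<union> G.O_sub)" (is "_ \<subseteq> ?H")
proof (induction p)
  case 0
  have "one \<in> ?H" by (intro F.span_base UnI1 CollectI exI[of _ "[]"]) simp
  then show ?case unfolding Fil.simps by (intro F.span_minimal F.subspace_span) simp
next
  case (Suc p)
  have O: "x \<in> ?H" if "x \<in> G.O_sub" for x using that by (intro F.span_base) simp
  have "YY (w r) (-1 - int k) u \<in> ?H" if r: "odd r" and u: "u \<in> Fil p" for r k u
  proof (induction k rule: less_induct)
    case (less k)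
    have wr: "w r \<in> E (int (Suc r))" using w_E[OF r] by (simp add: add.commute)
    let ?X = "VA.md (w r) (tshift ^ Suc r * tpow (-1 - int k)) u"
    have X: "?X \<in> ?H"
    proof (cases k)
      case 0
      have "G.star (w r) v \<in> ?H" if "v \<in> ?H" for v
        using that
      proof (induction rule: F.span_induct_alt)
        case base then show ?case by (simp add: F.span_zero)
      next
        case (step z x y)
        have "G.star (w r) x \<in> ?H"
        proof (cases "x \<in> G.O_sub")
          case True then show ?thesis using G.star_O_right O by blast
        next
          case False
          then obtain "is" where "x = foldr (\<lambda>i. G.star (w i)) is one" "set is \<subseteq> {r. odd r}" using step(1) by blast
          then show ?thesis using r by (intro F.span_base UnI1 CollectI exI[of _ "r # is"]) simp
        qed
        then show ?case using step(2) by (simp only: G.star_arg_add G.star_arg_scale F.span_add F.span_scale)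
      qed
      then show ?thesis using 0 u Suc by (auto simp: G.star_hom[OF wr, symmetric] simp del: power_Suc)
    next
      case (Suc k')
      then have e: "-1 - int k = -2 - int k'" by simp
      show ?thesis unfolding e by (rule O[OF G.md_O_tpow[OF wr]])
    qed
    have "?X = (\<Sum>j\<le>Suc r. s (of_nat (Suc r choose j)) (YY (w r) (-1 - int k + int j) u))"
      by (rule VA.md_tshift_tpow)
    also have "\<dots> = YY (w r) (-1 - int k) u + (\<Sum>j\<le>r. s (of_nat (Suc r choose Suc j)) (YY (w r) (-1 - int k + int (Suc j)) u))"
      by (subst sum.atMost_Suc_shift) simp
    finally have e: "YY (w r) (-1 - int k) u = ?X - (\<Sum>j\<le>r. s (of_nat (Suc r choose Suc j)) (YY (w r) (-1 - int k + int (Suc j)) u))"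
      by simp
    have "YY (w r) (-1 - int k + int (Suc j)) u \<in> ?H" for j
    proof (cases "j < k")
      case True
      then have "-1 - int k + int (Suc j) = -1 - int (k - Suc j)" by simp
      then show ?thesis using less.IH[of "k - Suc j"] True by simp
    next
      case False
      then show ?thesis using Fil_pos[OF r _ u, of "-1 - int k + int (Suc j)"] Suc by auto
    qed
    then show ?case unfolding e by (intro F.span_diff X F.span_sum F.span_scale)
  qed
  then show ?case using Suc unfolding Fil.simps by (intro F.span_minimal F.subspace_span) auto
qed

sublocale Z: zhu_generated s YY "\<lambda>m. E (int m)" T cmp one "{r. odd r}" w Suc
proof
  fix i j :: nat and x assume ij: "i \<in> {r. odd r}" "j \<in> {r. odd r}"
  let ?C = "dcomp (Lop i) (Lop j) - dcomp (Lop j) (Lop i)"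
  have m: "(Lop i, 0) \<in> D_plus_hat" "(Lop j, 0) \<in> D_plus_hat" using ij by (auto simp: Lop_def D_hat_mem Wf_in_D_plus)
  have "dhat_bracket (Lop i, 0) (Lop j, 0) = (?C, 0)"
    by (simp add: dhat_bracket_def dcocycle_degree_0[OF Lop_coef(1) Lop_coef(1)])
  then have "rho (Lop i, 0) (rho (Lop j, 0) x) - rho (Lop j, 0) (rho (Lop i, 0) x) = rho (?C, 0) x"
    using rho_bracket[OF m, of x] by simp
  moreover have "rho (?C, 0) x \<in> G.O_sub"
    using rho_small_O Lop_commutator ij by blast
  ultimately show "G.star (w i) (G.star (w j) x) - G.star (w j) (G.star (w i) x) \<in> G.O_sub"
    using ij by (simp add: star_w)
next
  fix i :: nat assume "i \<in> {r. odd r}"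
  then show "w i \<in> E (int (Suc i))" using w_E[of i] by (simp add: add.commute)
next
  fix a
  obtain p where "pr a \<in> Fil p" by (rule Fil_exhaust)
  then show "G.hsum a \<in> F.span ({foldr (\<lambda>i. G.star (w i)) is one | is. set is \<subseteq> {r. odd r}} \<union> G.O_sub)"
    using Fil_span[of p] by (auto simp: G.hsum_def hsum_cmp)
qed

end

section \<open>The maximal ideal\<close>

lemma lspan_subspace:
  fixes M :: "(complex, 'm, 'x) module_scheme" (structure)
  assumes M: "Module.module complex_ring M" and S: "S \<subseteq> carrier M" shows "subspace_of (lspan M S) M"
proof -
  interpret Module.module complex_ring M by (rule M)
  have c: "subspace_of (carrier M) M" by (intro submoduleI) auto
  let ?F = "{H. subspace_of H M \<and> S \<subseteq> H}"
  have E: "H \<in> ?F \<Longrightarrow> subspace_of H M" for H by simp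
  note E = submoduleE[OF E]
  have C: "carrier M \<in> ?F" using c S by simp
  have z: "\<zero> \<in> H" if "H \<in> ?F" for H
  proof -
    from E(2)[OF that] obtain x where "x \<in> H" by auto
    then show ?thesis using E(4)[OF that, of 0 x] E(1)[OF that] smult_l_null[of x] by auto
  qed
  show ?thesis
    unfolding lspan_def
  proof (rule submoduleI)
    show "\<Inter>?F \<subseteq> carrier M" using C by blast
    show "\<zero> \<in> \<Inter>?F" using z by blast
    show "\<And>a. a \<in> \<Inter>?F \<Longrightarrow> \<ominus> a \<in> \<Inter>?F" using E(3) by blast
    show "\<And>a b. a \<in> \<Inter>?F \<Longrightarrow> b \<in> \<Inter>?F \<Longrightarrow> a \<oplus> b \<in> \<Inter>?F" using E(5) by blast
    show "\<And>a x. a \<in> carrier complex_ring \<Longrightarrow> x \<in> \<Inter>?F \<Longrightarrow> a \<odot> x \<in> \<Inter>?F" using E(4) by blast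
  qed
qed

context verma_va
begin

text \<open>The copy of the maximal graded submodule. Since \<open>L0\<close> is a mode of a generator, it
  preserves this space, and with it the homogeneous components of its vectors lie in it.\<close>

definition maximal_ideal :: "'f set" where
  "maximal_ideal = F.span (em ` \<Union>{H. graded_submodule c H \<and> H \<noteq> carrier (M_space c)})"

interpretation MS: Module.module complex_ring "M_space c" unfolding M_space_def by (rule MQ.module_quot)

lemma graded_submodule_carrier: "graded_submodule c H \<Longrightarrow> H \<subseteq> carrier (M_space c)"
  using MS.submoduleE(1) by (auto simp: graded_submodule_def)

lemma maximal_submodule_iff: "x \<in> carrier (M_space c) \<Longrightarrow> x \<in> maximal_submodule c \<longleftrightarrow> em x \<in> maximal_ideal"
proof -
  assume x: "x \<in> carrier (M_space c)"
  have "maximal_submodule c = lspan (M_with c Y) (\<Union>{H. graded_submodule c H \<and> H \<noteq> carrier (M_space c)})"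
    by (simp add: maximal_submodule_def lspan_def subspace_of_M_with)
  then show ?thesis
    using mem_lspan_iff[of "\<Union>{H. graded_submodule c H \<and> H \<noteq> carrier (M_space c)}" x] x graded_submodule_carrier
    by (auto simp: maximal_ideal_def)
qed

lemma maximal_submodule_subspace: "subspace_of (maximal_submodule c) (M_with c Y)"
  unfolding subspace_of_M_with maximal_submodule_def
  using graded_submodule_carrier by (intro lspan_subspace MS.module_axioms) auto

lemma maximal_ideal_subspace: "F.subspace maximal_ideal" by (simp add: maximal_ideal_def F.subspace_span)

lemma maximal_ideal_pr: "u \<in> maximal_ideal \<Longrightarrow> pr u = u"
proof -
  have "maximal_ideal \<subseteq> {u. pr u = u}"
    unfolding maximal_ideal_def
    by (intro F.span_minimal pr_fix_subspace) (auto simp: pr_def dest: subsetD[OF graded_submodule_carrier])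
  then show "u \<in> maximal_ideal \<Longrightarrow> pr u = u" by auto
qed

lemma maximal_ideal_rho: assumes x: "x \<in> D_plus_hat" and u: "u \<in> maximal_ideal" shows "rho x u \<in> maximal_ideal"
  using u[unfolded maximal_ideal_def]
proof (induction rule: F.span_induct_alt)
  case base
  have "rho x 0 = 0" using rho_arg_scale[OF x, of 0 0] by simp
  then show ?case using F.subspace_0[OF maximal_ideal_subspace] by simp
next
  case (step z y v)
  then obtain H h where H: "graded_submodule c H" "H \<noteq> carrier (M_space c)" "h \<in> H" "y = em h" by auto
  then have "h \<in> carrier (M_space c)" using graded_submodule_carrier by blast
  then have "rho x y = em (M_action c x h)" using H by (simp add: rho_def)
  moreover have "M_action c x h \<in> H" using H x by (simp add: graded_submodule_def)
  ultimately have "rho x y \<in> maximal_ideal" unfolding maximal_ideal_def using H by (intro F.span_base) blast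
  then show ?case using step(2) maximal_ideal_subspace
    by (simp add: rho_arg_add[OF x] rho_arg_scale[OF x] F.subspace_add F.subspace_scale)
qed

lemma maximal_ideal_w: "odd r \<Longrightarrow> u \<in> maximal_ideal \<Longrightarrow> YY (w r) n u \<in> maximal_ideal"
  by (simp add: YY_w maximal_ideal_rho D_hat_mem Wf_in_D_plus)

lemma maximal_ideal_simps: "0 \<in> maximal_ideal" "u \<in> maximal_ideal \<Longrightarrow> v \<in> maximal_ideal \<Longrightarrow> u + v \<in> maximal_ideal" "u \<in> maximal_ideal \<Longrightarrow> v \<in> maximal_ideal \<Longrightarrow> u - v \<in> maximal_ideal"
  "u \<in> maximal_ideal \<Longrightarrow> s z u \<in> maximal_ideal" "(\<And>i. i \<in> S \<Longrightarrow> h i \<in> maximal_ideal) \<Longrightarrow> sum h S \<in> maximal_ideal"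
  using maximal_ideal_subspace by (simp_all add: F.subspace_0 F.subspace_add F.subspace_diff F.subspace_scale F.subspace_sum)

text \<open>By the iterate formula it suffices that the modes of the generators preserve the ideal,
  and these act through the Lie algebra.\<close>

lemma maximal_ideal_left: assumes u: "u \<in> maximal_ideal" shows "YY a n u \<in> maximal_ideal"
proof -
  have "pr a \<in> {a. \<forall>n. \<forall>u\<in>maximal_ideal. YY a n u \<in> maximal_ideal}"
  proof (rule generator_induct)
    show "F.subspace {a. \<forall>n. \<forall>u\<in>maximal_ideal. YY a n u \<in> maximal_ideal}"
      by (auto simp: F.subspace_def VA.act_add VA.act_scale maximal_ideal_simps)
    show "one \<in> {a. \<forall>n. \<forall>u\<in>maximal_ideal. YY a n u \<in> maximal_ideal}"
      by (auto simp: YY_one maximal_ideal_pr maximal_ideal_simps)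
    fix r :: nat and l a assume r: "odd r" and a: "a \<in> {a. \<forall>n. \<forall>u\<in>maximal_ideal. YY a n u \<in> maximal_ideal}"
    then have a': "\<And>n u. u \<in> maximal_ideal \<Longrightarrow> YY a n u \<in> maximal_ideal" by blast
    have "YY (YY (w r) l a) k u \<in> maximal_ideal" if u: "u \<in> maximal_ideal" for k u
    proof -
      obtain N where N: "YY (YY (w r) l a) k u = (\<Sum>j<N. s ((-1) ^ j * (of_int l gchoose j))
        (YY (w r) (l - int j) (YY a (k + int j) u) - s ((-1) powi l) (YY a (l + k - int j) (YY (w r) (int j) u))))"
        using eventually_happens'[OF sequentially_bot VA.iterate_formula[of "w r" l a k u]] by (elim exE)
      show ?thesis
        unfolding N by (intro maximal_ideal_simps(3,4,5) maximal_ideal_w[OF r] a' u)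
    qed
    then show "YY (w r) l a \<in> {a. \<forall>n. \<forall>u\<in>maximal_ideal. YY a n u \<in> maximal_ideal}" by auto
  qed
  then have "YY (pr a) n u \<in> maximal_ideal" using u by blast
  then show ?thesis by simp
qed

lemma maximal_ideal_T: "u \<in> maximal_ideal \<Longrightarrow> T u \<in> maximal_ideal"
  using maximal_ideal_w[of 1 u 0] by (simp add: D_eq_T[symmetric] D_def)

lemma maximal_ideal_L0: "u \<in> maximal_ideal \<Longrightarrow> L0 u \<in> maximal_ideal"
  using maximal_ideal_w[of 1 u 1] by (simp add: L0_def)

text \<open>The state $x(-1-k)1$ is $T^k x / k!$, and \<open>T\<close> preserves the ideal as a mode of a
  generator.\<close>

lemma maximal_ideal_right_one: "x \<in> maximal_ideal \<Longrightarrow> YY x n one \<in> maximal_ideal"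
proof -
  have neg: "YY x (-1 - int k) one \<in> maximal_ideal" if "x \<in> maximal_ideal" for k x
    using that
  proof (induction k arbitrary: x)
    case 0 then show ?case by (simp add: YY_one_right maximal_ideal_pr)
  next
    case (Suc k)
    have "YY (T x) (-1 - int k) one \<in> maximal_ideal" by (intro Suc.IH maximal_ideal_T Suc.prems)
    moreover have "YY (T x) (-1 - int k) one = s (of_nat (Suc k)) (YY x (-1 - int (Suc k)) one)"
    proof -
      have e: "-1 - int k - 1 = -1 - int (Suc k)" "- of_int (-1 - int k) = (of_nat (Suc k) :: complex)" by simp_all
      show ?thesis by (simp only: T_mode e)
    qed
    ultimately have "s (of_nat (Suc k)) (YY x (-1 - int (Suc k)) one) \<in> maximal_ideal" by (simp only:)
    then have "s (1 / of_nat (Suc k)) (s (of_nat (Suc k)) (YY x (-1 - int (Suc k)) one)) \<in> maximal_ideal"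
      by (rule maximal_ideal_simps(4))
    then show ?case by (simp del: of_nat_Suc)
  qed
  show "YY x n one \<in> maximal_ideal" if x: "x \<in> maximal_ideal"
  proof (cases "n \<ge> 0")
    case True then show ?thesis by (simp add: YY_one_right maximal_ideal_simps)
  next
    case False
    then have "n = -1 - int (nat (-1 - n))" by simp
    then show ?thesis using neg[OF x] by metis
  qed
qed

text \<open>By the commutator formula $x(n) w_r(l) b$ differs from $w_r(l) x(n) b$ by modes of the
  states $w_r(j) x$ of the ideal applied to \<open>b\<close>, so the claim spreads from the vacuum to all
  states \<open>b\<close>.\<close>

lemma maximal_ideal_right: assumes x: "x \<in> maximal_ideal" shows "YY x n b \<in> maximal_ideal"
proof -
  have "pr b \<in> {b. \<forall>n. \<forall>x\<in>maximal_ideal. YY x n b \<in> maximal_ideal}"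
  proof (rule generator_induct)
    show "F.subspace {b. \<forall>n. \<forall>x\<in>maximal_ideal. YY x n b \<in> maximal_ideal}"
      by (auto simp: F.subspace_def VA.act_arg_add VA.act_arg_scale maximal_ideal_simps)
    show "one \<in> {b. \<forall>n. \<forall>x\<in>maximal_ideal. YY x n b \<in> maximal_ideal}" by (auto intro: maximal_ideal_right_one)
    fix r :: nat and l b assume r: "odd r" and b: "b \<in> {b. \<forall>n. \<forall>x\<in>maximal_ideal. YY x n b \<in> maximal_ideal}"
    have "YY x n (YY (w r) l b) \<in> maximal_ideal" if x: "x \<in> maximal_ideal" for n x
    proof -
      obtain N where N: "(\<Sum>j<N. s (of_int l gchoose j) (YY (YY (w r) (int j) x) (l + n - int j) b)) =
          YY (w r) l (YY x n b) - YY x n (YY (w r) l b)"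
        using eventually_happens'[OF sequentially_bot VA.commutator_formula[of l "w r" x n b]] by (elim exE)
      have "YY x n (YY (w r) l b) = YY (w r) l (YY x n b) -
          (\<Sum>j<N. s (of_int l gchoose j) (YY (YY (w r) (int j) x) (l + n - int j) b))"
        unfolding N by simp
      also have "\<dots> \<in> maximal_ideal" using b x maximal_ideal_w[OF r] by (intro maximal_ideal_simps(3,4,5)) auto
      finally show ?thesis .
    qed
    then show "YY (w r) l b \<in> {b. \<forall>n. \<forall>x\<in>maximal_ideal. YY x n b \<in> maximal_ideal}" by auto
  qed
  then have "YY x n (pr b) \<in> maximal_ideal" using x by blast
  then show ?thesis by simp
qed

section \<open>The simple quotient\<close>

interpretation VQ: quotient_module "M_with c Y" "maximal_submodule c"
  by (intro quotient_module.intro quotient_module_axioms.intro maximal_submodule_subspace) (rule Q.module_axioms)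

abbreviation V where "V \<equiv> V_simple c Y"
text \<open>\<open>th'\<close> is the quotient map from the type onto $\mathcal V_c$. All structure on
  $\mathcal V_c$ is computed on representatives in the type.\<close>

definition q :: "M_elem \<Rightarrow> M_elem set" where "q x = maximal_submodule c +>\<^bsub>M_with c Y\<^esub> x"
definition th' :: "'f \<Rightarrow> M_elem set" where "th' u = q (th u)"

lemma q_eq_iff: "x \<in> carrier (M_space c) \<Longrightarrow> y \<in> carrier (M_space c) \<Longrightarrow> q x = q y \<longleftrightarrow> em x - em y \<in> maximal_ideal"
proof -
  assume a: "x \<in> carrier (M_space c)" "y \<in> carrier (M_space c)"
  then have m: "x \<ominus>\<^bsub>M_with c Y\<^esub> y \<in> carrier (M_space c)" using Q.minus_closed[of x y] by simp
  have "q x = q y \<longleftrightarrow> x \<ominus>\<^bsub>M_with c Y\<^esub> y \<in> maximal_submodule c"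
    using a VQ.coset_eq_iff[of x y] by (simp add: q_def)
  also have "\<dots> \<longleftrightarrow> em (x \<ominus>\<^bsub>M_with c Y\<^esub> y) \<in> maximal_ideal" by (rule maximal_submodule_iff[OF m])
  also have "em (x \<ominus>\<^bsub>M_with c Y\<^esub> y) = em x - em y" using a em_minus by simp
  finally show ?thesis .
qed

lemma th'_eq_iff: "th' u = th' v \<longleftrightarrow> pr u - pr v \<in> maximal_ideal"
  by (simp add: th'_def q_eq_iff pr_def)

lemma th'_eqI: "u - v \<in> maximal_ideal \<Longrightarrow> th' u = th' v"
proof -
  assume "u - v \<in> maximal_ideal"
  then have "pr (u - v) = u - v" "u - v \<in> maximal_ideal" by (auto simp: maximal_ideal_pr)
  moreover have "pr (u - v) = pr u - pr v" using pr_add[of "u - v" v] by (simp add: eq_diff_eq)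
  ultimately show ?thesis by (simp add: th'_eq_iff)
qed

lemma carrier_V: "carrier V = range th'"
proof -
  have "carrier V = q ` carrier (M_space c)"
    using VQ.carrier_quot by (simp add: V_simple_def q_def)
  also have "\<dots> = range th'"
  proof
    show "q ` carrier (M_space c) \<subseteq> range th'"
    proof
      fix X assume "X \<in> q ` carrier (M_space c)"
      then obtain x where "x \<in> carrier (M_space c)" "X = q x" by auto
      then have "X = th' (em x)" by (simp add: th'_def)
      then show "X \<in> range th'" by simp
    qed
  qed (auto simp: th'_def)
  finally show ?thesis .
qed

lemma module_V: "Module.module complex_ring V"
  by (rule module_record_cong[OF VQ.module_quot]) (simp_all add: V_simple_def)

sublocale V: linear_into s V th'
proof (intro linear_into.intro linear_into_axioms.intro module_V)
  show "vector_space s" by (rule F.vector_space_axioms)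
  fix u v z
  show "th' u \<in> carrier V" by (simp add: carrier_V)
  show "th' (u + v) = th' u \<oplus>\<^bsub>V\<^esub> th' v"
    using VQ.quot_add[of "th u" "th v"] th_add[of u v] by (simp add: V_simple_def th'_def q_def)
  show "th' (s z u) = z \<odot>\<^bsub>V\<^esub> th' u"
    using VQ.quot_smult[of "th u" z] th_scale[of z u] by (simp add: V_simple_def th'_def q_def)
qed

lemma nprod_V: "nprod V (th' a) n (th' b) = th' (YY a n b)"
proof -
  let ?W = "M_with c Y" and ?I = "maximal_submodule c"
  have "nprod V (th' a) n (th' b) = (\<Union>x\<in>?I +>\<^bsub>?W\<^esub> th a. \<Union>y\<in>?I +>\<^bsub>?W\<^esub> th b. ?I +>\<^bsub>?W\<^esub> Y x n y)"
    by (simp add: V_simple_def th'_def q_def)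
  also have "\<dots> = q (Y (th a) n (th b))"
  proof (rule VQ.UN_coset)
    fix x assume x: "x \<in> carrier ?W" "?I +>\<^bsub>?W\<^esub> x = ?I +>\<^bsub>?W\<^esub> th a"
    show "(\<Union>y\<in>?I +>\<^bsub>?W\<^esub> th b. ?I +>\<^bsub>?W\<^esub> Y x n y) = q (Y (th a) n (th b))"
    proof (rule VQ.UN_coset)
      fix y assume y: "y \<in> carrier ?W" "?I +>\<^bsub>?W\<^esub> y = ?I +>\<^bsub>?W\<^esub> th b"
      have xy: "x \<in> carrier (M_space c)" "y \<in> carrier (M_space c)" using x y by auto
      have "em x - pr a \<in> maximal_ideal" "em y - pr b \<in> maximal_ideal"
        using x(2) y(2) q_eq_iff[OF xy(1), of "th a"] q_eq_iff[OF xy(2), of "th b"] by (simp_all add: q_def pr_def)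
      then have "YY (em x - pr a) n (em y) + YY (pr a) n (em y - pr b) \<in> maximal_ideal"
        by (intro maximal_ideal_simps(2) maximal_ideal_right maximal_ideal_left)
      moreover have "YY (em x - pr a) n (em y) + YY (pr a) n (em y - pr b) = YY (em x) n (em y) - YY (pr a) n (pr b)"
        using VA.act_add[of "em x - pr a" "pr a" n "em y"] by (simp add: YY_diff del: YY_pr)
      ultimately have "YY (em x) n (em y) - YY a n b \<in> maximal_ideal" by simp
      then show "?I +>\<^bsub>?W\<^esub> Y x n y = q (Y (th a) n (th b))"
        using xy q_eq_iff[of "Y x n y" "Y (th a) n (th b)"] by (simp add: q_def Y_closed YY_def)
    qed simp
  qed simp
  also have "\<dots> = th' (YY a n b)" by (simp add: th'_def th_YY)
  finally show ?thesis .
qed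

lemma wt_V: "wt V n = th' ` E n"
proof -
  have "wt V n = q ` M_weight c n" by (simp add: V_simple_def q_def)
  also have "\<dots> = th' ` E n"
  proof
    show "q ` M_weight c n \<subseteq> th' ` E n"
    proof
      fix X assume "X \<in> q ` M_weight c n"
      then obtain x where x: "x \<in> M_weight c n" "X = q x" by auto
      then have xc: "x \<in> carrier (M_space c)" by (intro M_weight_carrier)
      then have "em x \<in> E n" "X = th' (em x)" using x M_weight_iff[OF xc] by (simp_all add: E_eq_Mw th'_def)
      then show "X \<in> th' ` E n" by blast
    qed
    show "th' ` E n \<subseteq> q ` M_weight c n"
    proof
      fix X assume "X \<in> th' ` E n"
      then obtain u where u: "u \<in> E n" "X = th' u" by auto
      then have "em (th u) \<in> Mw n" using E_pr[of u n] by (simp add: E_eq_Mw pr_def)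
      then have "th u \<in> M_weight c n" by (simp add: M_weight_iff)
      then show "X \<in> q ` M_weight c n" using u by (simp add: th'_def)
    qed
  qed
  finally show ?thesis .
qed

text \<open>Weights are natural numbers in \<open>cmp\<close> and integers in the grading of the quotient.\<close>

definition cmp_int :: "int \<Rightarrow> 'f \<Rightarrow> 'f" where
  "cmp_int m a = (if m \<ge> 0 then cmp (nat m) a else 0)"

lemma cmp_int_E: "cmp_int m a \<in> E m"
proof (cases "m \<ge> 0")
  case True
  then show ?thesis using cmp_dec[of a] by (auto simp: cmp_int_def is_dec_def dest: spec[of _ "nat m"])
qed (simp add: cmp_int_def F.subspace_0[OF E_subspace])

lemma cmp_int_supp: "finite (int ` {m. cmp m a \<noteq> 0})" "m \<notin> int ` {m. cmp m a \<noteq> 0} \<Longrightarrow> cmp_int m a = 0"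
proof -
  show "finite (int ` {m. cmp m a \<noteq> 0})" using cmp_dec[of a] by (simp add: is_dec_def)
  assume m: "m \<notin> int ` {m. cmp m a \<noteq> 0}"
  show "cmp_int m a = 0"
  proof (cases "m \<ge> 0")
    case True
    then have "m = int (nat m)" by simp
    then have "cmp (nat m) a = 0" using m by blast
    then show ?thesis by (simp add: cmp_int_def)
  qed (simp add: cmp_int_def)
qed

lemma sum_cmp_int: "finite S \<Longrightarrow> int ` {m. cmp m a \<noteq> 0} \<subseteq> S \<Longrightarrow> (\<Sum>m\<in>S. cmp_int m a) = pr a"
proof -
  assume S: "finite S" "int ` {m. cmp m a \<noteq> 0} \<subseteq> S"
  have "(\<Sum>m\<in>S. cmp_int m a) = (\<Sum>m\<in>int ` {m. cmp m a \<noteq> 0}. cmp_int m a)"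
    using S cmp_int_supp(2)[where a = a] by (intro sum.mono_neutral_right) auto
  also have "\<dots> = (\<Sum>m | cmp m a \<noteq> 0. cmp m a)"
    by (subst sum.reindex) (auto simp: cmp_int_def)
  finally show ?thesis by (simp add: hsum_cmp)
qed

lemma th'_pr: "th' (pr u) = th' u" by (simp add: th'_eq_iff maximal_ideal_simps)

text \<open>The components in the quotient are determined, because a sum of homogeneous vectors that
  lies in the ideal has all its summands there: the ideal is invariant under \<open>L0\<close>.\<close>

lemma component_V: "component V (wt V) (th' a) = (\<lambda>m. th' (cmp_int m a))"
  unfolding component_def
proof (rule the_equality)
  let ?S = "int ` {m. cmp m a \<noteq> 0}"
  have "fin_sum V (\<lambda>m. th' (cmp_int m a)) = th' (\<Sum>m\<in>?S. cmp_int m a)"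
    using cmp_int_supp(1)[of a] cmp_int_supp(2)[where a = a] by (intro V.fin_sum_th) auto
  also have "\<dots> = th' a" using sum_cmp_int[of ?S a] cmp_int_supp(1)[of a] by (simp add: th'_pr)
  finally have "fin_sum V (\<lambda>m. th' (cmp_int m a)) = th' a" .
  moreover have "{m. th' (cmp_int m a) \<noteq> \<zero>\<^bsub>V\<^esub>} \<subseteq> ?S" using cmp_int_supp(2)[where a = a] by auto
  then have "finite {m. th' (cmp_int m a) \<noteq> \<zero>\<^bsub>V\<^esub>}" using cmp_int_supp(1) finite_subset by blast
  ultimately show "decomposes V (wt V) (th' a) (\<lambda>m. th' (cmp_int m a))"
    by (auto simp: decomposes_def wt_V cmp_int_E)
next
  fix f assume f: "decomposes V (wt V) (th' a) f"
  \<comment> \<open>The value \<open>0\<close> where \<open>f\<close> vanishes keeps the support of \<open>b\<close> finite.\<close>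
  define b where "b m = (if f m = \<zero>\<^bsub>V\<^esub> then 0 else (SOME u. u \<in> E m \<and> f m = th' u))" for m
  have b: "b m \<in> E m \<and> f m = th' (b m)" for m
  proof (cases "f m = \<zero>\<^bsub>V\<^esub>")
    case True then show ?thesis by (simp add: b_def F.subspace_0[OF E_subspace])
  next
    case False
    have "f m \<in> th' ` E m" using f by (simp add: decomposes_def wt_V)
    then have "\<exists>u. u \<in> E m \<and> f m = th' u" by auto
    from someI_ex[OF this] show ?thesis using False by (simp add: b_def)
  qed
  let ?S0 = "{m. f m \<noteq> \<zero>\<^bsub>V\<^esub>}" and ?S1 = "int ` {m. cmp m a \<noteq> 0}"
  have S0: "finite ?S0" using f by (simp add: decomposes_def)
  have b0: "b m = 0" if "m \<notin> ?S0" for m using that by (simp add: b_def)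
  have S: "finite (?S0 \<union> ?S1)" using S0 cmp_int_supp(1)[of a] by simp
  have "f = (\<lambda>m. th' (b m))" using b by auto
  then have "th' a = fin_sum V (\<lambda>m. th' (b m))" using f by (simp add: decomposes_def)
  also have "\<dots> = th' (\<Sum>m\<in>?S0 \<union> ?S1. b m)" using b0 by (intro V.fin_sum_th S) auto
  finally have "th' (\<Sum>m\<in>?S0 \<union> ?S1. b m) = th' a" ..
  moreover have "pr (\<Sum>m\<in>?S0 \<union> ?S1. b m) = (\<Sum>m\<in>?S0 \<union> ?S1. b m)"
    unfolding pr_sum using b E_pr by (intro sum.cong) auto
  ultimately have "(\<Sum>m\<in>?S0 \<union> ?S1. b m) - (\<Sum>m\<in>?S0 \<union> ?S1. cmp_int m a) \<in> maximal_ideal"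
    using sum_cmp_int[OF S, of a] by (simp add: th'_eq_iff)
  then have sum: "(\<Sum>m\<in>?S0 \<union> ?S1. b m - cmp_int m a) \<in> maximal_ideal" by (simp add: sum_subtractf)
  have E: "b m - cmp_int m a \<in> E m" for m using b cmp_int_E F.subspace_diff[OF E_subspace] by blast
  have "b m - cmp_int m a \<in> maximal_ideal" for m
  proof (cases "m \<in> ?S0 \<union> ?S1")
    case True
    show ?thesis using L0_eigen_independent[OF maximal_ideal_subspace maximal_ideal_L0 S E sum True] .
  next
    case False then show ?thesis using b0 cmp_int_supp(2)[where m = m and a = a] by (simp add: maximal_ideal_simps)
  qed
  then have "th' (b m) = th' (cmp_int m a)" for m by (rule th'_eqI)
  then show "f = (\<lambda>m. th' (cmp_int m a))" using b by auto
qed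

lemma zhu_res_V: "zhu_res V (int m) p (th' a) (th' b) = th' (VA.md a (tshift ^ m * tpow (- p)) b)"
proof -
  have "zhu_res V (int m) p (th' a) (th' b) = fin_sum V (\<lambda>j::nat. th' (s (of_nat (m choose j)) (YY a (- p + int j) b)))"
    by (simp add: zhu_res_def nprod_V V.th_scale binomial_gbinomial)
  also have "\<dots> = th' (\<Sum>j\<le>m. s (of_nat (m choose j)) (YY a (- p + int j) b))"
    by (intro V.fin_sum_th) (auto simp: binomial_eq_0)
  finally show ?thesis by (simp add: VA.md_tshift_tpow)
qed

lemma zhu_res_V_0: "zhu_res V m p (th' 0) (th' b) = th' 0"
proof -
  have "zhu_res V m p (th' 0) (th' b) = fin_sum V (\<lambda>j::nat. th' (s (of_int m gchoose j) (YY 0 (int j - p) b)))"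
    unfolding zhu_res_def nprod_V V.th_scale ..
  also have "\<dots> = th' (\<Sum>j\<in>{}. s (of_int m gchoose j) (YY 0 (int j - p) b))"
    by (intro V.fin_sum_th) auto
  finally show ?thesis by simp
qed

lemma zhu_star_V: "zhu_star V (th' a) (th' b) = th' (G.star a b)"
proof -
  let ?h = "\<lambda>m. if m \<ge> 0 then VA.md (cmp (nat m) a) (tshift ^ nat m * tpow (-1)) b else 0"
  let ?S = "int ` {m. cmp m a \<noteq> 0}"
  have "zhu_res V m 1 (th' (cmp_int m a)) (th' b) = th' (?h m)" for m
  proof (cases "m \<ge> 0")
    case True
    then show ?thesis using zhu_res_V[of "nat m" 1 "cmp (nat m) a" b] by (simp add: cmp_int_def)
  next
    case False then show ?thesis using zhu_res_V_0[of m 1 b] by (simp add: cmp_int_def del: V.th_0)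
  qed
  then have "zhu_star V (th' a) (th' b) = fin_sum V (\<lambda>m. th' (?h m))"
    by (simp add: zhu_star_def component_V)
  also have "\<dots> = th' (\<Sum>m\<in>?S. ?h m)"
  proof (rule V.fin_sum_th[OF cmp_int_supp(1)])
    fix m assume "m \<notin> ?S"
    from cmp_int_supp(2)[OF this] show "th' (?h m) = \<zero>\<^bsub>V\<^esub>" by (auto simp: cmp_int_def)
  qed
  also have "(\<Sum>m\<in>?S. ?h m) = G.star a b"
    unfolding G.star_def by (subst sum.reindex) auto
  finally show ?thesis .
qed

lemma zhu_gens_carrier: "{zhu_res V m 2 a b | m a b. a \<in> wt V m \<and> b \<in> carrier V} \<subseteq> carrier V"
proof -
  have "zhu_res V m 2 (th' a) (th' b) \<in> carrier V" if "a \<in> E m" for m a b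
  proof (cases "m \<ge> 0")
    case True then show ?thesis using zhu_res_V[of "nat m" 2 a b] by simp
  next
    case False
    then have "a = 0" using E_neg[OF _ that] by simp
    then show ?thesis using zhu_res_V_0[of m 2 b] by (metis V.th_closed)
  qed
  then show ?thesis by (auto simp: wt_V carrier_V)
qed

lemma zhu_O_subspace: "subspace_of (zhu_O V) V"
  unfolding zhu_O_def by (rule lspan_subspace[OF module_V zhu_gens_carrier])

lemma th'_O: "u \<in> G.O_sub \<Longrightarrow> th' u \<in> zhu_O V"
  unfolding zhu_O_def G.O_sub_def
proof (erule V.span_th_in_lspan)
  show "th' ` {VA.md a (tshift ^ m * tpow (-2)) b | a m b. a \<in> E (int m)} \<subseteq>
    {zhu_res V m 2 a b | m a b. a \<in> wt V m \<and> b \<in> carrier V}"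
  proof clarify
    fix a m b assume a: "a \<in> E (int m)"
    show "\<exists>m' a' b'. th' (VA.md a (tshift ^ m * tpow (-2)) b) = zhu_res V m' 2 a' b' \<and> a' \<in> wt V m' \<and> b' \<in> carrier V"
      using a by (intro exI[of _ "int m"] exI[of _ "th' a"] exI[of _ "th' b"]) (simp add: zhu_res_V wt_V)
  qed
qed

text \<open>The product and the subspace of $\mathcal V_c$ are the images of those of
  $\mathcal M_c^+$, so commutativity modulo \<open>O_sub\<close> passes to the quotient.\<close>

theorem zhu_algebra_commutative:
  assumes "X \<in> carrier (zhu_algebra V)" "X' \<in> carrier (zhu_algebra V)"
  shows "X \<otimes>\<^bsub>zhu_algebra V\<^esub> X' = X' \<otimes>\<^bsub>zhu_algebra V\<^esub> X"
proof -
  interpret A: quotient_module V "zhu_O V"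
    by (intro quotient_module.intro quotient_module_axioms.intro module_V zhu_O_subspace)
  have sub: "X \<subseteq> carrier V" if "X \<in> carrier (zhu_algebra V)" for X
  proof -
    have "X \<in> carrier (quot_space V (zhu_O V))" using that by (simp add: zhu_algebra_def)
    then show ?thesis unfolding A.carrier_quot using A.coset_mem by blast
  qed
  have comm: "zhu_O V +>\<^bsub>V\<^esub> zhu_star V a b = zhu_O V +>\<^bsub>V\<^esub> zhu_star V b a" if "a \<in> carrier V" "b \<in> carrier V" for a b
  proof -
    obtain u v where uv: "a = th' u" "b = th' v" using \<open>a \<in> carrier V\<close> \<open>b \<in> carrier V\<close> by (auto simp: carrier_V)
    have "th' (G.star u v) \<ominus>\<^bsub>V\<^esub> th' (G.star v u) \<in> zhu_O V"
      using th'_O[OF Z.star_comm] by (simp add: V.th_diff)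
    then show ?thesis unfolding uv zhu_star_V by (subst A.coset_eq_iff) auto
  qed
  have "X \<otimes>\<^bsub>zhu_algebra V\<^esub> X' = (\<Union>a\<in>X. \<Union>b\<in>X'. zhu_O V +>\<^bsub>V\<^esub> zhu_star V a b)"
    by (simp add: zhu_algebra_def)
  also have "\<dots> = (\<Union>a\<in>X. \<Union>b\<in>X'. zhu_O V +>\<^bsub>V\<^esub> zhu_star V b a)"
    using sub[OF assms(1)] sub[OF assms(2)] by (intro SUP_cong refl comm) auto
  also have "\<dots> = (\<Union>b\<in>X'. \<Union>a\<in>X. zhu_O V +>\<^bsub>V\<^esub> zhu_star V b a)" by blast
  also have "\<dots> = X' \<otimes>\<^bsub>zhu_algebra V\<^esub> X" by (simp add: zhu_algebra_def)
  finally show ?thesis .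
qed

end

section \<open>Commuting operators with countably many generators\<close>

lemma (in vector_space) span_range_finite:
  fixes f :: "nat \<Rightarrow> 'b"
  assumes "x \<in> span (range f)" shows "\<exists>n. x \<in> span (f ` {..<n})"
  using assms
proof (induction rule: span_induct_alt)
  case base
  have "0 \<in> span (f ` {..<0})" by (rule span_zero)
  then show ?case by blast
next
  case (step c x y)
  then obtain i n where i: "x = f i" and n: "y \<in> span (f ` {..<n})" by auto
  have "x \<in> span (f ` {..<max n (Suc i)})" using i by (intro span_base) auto
  moreover have "f ` {..<n} \<subseteq> f ` {..<max n (Suc i)}" by auto
  then have "y \<in> span (f ` {..<max n (Suc i)})" using span_mono n by blast
  ultimately have "scale c x + y \<in> span (f ` {..<max n (Suc i)})" by (intro span_add span_scale)
  then show ?case by blast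
qed

text \<open>A space on which commuting operators act irreducibly. Countability of the index set bounds
  the dimension, and this replaces finite dimension in Schur's lemma.\<close>

locale commuting_operators = complex_vector_space s
  for s :: "complex \<Rightarrow> 'm::ab_group_add \<Rightarrow> 'm" +
  fixes M0 :: "'m set" and J :: "nat set" and X :: "nat \<Rightarrow> 'm \<Rightarrow> 'm"
  assumes M0: "subspace M0"
    and X_add: "X j (u + v) = X j u + X j v" and X_scale: "X j (s z u) = s z (X j u)"
    and X_mem: "j \<in> J \<Longrightarrow> u \<in> M0 \<Longrightarrow> X j u \<in> M0"
    and X_comm: "i \<in> J \<Longrightarrow> j \<in> J \<Longrightarrow> u \<in> M0 \<Longrightarrow> X i (X j u) = X j (X i u)"
    and cyclic: "v \<in> M0 \<Longrightarrow> v \<noteq> 0 \<Longrightarrow> M0 \<subseteq> span {foldr X is v | is. set is \<subseteq> J}"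
begin

lemma X_0 [simp]: "X j 0 = 0" using X_scale[of j 0 0] by simp
lemma X_diff: "X j (u - v) = X j u - X j v" using X_add[of j "u - v" v] by (simp add: eq_diff_eq)

lemma words_mem: "set is \<subseteq> J \<Longrightarrow> v \<in> M0 \<Longrightarrow> foldr X is v \<in> M0"
  by (induction "is") (auto intro: X_mem)
lemma words_diff: "foldr X is (u - v) = foldr X is u - foldr X is v"
  by (induction "is") (auto simp: X_diff)
lemma words_scale: "foldr X is (s z u) = s z (foldr X is u)"
  by (induction "is") (auto simp: X_scale)
lemma words_comm: "j \<in> J \<Longrightarrow> set is \<subseteq> J \<Longrightarrow> u \<in> M0 \<Longrightarrow> foldr X is (X j u) = X j (foldr X is u)"
  by (induction "is") (auto simp: X_comm words_mem)

text \<open>The polynomial \<open>p\<close> in the operator \<open>X j\<close>, by the Horner scheme.\<close>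

definition poly_op :: "nat \<Rightarrow> complex poly \<Rightarrow> 'm \<Rightarrow> 'm" where
  "poly_op j p u = fold_coeffs (\<lambda>a x. s a u + X j x) p 0"

lemma poly_op_0 [simp]: "poly_op j 0 u = 0" by (simp add: poly_op_def)
lemma poly_op_pCons [simp]: "poly_op j (pCons a p) u = s a u + X j (poly_op j p u)"
  by (cases "p = 0 \<and> a = 0") (auto simp: poly_op_def)
lemma poly_op_add: "poly_op j (p + q) u = poly_op j p u + poly_op j q u"
proof (induction p arbitrary: q)
  case (pCons a p)
  obtain b q' where "q = pCons b q'" by (cases q) auto
  then show ?case by (simp only: add_pCons poly_op_pCons pCons.IH scale_left_distrib X_add add_ac)
qed simp
lemma poly_op_smult: "poly_op j (smult z p) u = s z (poly_op j p u)"
  by (induction p) (simp_all add: X_scale scale_right_distrib)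
lemma poly_op_root: "poly_op j ([:- a, 1:] * q) u = X j (poly_op j q u) - s a (poly_op j q u)"
proof -
  have "[:- a, 1:] * q = smult (- a) q + pCons 0 q" by (simp add: mult_pCons_left)
  then show ?thesis by (simp add: poly_op_add poly_op_smult del: smult_minus_left)
qed
lemma poly_op_mem: "j \<in> J \<Longrightarrow> u \<in> M0 \<Longrightarrow> poly_op j p u \<in> M0"
  by (induction p) (auto intro!: subspace_add[OF M0] subspace_scale[OF M0] X_mem simp: subspace_0[OF M0])

text \<open>Suppose that $X = X_j$ has no eigenvector. Then every $X - \lambda$ is injective, and it
  is surjective since its image contains the words applied to $(X - \lambda) v \ne 0$, which
  span. The vectors $u_\lambda = (X - \lambda)^{-1} v$ are independent, even together with all
  $p(X) v$: this is partial fraction decomposition, and $p(X) v \ne 0$ for $p \ne 0$ because \<open>p\<close>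
  splits into linear factors. So there are uncountably many independent vectors in a space of
  countable dimension.\<close>

lemma eigenvector_exists:
  assumes j: "j \<in> J" and v: "v \<in> M0" "v \<noteq> 0"
  shows "\<exists>lam. \<exists>u\<in>M0. u \<noteq> 0 \<and> X j u = s lam u"
proof (rule ccontr)
  assume "\<not> ?thesis"
  then have no: "X j u - s lam u \<noteq> 0" if "u \<in> M0" "u \<noteq> 0" for lam u using that by auto
  have poly_op_ne: "poly_op j p v \<noteq> 0" if "p \<noteq> 0" for p
    using that
  proof (induction "degree p" arbitrary: p rule: less_induct)
    case less
    show ?case
    proof (cases "degree p = 0")
      case True
      then obtain a where "p = [:a:]" using degree_eq_zeroE by blast
      then show ?thesis using less.prems v(2) by simp
    next
      case False
      then have "\<not> constant (poly p)" by (simp add: constant_degree)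
      then obtain a where "poly p a = 0" using fundamental_theorem_of_algebra by blast
      then obtain q where q: "p = [:- a, 1:] * q" using poly_eq_0_iff_dvd by (metis dvdE)
      have q0: "q \<noteq> 0" using less.prems q by auto
      then have "degree p = 1 + degree q" unfolding q by (subst degree_mult_eq) auto
      then have "poly_op j q v \<noteq> 0" using less.hyps q0 by simp
      then show ?thesis unfolding q poly_op_root by (intro no poly_op_mem[OF j v(1)])
    qed
  qed
  have "\<exists>u\<in>M0. X j u - s lam u = v" for lam
  proof -
    let ?R = "{X j u - s lam u | u. u \<in> M0}"
    let ?v = "X j v - s lam v"
    have R: "subspace ?R"
    proof (rule subspaceI)
      show "0 \<in> ?R" using subspace_0[OF M0] by (intro CollectI exI[of _ 0]) simp
      fix x y assume "x \<in> ?R" "y \<in> ?R"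
      then obtain a b where "x = X j a - s lam a" "y = X j b - s lam b" "a \<in> M0" "b \<in> M0" by auto
      then show "x + y \<in> ?R" using subspace_add[OF M0]
        by (intro CollectI exI[of _ "a + b"]) (simp add: X_add scale_right_distrib)
    next
      fix z x assume "x \<in> ?R"
      then obtain a where "x = X j a - s lam a" "a \<in> M0" by auto
      then show "s z x \<in> ?R" using subspace_scale[OF M0]
        by (intro CollectI exI[of _ "s z a"]) (simp add: X_scale scale_right_diff_distrib mult.commute)
    qed
    have vm: "?v \<in> M0" using j v by (intro subspace_diff[OF M0] X_mem subspace_scale[OF M0])
    have "span {foldr X is ?v | is. set is \<subseteq> J} \<subseteq> ?R"
    proof (rule span_minimal[OF _ R], clarify)
      fix "is" assume i: "set is \<subseteq> J"
      show "\<exists>u. foldr X is ?v = X j u - s lam u \<and> u \<in> M0"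
        using i j v by (intro exI[of _ "foldr X is v"]) (simp add: words_diff words_scale words_comm words_mem)
    qed
    moreover have "v \<in> span {foldr X is ?v | is. set is \<subseteq> J}"
      using cyclic[OF vm no[OF v]] v(1) by blast
    ultimately show ?thesis by auto
  qed
  then obtain U where U: "\<And>lam. U lam \<in> M0" "\<And>lam. X j (U lam) - s lam (U lam) = v" by metis
  have XU: "X j (U lam) = s lam (U lam) + v" for lam using U(2)[of lam] by (simp add: algebra_simps)
  have indep: "p = 0 \<and> (\<forall>lam\<in>A. c lam = 0)"
    if "finite A" "poly_op j p v + (\<Sum>lam\<in>A. s (c lam) (U lam)) = 0" for A p c
    using that
  proof (induction A arbitrary: p c rule: finite_induct)
    case empty
    then show ?case using poly_op_ne by auto
  next
    case (insert m A)
    \<comment> \<open>multiplying a relation by $X - m$ turns the fraction with pole \<open>m\<close> into a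
      constant\<close>
    let ?p = "[:- m, 1:] * p + [:\<Sum>lam\<in>insert m A. c lam:]"
    have Xs: "X j (sum h B) = (\<Sum>i\<in>B. X j (h i))" for h and B :: "complex set"
      by (induction B rule: infinite_finite_induct) (auto simp: X_add)
    let ?w = "poly_op j p v + (\<Sum>lam\<in>insert m A. s (c lam) (U lam))"
    have "poly_op j ?p v + (\<Sum>lam\<in>A. s (c lam * (lam - m)) (U lam)) = X j ?w - s m ?w"
    proof -
      have "X j ?w - s m ?w = (X j (poly_op j p v) - s m (poly_op j p v)) +
          (\<Sum>lam\<in>insert m A. s (c lam) (X j (U lam)) - s m (s (c lam) (U lam)))"
        by (simp only: X_add Xs X_scale scale_right_distrib scale_sum_right sum_subtractf) (simp add: algebra_simps)
      also have "(\<Sum>lam\<in>insert m A. s (c lam) (X j (U lam)) - s m (s (c lam) (U lam))) =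
          (\<Sum>lam\<in>insert m A. s (c lam) v + s (c lam * (lam - m)) (U lam))"
        by (intro sum.cong refl) (simp add: XU scale_right_distrib right_diff_distrib scale_left_diff_distrib mult.commute)
      also have "\<dots> = s (\<Sum>lam\<in>insert m A. c lam) v + (\<Sum>lam\<in>A. s (c lam * (lam - m)) (U lam))"
        using insert.hyps by (simp add: sum.distrib scale_sum_left scale_left_distrib add.assoc)
      finally show ?thesis by (simp add: poly_op_add poly_op_root del: mult_pCons_left)
    qed
    then have "poly_op j ?p v + (\<Sum>lam\<in>A. s (c lam * (lam - m)) (U lam)) = 0"
      using insert.prems by simp
    from insert.IH[OF this]
    have p: "?p = 0" and c: "\<forall>lam\<in>A. c lam * (lam - m) = 0" by blast+
    have cA: "\<forall>lam\<in>A. c lam = 0" using c insert.hyps by auto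
    then have "(\<Sum>lam\<in>insert m A. c lam) = c m" using insert.hyps by simp
    then have "poly ([:- m, 1:] * p + [:c m:]) m = 0" using p by simp
    then have cm: "c m = 0" by simp
    then have "[:- m, 1:] * p = 0" using p \<open>(\<Sum>lam\<in>insert m A. c lam) = c m\<close> by simp
    then have "p = 0" by (metis mult_eq_0_iff pCons_eq_0_iff one_neq_zero)
    then show ?case using cA cm by simp
  qed
  have U_inj: "inj U"
  proof (rule injI, rule ccontr)
    fix a b assume ab: "U a = U b" "a \<noteq> b"
    have "poly_op j 0 v + (\<Sum>lam\<in>{a, b}. s (if lam = a then 1 else -1) (U lam)) = 0"
      using ab by simp
    then show False using indep[of "{a, b}" 0 "\<lambda>lam. if lam = a then 1 else -1"] by auto
  qed
  \<comment> \<open>enumeration of the words applied to \<open>v\<close>\<close>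
  define f where "f n = foldr X (from_nat n) v" for n
  have "{foldr X is v | is. set is \<subseteq> J} \<subseteq> range f"
  proof clarify
    fix "is" :: "nat list"
    show "foldr X is v \<in> range f" by (rule range_eqI[of _ _ "to_nat is"]) (simp add: f_def)
  qed
  then have "span {foldr X is v | is. set is \<subseteq> J} \<subseteq> span (range f)" by (rule span_mono)
  then have "U lam \<in> span (range f)" for lam using cyclic[OF v] U(1)[of lam] by blast
  then have "\<exists>n. U lam \<in> span (f ` {..<n})" for lam by (rule span_range_finite)
  then have cover: "(UNIV :: complex set) = (\<Union>n. {lam. U lam \<in> span (f ` {..<n})})" by auto
  \<comment> \<open>each of these spans has finite dimension, so it contains only finitely many of the
    \<open>U lam\<close>\<close>
  have "finite {lam. U lam \<in> span (f ` {..<n})}" for n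
  proof -
    let ?B = "{lam. U lam \<in> span (f ` {..<n})}"
    have "independent (U ` ?B)"
    proof
      assume "dependent (U ` ?B)"
      then obtain S u x where S: "finite S" "S \<subseteq> U ` ?B" "x \<in> S" "u x \<noteq> 0" "(\<Sum>v\<in>S. s (u v) v) = 0"
        unfolding dependent_explicit by blast
      obtain A where A: "S = U ` A" using S(2) by (meson subset_imageE)
      have fA: "finite A" using S(1) A U_inj by (metis finite_imageD inj_on_subset subset_UNIV)
      have "(\<Sum>lam\<in>A. s (u (U lam)) (U lam)) = 0"
        using S(5) unfolding A by (subst (asm) sum.reindex) (auto intro: inj_on_subset[OF U_inj])
      then have "\<forall>lam\<in>A. u (U lam) = 0" using indep[OF fA, of 0 "\<lambda>lam. u (U lam)"] by simp
      then show False using S(3,4) A by auto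
    qed
    then have "finite (U ` ?B)"
      using independent_span_bound[of "f ` {..<n}" "U ` ?B"] by auto
    then show ?thesis using U_inj by (metis finite_imageD inj_on_subset subset_UNIV)
  qed
  then have "countable (\<Union>n. {lam. U lam \<in> span (f ` {..<n})})"
    by (intro countable_UN) (auto intro: countable_finite)
  then show False using cover uncountable_UNIV_complex by simp
qed

text \<open>An eigenspace is invariant under the operators that commute with \<open>X j\<close>, so it is
  everything.\<close>

lemma operators_scalar:
  assumes j: "j \<in> J" and v: "v \<in> M0" "v \<noteq> 0"
  shows "\<exists>lam. \<forall>u\<in>M0. X j u = s lam u"
proof -
  obtain lam u where u: "u \<in> M0" "u \<noteq> 0" "X j u = s lam u" using eigenvector_exists[OF assms] by blast
  have "span {foldr X is u | is. set is \<subseteq> J} \<subseteq> {x. X j x = s lam x}"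
  proof (rule span_minimal)
    show "subspace {x. X j x = s lam x}"
      by (auto simp: subspace_def X_add X_scale scale_right_distrib mult.commute)
    show "{foldr X is u | is. set is \<subseteq> J} \<subseteq> {x. X j x = s lam x}"
      using u j by (auto simp: words_comm[symmetric] words_scale)
  qed
  then show ?thesis using cyclic[OF u(1,2)] by blast
qed

theorem one_dimensional:
  assumes v: "v \<in> M0" "v \<noteq> 0" shows "M0 \<subseteq> span {v}"
proof -
  have "foldr X is v \<in> span {v}" if "set is \<subseteq> J" for "is"
    using that
  proof (induction "is")
    case (Cons j "is")
    obtain lam where "\<forall>u\<in>M0. X j u = s lam u" using operators_scalar[of j, OF _ v] Cons.prems by auto
    then have "X j (foldr X is v) = s lam (foldr X is v)" using words_mem[of "is" v] Cons.prems v by simp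
    then show ?case using Cons by (simp add: span_scale)
  qed (simp add: span_base)
  then have "span {foldr X is v | is. set is \<subseteq> J} \<subseteq> span {v}" by (intro span_minimal subspace_span) auto
  then show ?thesis using cyclic[OF v] by blast
qed

end

section \<open>Irreducible modules\<close>

context va_action
begin

text \<open>The vectors $a(n) v$ span a submodule, without iteration: the Borcherds identity expresses
  $a(p) b(q) v$ by vectors $(a(n)b)(k) v$ and by $a(p') b(q+j) v$ with $j > 0$, and $b(q) v = 0$
  for large \<open>q\<close> starts the induction. The first exponent \<open>N2\<close> of the identity is taken so large
  that the terms with $a$ acting first on \<open>v\<close> vanish.\<close>

lemma cyclic_span_closed:
  assumes tr: "\<And>a u. \<exists>N. \<forall>n\<ge>N. act a n u = 0"
    and u: "u \<in> M.span {act b n v | b n. True}"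
  shows "act a p u \<in> M.span {act b n v | b n. True}" (is "_ \<in> ?U")
proof -
  have gen: "act a p (act b q v) \<in> ?U" for a b p q
  proof -
    obtain N1 where N1: "\<And>n. n \<ge> N1 \<Longrightarrow> act b n v = 0" using tr by blast
    obtain N2 where N2: "\<And>n. n \<ge> N2 \<Longrightarrow> act a n v = 0" using tr by blast
    have "act a p (act b q v) \<in> ?U" if "q \<ge> N1 - int k" for k p q
      using that
    proof (induction k arbitrary: p q)
      case 0 then show ?case by (simp add: N1 M.span_zero)
    next
      case (Suc k)
      let ?n = "p - N2"
      have "\<exists>N>0. (\<Sum>j<N. sM (of_int N2 gchoose j) (act (Y a (?n + int j) b) (N2 + q - int j) v)) =
      (\<Sum>j<N. sM ((-1) ^ j * (of_int ?n gchoose j))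
        (act a (N2 + ?n - int j) (act b (q + int j) v)
         - sM ((-1) powi ?n) (act b (?n + q - int j) (act a (N2 + int j) v))))"
        using eventually_happens'[OF sequentially_bot eventually_conj[OF eventually_gt_at_top[of 0] borcherds[of N2 a ?n b q v]]]
        by blast
      then obtain N where N: "N > 0" "(\<Sum>j<N. sM (of_int N2 gchoose j) (act (Y a (?n + int j) b) (N2 + q - int j) v)) =
      (\<Sum>j<N. sM ((-1) ^ j * (of_int ?n gchoose j))
        (act a (N2 + ?n - int j) (act b (q + int j) v)
         - sM ((-1) powi ?n) (act b (?n + q - int j) (act a (N2 + int j) v))))" (is "?L = ?R") by blast
      obtain K where K: "N = Suc K" using N(1) gr0_implies_Suc by blast
      have z: "act a (N2 + int j) v = 0" for j by (rule N2) simp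
      let ?t = "\<lambda>j. sM ((-1) ^ j * (of_int ?n gchoose j)) (act a (N2 + ?n - int j) (act b (q + int j) v))"
      have "?R = (\<Sum>j<N. ?t j)" unfolding z by simp
      also have "\<dots> = act a p (act b q v) + (\<Sum>j<K. ?t (Suc j))"
        unfolding K sum.lessThan_Suc_shift by simp
      finally have e: "act a p (act b q v) = ?L - (\<Sum>j<K. ?t (Suc j))" using N(2) by simp
      have "?L \<in> ?U" by (intro M.span_sum M.span_scale M.span_base) blast
      moreover have "(\<Sum>j<K. ?t (Suc j)) \<in> ?U"
        using Suc by (intro M.span_sum M.span_scale Suc.IH) auto
      ultimately show ?case unfolding e by (rule M.span_diff)
    qed
    from this[where k = "nat (N1 - q)" and q = q and p = p] show ?thesis by simp
  qed
  show ?thesis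
    using u
  proof (induction rule: M.span_induct_alt)
    case (step z x y)
    then show ?case using gen by (auto simp: act_arg_add act_arg_scale intro!: M.span_add M.span_scale)
  qed (simp add: M.span_zero)
qed

end

context verma_va
begin

lemma YY_trunc: "\<exists>N. \<forall>n\<ge>N. YY a n b = 0"
proof -
  obtain N where "\<forall>n\<ge>N. Y (th a) n (th b) = \<zero>\<^bsub>M_space c\<^esub>"
    using va_moduleD(7)[OF va_mod, of "th a" "th b"] by auto
  then show ?thesis using em_0 by (intro exI[of _ N]) (simp add: YY_def)
qed

lemma vac_V: "vac V = th' one"
  by (simp add: V_simple_def th'_def q_def one_def M_empty_carrier)

text \<open>By irreducibility the $a(n) v$ span \<open>M\<close> for every nonzero \<open>v\<close> of degree $0$. In degree $0$
  only the zero modes contribute, and since $o$ is a representation of the Zhu algebra these are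
  polynomials in the commuting operators $o(w_r)$. There are countably many generators, so the
  component of degree $0$ is a line.\<close>

theorem irreducible_highest_weight:
  fixes M :: "(complex, 'm) module"
  assumes adm: "admissible V M act gr" and irr: "va_irreducible V M act" and gr0: "gr 0 \<noteq> {\<zero>\<^bsub>M\<^esub>}"
  shows "highest_weight_module V M act gr"
proof -
  have vm: "va_module V M act" and ds: "direct_sum M gr" and gr_neg: "\<And>n. n < 0 \<Longrightarrow> gr n = {\<zero>\<^bsub>M\<^esub>}"
    and gr_act: "\<And>m a n k u. a \<in> wt V m \<Longrightarrow> u \<in> gr k \<Longrightarrow> act a n u \<in> gr (m + k - n - 1)"
    using adm unfolding admissible_def by blast+
  have gr_sub: "subspace_of (gr n) M" for n using ds by (simp add: direct_sum_def)
  obtain prj emb where "realization (pm_scale :: _ \<Rightarrow> ('m \<Rightarrow>\<^sub>0 complex) \<Rightarrow> _) M prj emb"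
    using realization_exists[OF va_moduleD(1)[OF vm]] by blast
  then interpret R: realization "pm_scale :: _ \<Rightarrow> ('m \<Rightarrow>\<^sub>0 complex) \<Rightarrow> _" M prj emb .
  have gr_carrier: "gr n \<subseteq> carrier M" for n using R.Q.submoduleE(1)[OF gr_sub] .
  define act' where "act' a n u = emb (act (th' a) n (prj u))" for a n u
  have tr_V: "\<exists>N. \<forall>n\<ge>N. nprod V X n X' = \<zero>\<^bsub>V\<^esub>" if X: "X \<in> carrier V" "X' \<in> carrier V" for X X'
  proof -
    obtain a b where ab: "X = th' a" "X' = th' b" using X unfolding carrier_V by blast
    obtain N where "\<forall>n\<ge>N. YY a n b = 0" using YY_trunc by blast
    then show ?thesis by (intro exI[of _ N]) (simp add: ab nprod_V)
  qed
  have act'_eq: "(\<lambda>a n u. emb (act (th' a) n (prj u))) = act'" by (simp add: fun_eq_iff act'_def)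
  have va: "va_action s pm_scale YY act'"
    using linear_into_realization_of_vertex_action[OF vm R.realization_axioms V.linear_into_axioms nprod_V tr_V]
    unfolding act'_eq .
  have act_cl: "act (th' a) n (prj u) \<in> carrier M" for a n u by (rule va_moduleD(2)[OF vm]) auto
  have prj_act': "prj (act' a n u) = act (th' a) n (prj u)" for a n u by (simp add: act'_def act_cl)
  \<comment> \<open>the graded components inside the copy of the module\<close>
  define Gr where "Gr k = {u. emb (prj u) = u \<and> prj u \<in> gr k}" for k
  have Gr_sub: "pm.subspace (Gr k)" for k
  proof (rule pm.subspaceI)
    have sub: "pm.subspace {u. prj u \<in> gr k}" by (rule R.subspace_vimage[OF gr_sub])
    show "0 \<in> Gr k" using pm.subspace_0[OF sub] R.em_0 by (simp add: Gr_def)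
    show "x + y \<in> Gr k" if "x \<in> Gr k" "y \<in> Gr k" for x y
      using pm.subspace_add[OF sub, of x y] that by (simp add: Gr_def R.em_th_add)
    show "pm_scale z x \<in> Gr k" if "x \<in> Gr k" for z x
      using pm.subspace_scale[OF sub, of x z] that by (simp add: Gr_def R.em_th_scale)
  qed
  have Gr_act: "act' a n u \<in> Gr (m + k - n - 1)" if "a \<in> E m" "u \<in> Gr k" for a m n u k
  proof -
    have "act (th' a) n (prj u) \<in> gr (m + k - n - 1)"
      using that by (intro gr_act) (simp_all add: Gr_def wt_V)
    then show ?thesis by (simp add: Gr_def act'_def act_cl)
  qed
  have Gr_neg: "Gr k = {0}" if "k < 0" for k
  proof
    show "Gr k \<subseteq> {0}"
    proof
      fix u assume u: "u \<in> Gr k"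
      then have "prj u = \<zero>\<^bsub>M\<^esub>" using gr_neg[OF that] by (simp add: Gr_def)
      then have "emb (prj u) = 0" using R.em_0 by simp
      then show "u \<in> {0}" using u by (simp add: Gr_def)
    qed
    show "{0} \<subseteq> Gr k" using pm.subspace_0[OF Gr_sub] by simp
  qed
  have act'_vac: "act' one (-1) u = emb (prj u)" for u
    using va_moduleD(8)[OF vm, of "prj u" "-1"] by (simp add: act'_def vac_V)
  interpret N: va_action s pm_scale YY act' by (rule va)
  interpret B: graded_va_module s YY "\<lambda>m. E (int m)" T cmp one pm_scale act' "Gr 0"
  proof
    show "pm.subspace (Gr 0)" by (rule Gr_sub)
    fix a u and m :: nat assume a: "a \<in> E (int m)" and u: "u \<in> Gr 0"
    show "act' a n u = 0" if "n \<ge> int m" for n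
      using Gr_act[OF a u, of n] Gr_neg[of "int m + 0 - n - 1"] that by simp
    show "act' a (int m - 1) u \<in> Gr 0" using Gr_act[OF a u, of "int m - 1"] by simp
  next
    fix u assume "u \<in> Gr 0" then show "act' one (-1) u = u" by (simp add: act'_vac Gr_def)
  qed
  have tr': "\<exists>N. \<forall>n\<ge>N. act' a n u = 0" for a u
  proof -
    obtain N where "\<forall>n\<ge>N. act (th' a) n (prj u) = \<zero>\<^bsub>M\<^esub>"
      using va_moduleD(7)[OF vm, of "th' a" "prj u"] by auto
    then show ?thesis using R.em_0 by (intro exI[of _ N]) (simp add: act'_def)
  qed
  \<comment> \<open>The $a(n) v$ span a submodule, which contains \<open>v\<close> as the value of the mode $-1$ of
    the vacuum.\<close>
  have all: "u \<in> pm.span {act' a n v | a n. True}" if v: "v \<in> Gr 0" "v \<noteq> 0" and u: "emb (prj u) = u" for u v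
  proof -
    let ?U = "pm.span {act' a n v | a n. True}" let ?H = "{x \<in> carrier M. emb x \<in> ?U}"
    have "va_submodule V M act ?H"
      unfolding va_submodule_def
    proof (intro conjI ballI allI)
      show "subspace_of ?H M" by (rule R.subspace_of_em[OF pm.subspace_span])
      fix X n x assume X: "X \<in> carrier V" and x: "x \<in> ?H"
      obtain a where a: "X = th' a" using X unfolding carrier_V by blast
      have xc: "x \<in> carrier M" and xU: "emb x \<in> ?U" using x by (simp_all only: mem_Collect_eq)
      have "emb (act X n x) = act' a n (emb x)" unfolding act'_def a R.th_em[OF xc] ..
      moreover have "act' a n (emb x) \<in> ?U" by (rule N.cyclic_span_closed[OF tr' xU])
      ultimately have "emb (act X n x) \<in> ?U" by (simp only:)
      moreover have "act X n x \<in> carrier M" by (rule va_moduleD(2)[OF vm X xc])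
      ultimately show "act X n x \<in> ?H" by (simp only: mem_Collect_eq)
    qed
    then have dichotomy: "?H = {\<zero>\<^bsub>M\<^esub>} \<or> ?H = carrier M" using irr unfolding va_irreducible_def by blast
    have v_emb: "emb (prj v) = v" using v(1) by (simp add: Gr_def)
    have "act' one (-1) v \<in> ?U" by (rule pm.span_base) blast
    then have "emb (prj v) \<in> ?U" by (simp only: act'_vac)
    then have vH: "prj v \<in> ?H" by simp
    have v0: "prj v \<noteq> \<zero>\<^bsub>M\<^esub>"
    proof
      assume "prj v = \<zero>\<^bsub>M\<^esub>"
      then have "emb (prj v) = 0" using R.em_0 by simp
      then show False using v_emb v(2) by simp
    qed
    from dichotomy have H: "?H = carrier M"
    proof
      assume "?H = {\<zero>\<^bsub>M\<^esub>}"
      with vH have "prj v \<in> {\<zero>\<^bsub>M\<^esub>}" by (simp only:)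
      then show ?thesis using v0 by simp
    qed
    have "prj u \<in> ?H" unfolding H by (rule R.th_closed)
    then have "emb (prj u) \<in> ?U" by blast
    then show ?thesis by (simp only: u)
  qed
  \<comment> \<open>Split $a(n) v$ into the contributions of the homogeneous components of \<open>a\<close>; the
    decomposition into degrees is unique, so for \<open>u\<close> of degree \<open>0\<close> the part of degree \<open>0\<close>, which
    consists of zero modes, is \<open>u\<close>.\<close>
  have zero_modes: "u \<in> pm.span {B.om a v | a. True}" if v: "v \<in> Gr 0" "v \<noteq> 0" and u: "u \<in> Gr 0" for u v
  proof -
    let ?Z = "pm.span {B.om a v | a. True}"
    define P where "P x f \<longleftrightarrow> finite {i. f i \<noteq> 0} \<and> (\<forall>i::int. f i \<in> Gr i) \<and> x = (\<Sum>i | f i \<noteq> 0. f i)" for x f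
    have P0: "P 0 (\<lambda>i. 0)" using pm.subspace_0[OF Gr_sub] by (auto simp: P_def)
    have Padd: "P (x + y) (\<lambda>i. f i + g i)" if f: "P x f" and g: "P y g" for x y f g
    proof -
      let ?S = "{i. f i \<noteq> 0} \<union> {i. g i \<noteq> 0}"
      have S: "finite ?S" "{i. f i + g i \<noteq> 0} \<subseteq> ?S" using f g by (auto simp: P_def)
      have "(\<Sum>i | f i + g i \<noteq> 0. f i + g i) = (\<Sum>i\<in>?S. f i + g i)"
        using S by (intro sum.mono_neutral_left) auto
      moreover have "(\<Sum>i | f i \<noteq> 0. f i) = sum f ?S" "(\<Sum>i | g i \<noteq> 0. g i) = sum g ?S"
        using S(1) by (intro sum.mono_neutral_left; auto)+
      ultimately have "x + y = (\<Sum>i | f i + g i \<noteq> 0. f i + g i)" using f g by (simp add: P_def sum.distrib)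
      then show ?thesis using f g finite_subset[OF S(2,1)] pm.subspace_add[OF Gr_sub] by (auto simp: P_def)
    qed
    have Psingle: "P x (\<lambda>i. if i = k then x else 0)" if "x \<in> Gr k" for x k
      using that pm.subspace_0[OF Gr_sub] by (cases "x = 0") (auto simp: P_def)
    have Pdec: "decomposes M gr (prj x) (\<lambda>i. prj (f i))" if f: "P x f" for x f
    proof -
      have sup: "{i. prj (f i) \<noteq> \<zero>\<^bsub>M\<^esub>} \<subseteq> {i. f i \<noteq> 0}" using R.th_0 by auto
      have "fin_sum M (\<lambda>i. prj (f i)) = prj (\<Sum>i | f i \<noteq> 0. f i)"
        using f by (intro R.fin_sum_th) (auto simp: P_def)
      then show ?thesis
        using f finite_subset[OF sup] by (auto simp: decomposes_def Gr_def P_def)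
    qed
    have step: "\<exists>f. P x f \<and> f 0 \<in> ?Z" if "x \<in> pm.span {act' a n v | a n. True}" for x
      using that
    proof (induction rule: pm.span_induct_alt)
      case base then show ?case using P0 pm.span_zero by blast
    next
      case (step z x y)
      obtain a n where x: "x = act' a n v" using step(1) by blast
      obtain g where g: "P y g" "g 0 \<in> ?Z" using step(2) by blast
      have comp: "act' (cmp m a) n v \<in> Gr (int m - n - 1)" for m
        using Gr_act[OF _ v(1), of "cmp m a" "int m" n] G.cmp_weight by simp
      let ?A = "{m. cmp m a \<noteq> 0}"
      have x': "x = (\<Sum>m\<in>?A. act' (cmp m a) n v)"
      proof -
        have "act' a n v = act' (pr a) n v" by (simp add: act'_def th'_pr)
        then show ?thesis unfolding x hsum_cmp[symmetric] by (simp add: N.act_sum)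
      qed
      have fin: "finite ?A" by (rule G.cmp_finite)
      have part: "\<exists>f. P (s' + y) f \<and> f 0 \<in> ?Z" if "s' = pm_scale z (\<Sum>m\<in>S. act' (cmp m a) n v)" "finite S" for S s'
        using that(2,1)
      proof (induction S arbitrary: s' rule: finite_induct)
        case empty then show ?case using g by auto
      next
        case (insert m S)
        obtain f where f: "P (pm_scale z (\<Sum>m\<in>S. act' (cmp m a) n v) + y) f" "f 0 \<in> ?Z"
          using insert.IH by blast
        let ?x = "pm_scale z (act' (cmp m a) n v)" let ?k = "int m - n - 1"
        have x1: "?x \<in> Gr ?k" by (rule pm.subspace_scale[OF Gr_sub comp])
        have e: "s' + y = ?x + (pm_scale z (\<Sum>m\<in>S. act' (cmp m a) n v) + y)"
          using insert.hyps insert.prems by (simp add: pm.scale_right_distrib add.assoc)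
        have "P (s' + y) (\<lambda>i. (if i = ?k then ?x else 0) + f i)"
          unfolding e by (rule Padd[OF Psingle[OF x1] f(1)])
        moreover have "(if 0 = ?k then ?x else 0) + f 0 \<in> ?Z"
        proof (cases "?k = 0")
          case True
          then have "n = int m - 1" by simp
          then have om: "act' (cmp m a) n v = B.om (cmp m a) v" using B.om_hom[OF G.cmp_weight] by simp
          have "?x \<in> ?Z" unfolding om by (intro pm.span_scale pm.span_base) blast
          then show ?thesis using f(2) True by (simp add: pm.span_add)
        next
          case False then show ?thesis using f(2) by simp
        qed
        ultimately show ?case by blast
      qed
      show ?case using part[OF _ fin, of "pm_scale z x"] x' by simp
    qed
    have "u \<in> pm.span {act' a n v | a n. True}" using u by (intro all v) (simp add: Gr_def)
    then obtain f where f: "P u f" "f 0 \<in> ?Z" using step by blast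
    have uniq: "\<exists>!x. A x \<Longrightarrow> A g \<Longrightarrow> A h \<Longrightarrow> g = h" for A and g h :: "int \<Rightarrow> 'm" by blast
    have "\<exists>!h. decomposes M gr (prj u) h" using ds unfolding direct_sum_def by (simp only: R.th_closed)
    then have "(\<lambda>i. prj (f i)) = (\<lambda>i. prj (if i = 0 then u else 0))"
      by (rule uniq[where A = "decomposes M gr (prj u)"]) (rule Pdec, rule f(1), rule Pdec, rule Psingle, rule u)
    from fun_cong[OF this, of 0] have p: "prj (f 0) = prj u" by (simp only: if_True simp_thms)
    have "f 0 \<in> Gr 0" using f(1) unfolding P_def by blast
    then have "f 0 = emb (prj (f 0))" by (simp only: Gr_def mem_Collect_eq)
    also have "\<dots> = emb (prj u)" by (simp only: p)
    also have "\<dots> = u" using u by (simp only: Gr_def mem_Collect_eq)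
    finally have "f 0 = u" .
    then show ?thesis using f(2) by simp
  qed
  interpret C: commuting_operators pm_scale "Gr 0" "{r. odd r}" "\<lambda>r. B.om (w r)"
  proof
    show "pm.subspace (Gr 0)" by (rule Gr_sub)
    fix i j :: nat and u assume "i \<in> {r. odd r}" "j \<in> {r. odd r}" and u: "u \<in> Gr 0"
    have "B.om (G.star (w i) (w j) - G.star (w j) (w i)) u = 0"
      by (rule B.om_O[OF Z.star_comm u])
    moreover have "B.om (x - y) u = B.om x u - B.om y u" for x y
      using B.om_add[of "x - y" y u] by (simp add: eq_diff_eq)
    ultimately show "B.om (w i) (B.om (w j) u) = B.om (w j) (B.om (w i) u)"
      by (simp add: B.om_star[OF u])
  next
    fix v assume v: "v \<in> Gr 0" "v \<noteq> 0"
    let ?W = "pm.span {foldr (\<lambda>r. B.om (w r)) is v | is. set is \<subseteq> {r. odd r}}"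
    have words: "B.om (foldr (\<lambda>i. G.star (w i)) is one) v = foldr (\<lambda>r. B.om (w r)) is v" for "is"
      by (induction "is") (simp_all add: B.om_vac[OF v(1)] B.om_star[OF v(1)])
    have "B.om x v \<in> ?W" if "x \<in> F.span ({foldr (\<lambda>i. G.star (w i)) is one | is. set is \<subseteq> {r. odd r}} \<union> G.O_sub)" for x
      using that
    proof (induction rule: F.span_induct_alt)
      case base then show ?case by (simp add: pm.span_zero)
    next
      case (step z x y)
      have "B.om x v \<in> ?W"
      proof (cases "x \<in> G.O_sub")
        case True then show ?thesis using B.om_O[OF _ v(1)] by (simp add: pm.span_zero)
      next
        case False
        then obtain "is" where i: "x = foldr (\<lambda>i. G.star (w i)) is one" "set is \<subseteq> {r. odd r}" using step(1) by blast
        then show ?thesis unfolding i(1) words by (intro pm.span_base) blast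
      qed
      then show ?case using step(2) by (simp add: B.om_add B.om_scale pm.span_add pm.span_scale)
    qed
    then have "B.om (G.hsum a) v \<in> ?W" for a using Z.w_span[of a] by (simp only:)
    then have om: "B.om a v \<in> ?W" for a by (simp only: B.om_hsum)
    show "Gr 0 \<subseteq> ?W"
    proof
      fix u assume "u \<in> Gr 0"
      then have "u \<in> pm.span {B.om a v | a. True}" by (rule zero_modes[OF v])
      moreover have "pm.span {B.om a v | a. True} \<subseteq> ?W" by (rule pm.span_minimal[OF _ pm.subspace_span]) (use om in \<open>clarify, simp only:\<close>)
      ultimately show "u \<in> ?W" by (rule subsetD[rotated])
    qed
  qed (rule B.om_arg_add B.om_arg_scale B.om_mem, assumption?)+
  have gr_emb: "emb x \<in> Gr k" if "x \<in> gr k" for x k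
    using that subsetD[OF gr_carrier that] by (simp add: Gr_def)
  have "\<zero>\<^bsub>M\<^esub> \<in> gr 0" using pm.subspace_0[OF Gr_sub[of 0]] by (simp add: Gr_def)
  then obtain v where v: "v \<in> gr 0" "v \<noteq> \<zero>\<^bsub>M\<^esub>" using gr0 by blast
  have vc: "v \<in> carrier M" using v gr_carrier by blast
  have ev: "emb v \<in> Gr 0" "emb v \<noteq> 0"
    using gr_emb[OF v(1)] v(2) R.em_inj[OF vc, of "\<zero>\<^bsub>M\<^esub>"] by simp_all
  have line: "gr 0 = {z \<odot>\<^bsub>M\<^esub> v | z. True}"
  proof
    show "gr 0 \<subseteq> {z \<odot>\<^bsub>M\<^esub> v | z. True}"
    proof
      fix x assume x: "x \<in> gr 0"
      then have xc: "x \<in> carrier M" using gr_carrier by blast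
      then have "emb x \<in> pm.span {emb v}" using subsetD[OF C.one_dimensional[OF ev] gr_emb[OF x]] by (simp only:)
      then obtain z where "emb x = pm_scale z (emb v)" by (auto simp: pm.span_singleton)
      also have "\<dots> = emb (z \<odot>\<^bsub>M\<^esub> v)" using vc by (simp add: R.em_scale)
      finally have "x = z \<odot>\<^bsub>M\<^esub> v" using R.em_inj[OF xc, of "z \<odot>\<^bsub>M\<^esub> v"] vc by simp
      then show "x \<in> {z \<odot>\<^bsub>M\<^esub> v | z. True}" by blast
    qed
    show "{z \<odot>\<^bsub>M\<^esub> v | z. True} \<subseteq> gr 0" using R.Q.submoduleE(4)[OF gr_sub[of 0]] v by auto
  qed
  have gen: "va_generated V M act x = carrier M" if x: "x \<in> gr 0" "x \<noteq> \<zero>\<^bsub>M\<^esub>" for x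
  proof -
    have "subspace_of (carrier M) M" by (rule R.Q.submoduleI) auto
    then have top: "va_submodule V M act (carrier M)" using va_moduleD(2)[OF vm] by (simp add: va_submodule_def)
    have only: "H = carrier M" if "va_submodule V M act H" "x \<in> H" for H
      proof -
      have "H = {\<zero>\<^bsub>M\<^esub>} \<or> H = carrier M" using irr that(1) unfolding va_irreducible_def by (simp only:)
      then show ?thesis using that(2) x(2) by auto
    qed
    have xM: "x \<in> carrier M" using subsetD[OF gr_carrier x(1)] .
    have "{H. va_submodule V M act H \<and> x \<in> H} = {carrier M}"
    proof
      show "{H. va_submodule V M act H \<and> x \<in> H} \<subseteq> {carrier M}" using only by blast
      show "{carrier M} \<subseteq> {H. va_submodule V M act H \<and> x \<in> H}" using top xM by blast
    qed
    then show ?thesis by (simp add: va_generated_def)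
  qed
  show ?thesis
    unfolding highest_weight_module_def
  proof (intro conjI ballI impI)
    show "\<exists>v\<in>gr 0. v \<noteq> \<zero>\<^bsub>M\<^esub> \<and> gr 0 = {z \<odot>\<^bsub>M\<^esub> v | z. True}"
      by (rule bexI[OF _ v(1)]) (rule conjI, rule v(2), rule line)
  qed (rule gen)
qed

end

theorem theorem13p1:
  fixes c :: complex
    and Y :: "M_elem \<Rightarrow> int \<Rightarrow> M_elem \<Rightarrow> M_elem"
  assumes "state_field_map c Y"
  shows "(\<forall>x\<in>carrier (zhu_algebra (V_simple c Y)). \<forall>y\<in>carrier (zhu_algebra (V_simple c Y)).
            x \<otimes>\<^bsub>zhu_algebra (V_simple c Y)\<^esub> y = y \<otimes>\<^bsub>zhu_algebra (V_simple c Y)\<^esub> x)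
    \<and> (\<forall>(M :: (complex, 'm) module) act gr.
          admissible (V_simple c Y) M act gr \<and> va_irreducible (V_simple c Y) M act
            \<and> gr 0 \<noteq> {\<zero>\<^bsub>M\<^esub>}
          \<longrightarrow> highest_weight_module (V_simple c Y) M act gr)"
proof -
  have "va_module (M_with c Y) (M_with c Y) Y"
    using assms by (simp add: state_field_map_def vertex_algebra_def)
  then have "Module.module complex_ring (M_with c Y)" by (rule va_moduleD(1))
  then obtain th em where R: "realization (pm_scale :: _ \<Rightarrow> (M_elem \<Rightarrow>\<^sub>0 complex) \<Rightarrow> _) (M_with c Y) th em"
    using realization_exists by blast
  interpret verma_va "pm_scale :: _ \<Rightarrow> (M_elem \<Rightarrow>\<^sub>0 complex) \<Rightarrow> _" c Y th em
    using R assms by (intro verma_va.intro verma_va_axioms.intro)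
  show ?thesis
  proof (intro conjI ballI allI impI, goal_cases)
    case (1 x y)
    then show ?case by (rule zhu_algebra_commutative)
  next
    case (2 M act gr)
    then show ?case by (elim conjE) (rule irreducible_highest_weight)
  qed
qed

end
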